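(* Let $A=[a_1|\cdots|a_N]:\mathbb{R}^N\to V$ be a flat arrangement of rank $d=\dim V\ge2$, with $n=d-1$, $r=N-d$, and flat-arrangement polynomial $f_A(t)=\sum_{i=0}^r\alpha_it^i$. Let $P_1,\dots,P_{N-1}\subset W$ be its projected hypersimplices, where $W$ carries the density $|\omega_W|$. Then $$\alpha_i=\operatorname{MV}_W(P_{i+1},P_{i+2},\dots,P_{i+n})\qquad(0\le i\le r).$$
   Context: $V$ is a real vector space of dimension $d$ with a nonzero alternating form $\omega_V\in\bigwedge^dV^*$. A flat arrangement in $V$ is a labeled spanning family of vectors $a_1,\dots,a_N\in V$ (repetitions allowed), viewed as a surjective linear map $A:\mathbb{R}^N\to V$, such that there is $\varphi\in V^*$ with $\varphi(a_j)=1$ for all $j$. Put $H=\varphi^{-1}(1)$ and $W=\ker\varphi$ (so $\dim W=n=d-1$). Choose $v\in H$, set $b_j=a_j-v\in W$, and give $W$ the form $\omega_W(w_1,\dots,w_n)=\omega_V(w_1,\dots,w_n,v)$, which does not depend on $v$; volumes in $W$ use the density $|\omega_W|$. A basis is a subset $B\subset[N]=\{1,\dots,N\}$ of size $d$ for which $A_B:=A|_{\mathbb{R}^B}$ is an isomorphism onto $V$; $\mathcal{B}$ is the set of bases; $w_A(B)=|\omega_V((a_b)_{b\in B})|$. A circuit vector is a nonzero vector of $\ker A$ with inclusion-minimal support. For a basis $B$ and $j\notin B$, $c^{B,j}\in\ker A$ is defined by $c^{B,j}_j=1$, $c^{B,j}_B=-A_B^{-1}a_j$, $c^{B,j}_k=0$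 for $k\notin B\sqcup\{j\}$. A vector $\rho\in\mathbb{R}^N$ is circuit-generic if $\langle\rho,z\rangle\ne0$ for every circuit vector $z$. Put $\operatorname{ext}_\rho(B)=|\{j\notin B:\langle\rho,c^{B,j}\rangle>0\}|$. The flat-arrangement polynomial is $f_A(t)=\sum_{B\in\mathcal{B}}w_A(B)t^{\operatorname{ext}_\rho(B)}$ for any circuit-generic $\rho$; it is known not to depend on $\rho$. For $1\le k\le N-1$ the projected hypersimplex is $P_k=\operatorname{conv}\{\sum_{j\in I}b_j: I\subset[N],\ |I|=k\}\subset W$. $\operatorname{MV}_W$ is mixed volume in the $n$-dimensional space $W$ (symmetric, multilinear under Minkowski sums and nonnegative scaling) normalized by $\operatorname{MV}_W(K,\dots,K)=\operatorname{vol}_W(K)$. *)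

theory Defs
  imports "HOL-Analysis.Analysis" "HOL-Computational_Algebra.Polynomial"
begin

text \<open>
  The space \<open>V\<close> is a type of class \<open>euclidean_space\<close>; only its linear structure and its (canonical)
  topology are used, never the inner product. Labels are the elements of a finite type \<open>'m\<close> with
  \<open>N = CARD('m)\<close>, so that \<open>\<real>\<^sup>N\<close> is \<open>real ^ 'm\<close>.
\<close>

definition alternating_form :: "nat \<Rightarrow> ('v::real_vector list \<Rightarrow> real) \<Rightarrow> bool" where
  "alternating_form k \<omega> \<longleftrightarrow>
     (\<forall>vs i. length vs = k \<longrightarrow> i < k \<longrightarrow> linear (\<lambda>x. \<omega> (vs[i := x]))) \<and>
     (\<forall>vs. length vs = k \<longrightarrow> \<not> distinct vs \<longrightarrow> \<omega> vs = 0)"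

definition nonzero_form :: "nat \<Rightarrow> ('v::real_vector list \<Rightarrow> real) \<Rightarrow> bool" where
  "nonzero_form k \<omega> \<longleftrightarrow> (\<exists>vs. length vs = k \<and> \<omega> vs \<noteq> 0)"


definition arr_map :: "('m::finite \<Rightarrow> 'v::real_vector) \<Rightarrow> real ^ 'm \<Rightarrow> 'v" where
  "arr_map a x = (\<Sum>j\<in>UNIV. (x $ j) *\<^sub>R a j)"

text \<open>The functional \<open>\<phi>\<close> is determined by \<open>a\<close>, because the \<open>a j\<close> span.\<close>

definition flat_arrangement :: "('m::finite \<Rightarrow> 'v::real_vector) \<Rightarrow> ('v \<Rightarrow> real) \<Rightarrow> bool" where
  "flat_arrangement a \<phi> \<longleftrightarrow> surj (arr_map a) \<and> linear \<phi> \<and> (\<forall>j. \<phi> (a j) = 1)"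

text \<open>\<open>\<real>\<^sup>B\<close> as a coordinate subspace of \<open>\<real>\<^sup>N\<close>.\<close>

definition coord_subspace :: "'m::finite set \<Rightarrow> (real ^ 'm) set" where
  "coord_subspace B = {x. \<forall>k. k \<notin> B \<longrightarrow> x $ k = 0}"

definition bases :: "('m::finite \<Rightarrow> 'v::euclidean_space) \<Rightarrow> 'm set set" where
  "bases a = {B. card B = DIM('v) \<and> bij_betw (arr_map a) (coord_subspace B) UNIV}"

text \<open>Reordering the arguments of \<open>\<omega>\<close> only changes the sign, so any enumeration of \<open>B\<close> will do.\<close>

definition basis_weight ::
    "('m::finite \<Rightarrow> 'v::real_vector) \<Rightarrow> ('v list \<Rightarrow> real) \<Rightarrow> 'm set \<Rightarrow> real" where
  "basis_weight a \<omega> B = \<bar>\<omega> (map a (SOME bs. distinct bs \<and> set bs = B))\<bar>"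

definition supp :: "real ^ 'm::finite \<Rightarrow> 'm set" where
  "supp x = {k. x $ k \<noteq> 0}"

definition circuit_vector :: "('m::finite \<Rightarrow> 'v::real_vector) \<Rightarrow> real ^ 'm \<Rightarrow> bool" where
  "circuit_vector a z \<longleftrightarrow> z \<noteq> 0 \<and> arr_map a z = 0 \<and>
     (\<forall>y. y \<noteq> 0 \<longrightarrow> arr_map a y = 0 \<longrightarrow> supp y \<subseteq> supp z \<longrightarrow> supp y = supp z)"

definition circuit_generic :: "('m::finite \<Rightarrow> 'v::real_vector) \<Rightarrow> real ^ 'm \<Rightarrow> bool" where
  "circuit_generic a \<rho> \<longleftrightarrow> (\<forall>z. circuit_vector a z \<longrightarrow> \<rho> \<bullet> z \<noteq> 0)"

definition fund_circuit ::
    "('m::finite \<Rightarrow> 'v::real_vector) \<Rightarrow> 'm set \<Rightarrow> 'm \<Rightarrow> real ^ 'm" where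
  "fund_circuit a B j = (\<chi> k. if k = j then 1
     else if k \<in> B then - (inv_into (coord_subspace B) (arr_map a) (a j) $ k)
     else 0)"

definition ext_act :: "('m::finite \<Rightarrow> 'v::real_vector) \<Rightarrow> real ^ 'm \<Rightarrow> 'm set \<Rightarrow> nat" where
  "ext_act a \<rho> B = card {j. j \<notin> B \<and> \<rho> \<bullet> fund_circuit a B j > 0}"

definition flat_poly ::
    "('m::finite \<Rightarrow> 'v::euclidean_space) \<Rightarrow> ('v list \<Rightarrow> real) \<Rightarrow> real ^ 'm \<Rightarrow> real poly" where
  "flat_poly a \<omega> \<rho> = (\<Sum>B\<in>bases a. monom (basis_weight a \<omega> B) (ext_act a \<rho> B))"


definition form_at :: "('v list \<Rightarrow> real) \<Rightarrow> 'v \<Rightarrow> 'v list \<Rightarrow> real" where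
  "form_at \<omega> v ws = \<omega> (ws @ [v])"

definition proj_hypersimplex ::
    "('m::finite \<Rightarrow> 'v::real_vector) \<Rightarrow> 'v \<Rightarrow> nat \<Rightarrow> 'v set" where
  "proj_hypersimplex a v k = convex hull {(\<Sum>j\<in>I. a j - v) | I. card I = k}"


definition basis_list :: "'v::real_vector set \<Rightarrow> 'v list \<Rightarrow> bool" where
  "basis_list W ws \<longleftrightarrow> distinct ws \<and> independent (set ws) \<and> span (set ws) = W"

text \<open>
  The measure on \<open>W\<close> with density \<open>\<bar>\<eta>\<bar>\<close>: Lebesgue measure in the coordinates of a basis \<open>ws\<close> of \<open>W\<close>,
  scaled by \<open>\<bar>\<eta> ws\<bar>\<close>. When \<open>\<eta>\<close> is a top-degree alternating form on \<open>W\<close> it does not depend on \<open>ws\<close>,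
  by the change of variables formula.
\<close>

definition density_measure ::
    "'v::euclidean_space set \<Rightarrow> ('v list \<Rightarrow> real) \<Rightarrow> 'v measure" where
  "density_measure W \<eta> = (let ws = (SOME ws. basis_list W ws) in
     scale_measure (ennreal \<bar>\<eta> ws\<bar>)
       (distr (\<Pi>\<^sub>M i\<in>{..<length ws}. lborel) borel (\<lambda>x. \<Sum>i<length ws. x i *\<^sub>R ws ! i)))"


definition convex_bodies :: "'v::euclidean_space set \<Rightarrow> 'v set set" where
  "convex_bodies W = {K. K \<subseteq> W \<and> convex K \<and> compact K \<and> K \<noteq> {}}"

definition mink_comb :: "real \<Rightarrow> 'v::real_vector set \<Rightarrow> real \<Rightarrow> 'v set \<Rightarrow> 'v set" where
  "mink_comb s K t L = {s *\<^sub>R x + t *\<^sub>R y | x y. x \<in> K \<and> y \<in> L}"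

text \<open>
  Mixed volume is the symmetric functional on \<open>dim W\<close> convex bodies in \<open>W\<close> that is multilinear under
  Minkowski sums and nonnegative scaling and restricts to \<open>\<mu>\<close>-volume on the diagonal. By polarization
  these properties determine its values on lists of \<open>dim W\<close> convex bodies; values on other lists
  are left unconstrained.
\<close>

definition is_mixed_volume ::
    "'v::euclidean_space set \<Rightarrow> 'v measure \<Rightarrow> ('v set list \<Rightarrow> real) \<Rightarrow> bool" where
  "is_mixed_volume W \<mu> MV \<longleftrightarrow>
     (\<forall>Ks Ls. length Ks = dim W \<longrightarrow> set Ks \<subseteq> convex_bodies W \<longrightarrow> mset Ls = mset Ks \<longrightarrow>
        MV Ls = MV Ks) \<and>
     (\<forall>Ks i K L s t. length Ks = dim W \<longrightarrow> set Ks \<subseteq> convex_bodies W \<longrightarrow> i < dim W \<longrightarrow>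
        K \<in> convex_bodies W \<longrightarrow> L \<in> convex_bodies W \<longrightarrow> 0 \<le> s \<longrightarrow> 0 \<le> t \<longrightarrow>
        MV (Ks[i := mink_comb s K t L]) = s * MV (Ks[i := K]) + t * MV (Ks[i := L])) \<and>
     (\<forall>K \<in> convex_bodies W. MV (replicate (dim W) K) = measure \<mu> K)"

end

theory Submission
  imports Defs "HOL-Combinatorics.Multiset_Permutations"
begin

text \<open>
  Lift the vertex \<open>\<Sum>j\<in>I. b\<^sub>j\<close> of each projected hypersimplex to height \<open>\<Sum>j\<in>I. \<rho>\<^sub>j\<close>. The induced coherent mixed
  subdivision writes the mixed volume as a sum over slopes \<open>y\<close> of the mixed volumes of the faces maximizing
  \<open>\<langle>y, b\<^sub>j\<rangle> + \<rho>\<^sub>j\<close>. A cell contributes only if none of its \<open>n\<close> faces is a point, which forces the positions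
  \<open>i + 1, \<dots>, i + n + 1\<close> in the decreasing order of these values to be tied; by genericity the tied labels form
  a basis \<open>B\<close>, and the \<open>i\<close> labels above them are the ones counted by \<open>ext\<^sub>\<rho>(B)\<close>. The faces of this cell are
  translates of the hypersimplices of the simplex on \<open>B\<close>, whose mixed volume \<open>w\<^sub>A(B)\<close> is found with a second
  lift: it cuts their sum into \<open>n!\<close> mixed cells, all of them parallelepipeds on the edges at one vertex.
  The form \<open>\<omega>\<^sub>W\<close> measures a parallelepiped because replacing one basis vector rescales the form and the
  Lebesgue measure in coordinates inversely, so no determinants are needed.
\<close>

section \<open>Weighted Minkowski sums and polarization\<close>

text \<open>The functional \<open>MV\<close> is only characterized by its properties, so every
  statement about it has to be extracted from volumes of weighted Minkowski sums: a subdivision is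
  proved for volumes at each point of a finite cube of weights and turned into an identity of mixed
  volumes by polarization. The cube has the coordinates 1 and 2 rather than 0 and 1. With all
  weights positive, the face of a weighted sum in a given direction is the weighted sum of the faces
  of the summands, so the same slopes and the same faces serve all weights.

  A coarse cell enters through the mixed volume of its faces, and lower-dimensional cells go into a
  null set. Genericity of \<rho> is used through a single fact: labels on a common level carry
  linearly independent vectors. A second lift is unavoidable for the cells, because on a tied basis
  \<rho> agrees with an affine function of the points and cannot cut the cell any further.\<close>

definition wsum :: "'k set \<Rightarrow> ('k \<Rightarrow> real) \<Rightarrow> ('k \<Rightarrow> 'v::real_vector set) \<Rightarrow> 'v set" where
  "wsum I c K = {\<Sum>k\<in>I. c k *\<^sub>R x k | x. \<forall>k\<in>I. x k \<in> K k}"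

lemma wsum_empty [simp]: "wsum {} c K = {0}"
  by (simp add: wsum_def)

lemma wsum_insert:
  assumes "finite I" "k \<notin> I"
  shows "wsum (insert k I) c K = mink_comb (c k) (K k) 1 (wsum I c K)"
proof (intro subset_antisym subsetI)
  fix z assume "z \<in> wsum (insert k I) c K"
  then obtain x where "z = (\<Sum>j\<in>insert k I. c j *\<^sub>R x j)" "\<forall>j\<in>insert k I. x j \<in> K j"
    unfolding wsum_def by blast
  then show "z \<in> mink_comb (c k) (K k) 1 (wsum I c K)"
    unfolding mink_comb_def wsum_def using assms
    by (intro CollectI exI[of _ "x k"] exI[of _ "\<Sum>j\<in>I. c j *\<^sub>R x j"]) auto
next
  fix z assume "z \<in> mink_comb (c k) (K k) 1 (wsum I c K)"
  then obtain y x where z: "z = c k *\<^sub>R y + (\<Sum>j\<in>I. c j *\<^sub>R x j)" "y \<in> K k" "\<forall>j\<in>I. x j \<in> K j"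
    unfolding mink_comb_def wsum_def by auto
  have "(\<Sum>j\<in>I. c j *\<^sub>R x j) = (\<Sum>j\<in>I. c j *\<^sub>R (x(k := y)) j)"
    using assms by (intro sum.cong) auto
  then have "z = (\<Sum>j\<in>insert k I. c j *\<^sub>R (x(k := y)) j)"
    using assms z by simp
  moreover have "\<forall>j\<in>insert k I. (x(k := y)) j \<in> K j"
    using z by auto
  ultimately show "z \<in> wsum (insert k I) c K"
    unfolding wsum_def by blast
qed

lemma wsum_translate:
  assumes "finite I"
  shows "wsum I c (\<lambda>k. (+) (t k) ` K k) = (+) (\<Sum>k\<in>I. c k *\<^sub>R t k) ` wsum I c K"
proof (intro subset_antisym subsetI)
  fix z assume "z \<in> wsum I c (\<lambda>k. (+) (t k) ` K k)"
  then obtain x where x: "z = (\<Sum>k\<in>I. c k *\<^sub>R x k)" "\<forall>k\<in>I. x k \<in> (+) (t k) ` K k"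
    unfolding wsum_def by blast
  then have "\<forall>k\<in>I. x k - t k \<in> K k" by auto
  moreover have "z = (\<Sum>k\<in>I. c k *\<^sub>R t k) + (\<Sum>k\<in>I. c k *\<^sub>R (x k - t k))"
    unfolding x by (simp add: sum.distrib[symmetric] scaleR_add_right[symmetric])
  ultimately show "z \<in> (+) (\<Sum>k\<in>I. c k *\<^sub>R t k) ` wsum I c K"
    unfolding wsum_def image_iff
    by (intro bexI[of _ "\<Sum>k\<in>I. c k *\<^sub>R (x k - t k)"] CollectI exI[of _ "\<lambda>k. x k - t k"]) auto
next
  fix z assume "z \<in> (+) (\<Sum>k\<in>I. c k *\<^sub>R t k) ` wsum I c K"
  then obtain x where x: "z = (\<Sum>k\<in>I. c k *\<^sub>R t k) + (\<Sum>k\<in>I. c k *\<^sub>R x k)" "\<forall>k\<in>I. x k \<in> K k"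
    unfolding wsum_def by auto
  then have "z = (\<Sum>k\<in>I. c k *\<^sub>R (t k + x k))"
    by (simp add: sum.distrib scaleR_add_right)
  with x(2) show "z \<in> wsum I c (\<lambda>k. (+) (t k) ` K k)"
    unfolding wsum_def by (intro CollectI exI[of _ "\<lambda>k. t k + x k"]) auto
qed

lemma convex_bodies_mink_comb:
  assumes "subspace W" "K \<in> convex_bodies W" "L \<in> convex_bodies W"
  shows "mink_comb s K t L \<in> convex_bodies W"
proof -
  have eq: "mink_comb s K t L = {x + y |x y. x \<in> (*\<^sub>R) s ` K \<and> y \<in> (*\<^sub>R) t ` L}"
    unfolding mink_comb_def by blast
  show ?thesis
    unfolding convex_bodies_def
  proof (intro CollectI conjI)
    show "mink_comb s K t L \<subseteq> W"
      using assms unfolding mink_comb_def convex_bodies_def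
      by (auto intro!: subspace_add subspace_scale)
    show "convex (mink_comb s K t L)"
    proof -
      have "mink_comb s K t L = (\<Union>x\<in>(*\<^sub>R) s ` K. \<Union>y\<in>(*\<^sub>R) t ` L. {x + y})"
        unfolding eq by blast
      then show ?thesis
        using assms by (simp add: convex_bodies_def convex_scaling convex_sums del: UN_simps image_eqI)
    qed
    show "compact (mink_comb s K t L)"
      unfolding eq using assms by (intro compact_sums compact_scaling) (auto simp: convex_bodies_def)
    show "mink_comb s K t L \<noteq> {}"
      using assms unfolding mink_comb_def convex_bodies_def by auto
  qed
qed

lemma zero_convex_body: "subspace W \<Longrightarrow> {0} \<in> convex_bodies W"
  by (auto simp: convex_bodies_def subspace_0)

lemma convex_bodies_wsum:
  assumes "subspace W" "finite I" "\<And>k. k \<in> I \<Longrightarrow> K k \<in> convex_bodies W"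
  shows "wsum I c K \<in> convex_bodies W"
  using assms(2,3)
  by (induction I rule: finite_induct)
     (auto simp: wsum_insert zero_convex_body assms(1) intro!: convex_bodies_mink_comb)

lemma convex_hull_convex_body:
  assumes "subspace W" "finite X" "X \<subseteq> W" "X \<noteq> {}"
  shows "convex hull X \<in> convex_bodies W"
  using assms hull_minimal[of X W convex]
  by (simp add: convex_bodies_def finite_imp_compact_convex_hull subspace_imp_convex)

text \<open>The mixed first difference of the volume polynomial at \<open>(1,\<dots>,1)\<close> picks out the squarefree monomial.\<close>

definition cube_point :: "nat set \<Rightarrow> nat \<Rightarrow> real" where
  "cube_point S k = (if k \<in> S then 2 else 1)"

lemma cube_point_pos: "0 < cube_point S k"
  by (simp add: cube_point_def)

lemma prod_list_map_eq_prod_count: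
  fixes f :: "'a \<Rightarrow> 'b::comm_monoid_mult"
  assumes "finite A" "set xs \<subseteq> A"
  shows "prod_list (map f xs) = (\<Prod>k\<in>A. f k ^ count_list xs k)"
  using assms(2)
proof (induction xs)
  case (Cons x xs)
  have "(\<Prod>k\<in>A. f k ^ count_list (x # xs) k)
      = (\<Prod>k\<in>A. (if k = x then f k else 1) * f k ^ count_list xs k)"
    by (intro prod.cong) auto
  also have "\<dots> = f x * (\<Prod>k\<in>A. f k ^ count_list xs k)"
    using assms(1) Cons.prems by (simp add: prod.distrib prod.delta)
  finally show ?case using Cons by simp
qed simp

text \<open>The sum factors over the letters, and a letter \<open>k\<close> contributes
  \<open>2 ^ count_list xs k - 1\<close>. A missing letter makes this 0. A word of length
  \<open>n\<close> over \<open>n\<close> letters misses none exactly when it is a permutation, and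
  then every factor is 1.\<close>

lemma cube_difference_monomial:
  assumes "set xs \<subseteq> {..<n}" "length xs = n"
  shows "(\<Sum>S\<in>Pow {..<n}. (-1) ^ (n - card S) * prod_list (map (cube_point S) xs))
    = (if distinct xs then 1 else 0 :: real)"
proof -
  have "(\<Sum>S\<in>Pow {..<n}. (-1) ^ (n - card S) * prod_list (map (cube_point S) xs))
    = (\<Sum>S\<in>Pow {..<n}. (\<Prod>k\<in>S. 2 ^ count_list xs k) * (\<Prod>k\<in>{..<n}-S. - 1))"
  proof (rule sum.cong)
    fix S assume S: "S \<in> Pow {..<n}"
    then have fin: "finite S" by (auto intro: finite_subset)
    have "prod_list (map (cube_point S) xs) = (\<Prod>k<n. cube_point S k ^ count_list xs k)"
      by (rule prod_list_map_eq_prod_count) (use assms in auto)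
    also have "\<dots> = (\<Prod>k\<in>S. cube_point S k ^ count_list xs k)"
      by (rule prod.mono_neutral_right) (use S in \<open>auto simp: cube_point_def\<close>)
    also have "\<dots> = (\<Prod>k\<in>S. 2 ^ count_list xs k)"
      by (simp add: cube_point_def)
    finally show "(-1) ^ (n - card S) * prod_list (map (cube_point S) xs)
      = (\<Prod>k\<in>S. 2 ^ count_list xs k) * (\<Prod>k\<in>{..<n}-S. - 1)"
      using S fin by (simp add: card_Diff_subset)
  qed simp
  also have "\<dots> = (\<Prod>k<n. 2 ^ count_list xs k + - 1)"
    by (rule prod_add[symmetric]) simp
  also have "\<dots> = (if distinct xs then 1 else 0)"
  proof (cases "distinct xs")
    case True
    then have "set xs = {..<n}"
      using assms by (metis card_subset_eq card_lessThan distinct_card finite_lessThan)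
    then have "count_list xs k = 1" if "k < n" for k
      using True that distinct_count_atmost_1 count_list_0_iff
      by (metis count_mset distinct_count_atmost_1 lessThan_iff)
    then show ?thesis using True by simp
  next
    case False
    have "set xs \<noteq> {..<n}"
      using False assms card_distinct[of xs] by auto
    then obtain k where "k < n" "k \<notin> set xs" using assms by auto
    then show ?thesis using False by (auto simp: prod_zero_iff intro!: bexI[of _ k])
  qed
  finally show ?thesis .
qed

section \<open>Mixed volume from its characterizing properties\<close>

locale mixed_volume =
  fixes W :: "'v::euclidean_space set" and \<mu> :: "'v measure" and MV :: "'v set list \<Rightarrow> real"
  assumes W: "subspace W" and MV: "is_mixed_volume W \<mu> MV"
begin

lemma MV_perm:
  assumes "length Ks = dim W" "set Ks \<subseteq> convex_bodies W" "mset Ls = mset Ks"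
  shows "MV Ls = MV Ks"
  using MV assms unfolding is_mixed_volume_def by blast

lemma MV_slot:
  assumes "length Ks = dim W" "set Ks \<subseteq> convex_bodies W" "i < dim W"
    "K \<in> convex_bodies W" "L \<in> convex_bodies W" "0 \<le> s" "0 \<le> t"
  shows "MV (Ks[i := mink_comb s K t L]) = s * MV (Ks[i := K]) + t * MV (Ks[i := L])"
  using MV assms unfolding is_mixed_volume_def by blast

lemma MV_diag: "K \<in> convex_bodies W \<Longrightarrow> MV (replicate (dim W) K) = measure \<mu> K"
  using MV unfolding is_mixed_volume_def by blast

lemma MV_slot_wsum:
  assumes "length Ks = dim W" "set Ks \<subseteq> convex_bodies W" "i < dim W"
    and "finite I" "\<And>k. k \<in> I \<Longrightarrow> K k \<in> convex_bodies W" "\<And>k. k \<in> I \<Longrightarrow> 0 \<le> c k"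
  shows "MV (Ks[i := wsum I c K]) = (\<Sum>k\<in>I. c k * MV (Ks[i := K k]))"
  using assms(4-)
proof (induction I rule: finite_induct)
  case empty
  \<comment> \<open>The empty sum is the point 0; writing it as a combination with both coefficients
    0 lets linearity in the slot give the value 0.\<close>
  have "mink_comb 0 {0} 0 {0} = {0::'v}" by (simp add: mink_comb_def)
  then show ?case
    using MV_slot[OF assms(1-3) zero_convex_body[OF W] zero_convex_body[OF W], of 0 0] by simp
next
  case (insert k I)
  have "wsum I c K \<in> convex_bodies W"
    using insert by (intro convex_bodies_wsum W) auto
  then show ?case
    using insert MV_slot[OF assms(1-3), of "K k" "wsum I c K" "c k" 1]
    by (simp add: wsum_insert)
qed

text \<open>Multilinearity is applied to the equal slots one at a time, starting from the last. The
  list \<open>Ls\<close> collects the slots that are already expanded, which is what makes the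
  induction on \<open>m\<close> go through.\<close>

lemma MV_expand:
  assumes "finite I" "\<And>k. k \<in> I \<Longrightarrow> K k \<in> convex_bodies W" "\<And>k. k \<in> I \<Longrightarrow> 0 \<le> c k"
    and "m + length Ls = dim W" "set Ls \<subseteq> convex_bodies W"
  shows "MV (replicate m (wsum I c K) @ Ls)
    = (\<Sum>xs | set xs \<subseteq> I \<and> length xs = m. prod_list (map c xs) * MV (map K xs @ Ls))"
  using assms(4,5)
proof (induction m arbitrary: Ls)
  case 0
  have "{xs. set xs \<subseteq> I \<and> length xs = 0} = {[]}" by auto
  then show ?case by simp
next
  case (Suc m)
  let ?S = "wsum I c K" and ?X = "\<lambda>m. {xs. set xs \<subseteq> I \<and> length xs = m}"
  have S: "?S \<in> convex_bodies W" using assms by (intro convex_bodies_wsum W) auto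
  have upd: "(replicate m ?S @ {0} # Ls)[m := X] = replicate m ?S @ X # Ls" for X
    by (simp add: list_update_append)
  have eq: "replicate (Suc m) ?S @ Ls = replicate m ?S @ ?S # Ls"
    by (simp flip: replicate_append_same)
  have "MV (replicate (Suc m) ?S @ Ls) = MV ((replicate m ?S @ {0} # Ls)[m := ?S])"
    unfolding upd eq ..
  also have "\<dots> = (\<Sum>k\<in>I. c k * MV ((replicate m ?S @ {0} # Ls)[m := K k]))"
    using Suc.prems S zero_convex_body[OF W] assms by (intro MV_slot_wsum) auto
  also have "\<dots> = (\<Sum>k\<in>I. c k * (\<Sum>xs\<in>?X m. prod_list (map c xs) * MV (map K xs @ K k # Ls)))"
    unfolding upd using Suc.prems assms
    by (intro sum.cong refl arg_cong[of _ _ "(*) _"] Suc.IH) auto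
  also have "\<dots> = (\<Sum>(k,xs)\<in>I\<times>?X m. prod_list (map c (xs @ [k])) * MV (map K (xs @ [k]) @ Ls))"
    by (simp add: sum.cartesian_product[symmetric] sum_distrib_left mult_ac)
  also have "\<dots> = (\<Sum>xs\<in>?X (Suc m). prod_list (map c xs) * MV (map K xs @ Ls))"
  proof (rule sum.reindex_bij_witness[of _ "\<lambda>xs. (last xs, butlast xs)" "\<lambda>(k,xs). xs @ [k]"])
    fix xs assume "xs \<in> ?X (Suc m)"
    then have ne: "xs \<noteq> []" by auto
    then show "(case (last xs, butlast xs) of (k, xs) \<Rightarrow> xs @ [k]) = xs" by simp
    show "(last xs, butlast xs) \<in> I \<times> ?X m"
      using \<open>xs \<in> _\<close> ne by (auto dest: in_set_butlastD)
  qed (auto)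
  finally show ?case .
qed

text \<open>By \<open>MV_expand\<close> the volume is a homogeneous polynomial in the weights, with
  one monomial for each word of length \<open>n\<close>. The alternating sum over the cube keeps
  only the words without repetition, and by symmetry these \<open>fact n\<close> words all have the
  same mixed volume.\<close>

lemma polarization:
  assumes "n = dim W" "\<And>k. k < n \<Longrightarrow> K k \<in> convex_bodies W"
  shows "fact n * MV (map K [0..<n])
    = (\<Sum>S\<in>Pow {..<n}. (-1) ^ (n - card S) * measure \<mu> (wsum {..<n} (cube_point S) K))"
proof -
  let ?X = "{xs. set xs \<subseteq> {..<n} \<and> length xs = n}"
  have finX: "finite ?X" by (rule finite_lists_length_eq) simp
  have vol: "measure \<mu> (wsum {..<n} (cube_point S) K)
     = (\<Sum>xs\<in>?X. prod_list (map (cube_point S) xs) * MV (map K xs))" for S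
  proof -
    have "wsum {..<n} (cube_point S) K \<in> convex_bodies W"
      using assms by (intro convex_bodies_wsum W) auto
    from MV_diag[OF this] show ?thesis
      using MV_expand[of "{..<n}" K "cube_point S" n "[]"] assms
      by (simp add: less_imp_le[OF cube_point_pos])
  qed
  have "(\<Sum>S\<in>Pow {..<n}. (-1) ^ (n - card S) * measure \<mu> (wsum {..<n} (cube_point S) K))
     = (\<Sum>S\<in>Pow {..<n}. \<Sum>xs\<in>?X. (-1) ^ (n - card S) * prod_list (map (cube_point S) xs) * MV (map K xs))"
    unfolding vol by (simp add: sum_distrib_left mult.assoc)
  also have "\<dots> = (\<Sum>xs\<in>?X. (\<Sum>S\<in>Pow {..<n}. (-1) ^ (n - card S) * prod_list (map (cube_point S) xs)) * MV (map K xs))"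
    by (subst sum.swap) (simp add: sum_distrib_right)
  also have "\<dots> = (\<Sum>xs\<in>?X. (if distinct xs then MV (map K xs) else 0))"
    by (intro sum.cong refl, subst cube_difference_monomial) auto
  also have "\<dots> = (\<Sum>xs\<in>{xs\<in>?X. distinct xs}. MV (map K xs))"
    by (rule sum.inter_filter[OF finX, symmetric])
  also have "{xs\<in>?X. distinct xs} = permutations_of_set {..<n}"
  proof (intro subset_antisym subsetI)
    fix xs assume "xs \<in> {xs\<in>?X. distinct xs}"
    then show "xs \<in> permutations_of_set {..<n}"
      using card_subset_eq[of "{..<n}" "set xs"] distinct_card[of xs]
      by (simp add: permutations_of_set_def)
  next
    fix xs assume "xs \<in> permutations_of_set {..<n}"
    then show "xs \<in> {xs\<in>?X. distinct xs}"
      using distinct_card[of xs] by (simp add: permutations_of_set_def)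
  qed
  also have "(\<Sum>xs\<in>permutations_of_set {..<n}. MV (map K xs)) = (\<Sum>xs\<in>permutations_of_set {..<n}. MV (map K [0..<n]))"
  proof (rule sum.cong)
    fix xs assume "xs \<in> permutations_of_set {..<n}"
    then have "mset xs = mset [0..<n]"
      using set_eq_iff_mset_eq_distinct[of xs "[0..<n]"]
      by (simp add: permutations_of_set_def atLeast_upt)
    then show "MV (map K xs) = MV (map K [0..<n])"
      using assms by (intro MV_perm) auto
  qed simp
  also have "\<dots> = fact n * MV (map K [0..<n])"
    by simp
  finally show ?thesis ..
qed

text \<open>The polarization formula is linear in the volumes, so a decomposition of volume passes
  to mixed volume as soon as one index set \<open>Y\<close> and one family \<open>F\<close> work at
  all points of the cube.\<close>

lemma MV_eq_sum:
  assumes "n = dim W" "\<And>k. k < n \<Longrightarrow> K k \<in> convex_bodies W"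
    and "\<And>y k. y \<in> Y \<Longrightarrow> k < n \<Longrightarrow> F y k \<in> convex_bodies W"
    and vol: "\<And>S. S \<subseteq> {..<n} \<Longrightarrow> measure \<mu> (wsum {..<n} (cube_point S) K)
       = (\<Sum>y\<in>Y. measure \<mu> (wsum {..<n} (cube_point S) (F y)))"
  shows "MV (map K [0..<n]) = (\<Sum>y\<in>Y. MV (map (F y) [0..<n]))"
proof -
  have "fact n * MV (map K [0..<n])
      = (\<Sum>S\<in>Pow {..<n}. (-1) ^ (n - card S) * measure \<mu> (wsum {..<n} (cube_point S) K))"
    by (rule polarization) (use assms(1,2) in auto)
  also have "\<dots> = (\<Sum>S\<in>Pow {..<n}. \<Sum>y\<in>Y. (-1) ^ (n - card S) * measure \<mu> (wsum {..<n} (cube_point S) (F y)))"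
    by (intro sum.cong refl) (simp add: vol sum_distrib_left)
  also have "\<dots> = (\<Sum>y\<in>Y. fact n * MV (map (F y) [0..<n]))"
    by (subst sum.swap, intro sum.cong refl polarization[symmetric]) (use assms(1,3) in auto)
  finally have "fact n * MV (map K [0..<n]) = (\<Sum>y\<in>Y. fact n * MV (map (F y) [0..<n]))" .
  then show ?thesis by (simp add: sum_distrib_left[symmetric])
qed

end

section \<open>Change of basis for the density measure\<close>

text \<open>For independent vectors this is integration over their span against Lebesgue measure in
  the coordinates that they define. Working with integrands instead of sets allows an inner integral
  to serve as a new integrand, and the arbitrary index set allows coordinates to be split off
  singly.\<close>

definition lincomb_integral :: "nat set \<Rightarrow> (nat \<Rightarrow> 'v::euclidean_space) \<Rightarrow> ('v \<Rightarrow> ennreal) \<Rightarrow> ennreal" where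
  "lincomb_integral I u g = (\<integral>\<^sup>+x. g (\<Sum>i\<in>I. x i *\<^sub>R u i) \<partial>Pi\<^sub>M I (\<lambda>_. lborel))"

interpretation lborel_product: product_sigma_finite "\<lambda>_::nat. lborel :: real measure"
  by standard

lemma measurable_lincomb [measurable]:
  fixes u :: "nat \<Rightarrow> 'v::euclidean_space"
  shows "(\<lambda>x. \<Sum>i\<in>I. x i *\<^sub>R u i) \<in> borel_measurable (Pi\<^sub>M I (\<lambda>_. lborel :: real measure))"
  by (intro borel_measurable_sum borel_measurable_scaleR) auto

lemma sum_fun_upd_insert:
  fixes u :: "nat \<Rightarrow> 'v::real_vector"
  assumes "finite I" "i \<notin> I"
  shows "(\<Sum>k\<in>insert i I. (x(i := y)) k *\<^sub>R u k) = (\<Sum>k\<in>I. x k *\<^sub>R u k) + y *\<^sub>R u i"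
proof -
  have "(\<Sum>k\<in>I. (x(i := y)) k *\<^sub>R u k) = (\<Sum>k\<in>I. x k *\<^sub>R u k)"
    using assms by (intro sum.cong) auto
  then show ?thesis using assms by simp
qed

text \<open>Both orders of Fubini are needed: with the new coordinate outermost, the rest can be
  translated for each fixed \<open>y\<close>; with it innermost, its axis can be rescaled.\<close>

lemma lincomb_integral_insert:
  assumes "finite I" "i \<notin> I" and [measurable]: "g \<in> borel_measurable borel"
  shows "lincomb_integral (insert i I) u g = (\<integral>\<^sup>+y. lincomb_integral I u (\<lambda>z. g (z + y *\<^sub>R u i)) \<partial>lborel)"
    and "lincomb_integral (insert i I) u g = lincomb_integral I u (\<lambda>z. \<integral>\<^sup>+y. g (z + y *\<^sub>R u i) \<partial>lborel)"
proof -
  have m: "(\<lambda>x. g (\<Sum>k\<in>insert i I. x k *\<^sub>R u k)) \<in> borel_measurable (Pi\<^sub>M (insert i I) (\<lambda>_. lborel))"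
    by measurable
  show "lincomb_integral (insert i I) u g = (\<integral>\<^sup>+y. lincomb_integral I u (\<lambda>z. g (z + y *\<^sub>R u i)) \<partial>lborel)"
    unfolding lincomb_integral_def
    by (subst lborel_product.product_nn_integral_insert_rev[OF assms(1,2) m])
       (simp only: sum_fun_upd_insert[OF assms(1,2)])
  show "lincomb_integral (insert i I) u g = lincomb_integral I u (\<lambda>z. \<integral>\<^sup>+y. g (z + y *\<^sub>R u i) \<partial>lborel)"
    unfolding lincomb_integral_def
    by (subst lborel_product.product_nn_integral_insert[OF assms(1,2) m])
       (simp only: sum_fun_upd_insert[OF assms(1,2)])
qed

lemma lincomb_integral_cong:
  assumes "\<And>i. i \<in> I \<Longrightarrow> u i = u' i"
  shows "lincomb_integral I u g = lincomb_integral I u' g"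
  unfolding lincomb_integral_def
  using assms by (intro nn_integral_cong arg_cong[of _ _ g] sum.cong) auto

lemma lincomb_integral_translate1:
  assumes "finite I" "i \<in> I" and [measurable]: "g \<in> borel_measurable borel"
  shows "lincomb_integral I u (\<lambda>z. g (z + c *\<^sub>R u i)) = lincomb_integral I u g"
proof -
  obtain J where J: "I = insert i J" "i \<notin> J" "finite J"
    using assms by (metis finite_insert mk_disjoint_insert)
  have "(\<integral>\<^sup>+y. g (z + y *\<^sub>R u i + c *\<^sub>R u i) \<partial>lborel) = (\<integral>\<^sup>+y. g (z + y *\<^sub>R u i) \<partial>lborel)" for z
    using nn_integral_real_affine[of "\<lambda>y. g (z + y *\<^sub>R u i)" 1 c]
    by (simp add: scaleR_add_left add_ac)
  then show ?thesis
    unfolding J(1) by (simp add: lincomb_integral_insert(2)[OF J(3,2)])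
qed

lemma lincomb_integral_translate:
  assumes "finite I" "J \<subseteq> I" and [measurable]: "g \<in> borel_measurable borel"
  shows "lincomb_integral I u (\<lambda>z. g (z + (\<Sum>k\<in>J. c k *\<^sub>R u k))) = lincomb_integral I u g"
proof -
  have "finite J" using assms finite_subset by blast
  from this assms(2) show ?thesis
  proof (induction J rule: finite_induct)
    case (insert j J)
    have "lincomb_integral I u (\<lambda>z. g (z + (\<Sum>k\<in>insert j J. c k *\<^sub>R u k)))
       = lincomb_integral I u (\<lambda>z. (\<lambda>w. g (w + (\<Sum>k\<in>J. c k *\<^sub>R u k))) (z + c j *\<^sub>R u j))"
      using insert by (simp add: add_ac)
    also have "\<dots> = lincomb_integral I u (\<lambda>w. g (w + (\<Sum>k\<in>J. c k *\<^sub>R u k)))"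
      using insert assms by (intro lincomb_integral_translate1) auto
    finally show ?case using insert by simp
  qed simp
qed

text \<open>Replacing one spanning vector by a linear combination is a shear followed by a rescaling of one axis.\<close>

lemma lincomb_integral_replace:
  assumes "finite I" "i \<in> I" "c i \<noteq> 0" and [measurable]: "g \<in> borel_measurable borel"
  shows "ennreal \<bar>c i\<bar> * lincomb_integral I (u(i := \<Sum>k\<in>I. c k *\<^sub>R u k)) g = lincomb_integral I u g"
proof -
  obtain J where J: "I = insert i J" "i \<notin> J" "finite J"
    using assms by (metis finite_insert mk_disjoint_insert)
  let ?u = "u(i := \<Sum>k\<in>I. c k *\<^sub>R u k)"
  have "lincomb_integral I ?u g = (\<integral>\<^sup>+y. lincomb_integral J ?u (\<lambda>z. g (z + y *\<^sub>R ?u i)) \<partial>lborel)"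
    unfolding J(1) by (rule lincomb_integral_insert(1)[OF J(3,2)]) measurable
  also have "\<dots> = (\<integral>\<^sup>+y. lincomb_integral J u (\<lambda>z. g (z + y *\<^sub>R c i *\<^sub>R u i)) \<partial>lborel)"
  proof (rule nn_integral_cong)
    \<comment> \<open>For fixed \<open>y\<close> the components of the new vector along
      \<open>J\<close> only translate within the span of the vectors that are kept.\<close>
    fix y :: real
    have "lincomb_integral J ?u (\<lambda>z. g (z + y *\<^sub>R ?u i)) = lincomb_integral J u (\<lambda>z. g (z + y *\<^sub>R ?u i))"
      using J by (intro lincomb_integral_cong) auto
    also have "\<dots> = lincomb_integral J u (\<lambda>z. (\<lambda>w. g (w + y *\<^sub>R c i *\<^sub>R u i)) (z + (\<Sum>k\<in>J. (y * c k) *\<^sub>R u k)))"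
      using J by (simp add: scaleR_sum_right scaleR_add_right add_ac)
    also have "\<dots> = lincomb_integral J u (\<lambda>w. g (w + y *\<^sub>R c i *\<^sub>R u i))"
      by (rule lincomb_integral_translate[OF J(3)]) auto
    finally show "lincomb_integral J ?u (\<lambda>z. g (z + y *\<^sub>R ?u i)) = lincomb_integral J u (\<lambda>z. g (z + y *\<^sub>R c i *\<^sub>R u i))" .
  qed
  also have "\<dots> = (\<integral>\<^sup>+y. lincomb_integral J u (\<lambda>z. g (z + y *\<^sub>R (u(i := c i *\<^sub>R u i)) i)) \<partial>lborel)"
    by simp
  also have "\<dots> = (\<integral>\<^sup>+y. lincomb_integral J (u(i := c i *\<^sub>R u i)) (\<lambda>z. g (z + y *\<^sub>R (u(i := c i *\<^sub>R u i)) i)) \<partial>lborel)"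
    using J by (intro nn_integral_cong lincomb_integral_cong) auto
  also have "\<dots> = lincomb_integral I (u(i := c i *\<^sub>R u i)) g"
    unfolding J(1) by (rule lincomb_integral_insert(1)[OF J(3,2), symmetric]) measurable
  also have "\<dots> = lincomb_integral J (u(i := c i *\<^sub>R u i)) (\<lambda>z. \<integral>\<^sup>+y. g (z + y *\<^sub>R (u(i := c i *\<^sub>R u i)) i) \<partial>lborel)"
    unfolding J(1) by (rule lincomb_integral_insert(2)[OF J(3,2)]) measurable
  also have "\<dots> = lincomb_integral J u (\<lambda>z. \<integral>\<^sup>+y. g (z + y *\<^sub>R c i *\<^sub>R u i) \<partial>lborel)"
    using J by (simp, intro lincomb_integral_cong) auto
  finally have "ennreal \<bar>c i\<bar> * lincomb_integral I ?u g
      = ennreal \<bar>c i\<bar> * lincomb_integral J u (\<lambda>z. \<integral>\<^sup>+y. g (z + y *\<^sub>R c i *\<^sub>R u i) \<partial>lborel)"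
    by simp
  also have "\<dots> = lincomb_integral J u (\<lambda>z. ennreal \<bar>c i\<bar> * (\<integral>\<^sup>+y. g (z + y *\<^sub>R c i *\<^sub>R u i) \<partial>lborel))"
    unfolding lincomb_integral_def by (rule nn_integral_cmult[symmetric]) measurable
  also have "\<dots> = lincomb_integral J u (\<lambda>z. \<integral>\<^sup>+y. g (z + y *\<^sub>R u i) \<partial>lborel)"
  proof -
    have "ennreal \<bar>c i\<bar> * (\<integral>\<^sup>+y. g (z + y *\<^sub>R c i *\<^sub>R u i) \<partial>lborel) = (\<integral>\<^sup>+y. g (z + y *\<^sub>R u i) \<partial>lborel)" for z
      using nn_integral_real_affine[of "\<lambda>y. g (z + y *\<^sub>R u i)" "c i" 0] assms(3)
      by (simp add: mult.commute)
    then show ?thesis by simp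
  qed
  also have "\<dots> = lincomb_integral I u g"
    unfolding J(1) by (rule lincomb_integral_insert(2)[OF J(3,2), symmetric]) measurable
  finally show ?thesis .
qed

text \<open>Every line in the direction \<open>u i\<close> meets the hyperplane in a single point,
  so already the innermost integral vanishes.\<close>

lemma lincomb_integral_hyperplane:
  assumes "finite I" "i \<in> I" "z \<bullet> u i \<noteq> 0"
  shows "lincomb_integral I u (indicator {x. z \<bullet> x = c}) = 0"
proof -
  obtain J where J: "I = insert i J" "i \<notin> J" "finite J"
    using assms by (metis finite_insert mk_disjoint_insert)
  have [measurable]: "{x. z \<bullet> x = c} \<in> sets borel"
    by (intro borel_closed closed_hyperplane)
  have "(\<integral>\<^sup>+y. indicator {x. z \<bullet> x = c} (w + y *\<^sub>R u i) \<partial>lborel) = 0" for w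
  proof -
    have "indicator {x. z \<bullet> x = c} (w + y *\<^sub>R u i) = (indicator {(c - z \<bullet> w) / (z \<bullet> u i)} y :: ennreal)" for y
      using assms(3) by (auto simp: indicator_def inner_add_right field_simps)
    then show ?thesis by simp
  qed
  then show ?thesis
    unfolding J(1) by (subst lincomb_integral_insert(2)[OF J(3,2)]) (simp_all add: lincomb_integral_def)
qed

section \<open>Bases as lists and the exchange of basis vectors\<close>

lemma span_list_conv:
  "x \<in> span (set us) \<longleftrightarrow> (\<exists>c. x = (\<Sum>k<length us. c k *\<^sub>R us ! k))"
proof
  let ?R = "range (\<lambda>c. \<Sum>k<length us. c k *\<^sub>R us ! k)"
  have "subspace ?R"
    unfolding subspace_def
  proof (intro conjI ballI allI)
    show "0 \<in> ?R" by (intro range_eqI[of _ _ "\<lambda>_. 0"]) simp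
    fix x y assume "x \<in> ?R" "y \<in> ?R"
    then obtain c d where "x = (\<Sum>k<length us. c k *\<^sub>R us ! k)" "y = (\<Sum>k<length us. d k *\<^sub>R us ! k)"
      by auto
    then show "x + y \<in> ?R"
      by (intro range_eqI[of _ _ "\<lambda>k. c k + d k"]) (simp add: scaleR_add_left sum.distrib)
  next
    fix c x assume "x \<in> ?R"
    then obtain d where "x = (\<Sum>k<length us. d k *\<^sub>R us ! k)" by auto
    then show "c *\<^sub>R x \<in> ?R"
      by (intro range_eqI[of _ _ "\<lambda>k. c * d k"]) (simp add: scaleR_sum_right)
  qed
  moreover have "set us \<subseteq> ?R"
  proof
    fix x assume "x \<in> set us"
    then obtain i where i: "i < length us" "x = us ! i" by (auto simp: in_set_conv_nth)
    then show "x \<in> ?R"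
      by (intro range_eqI[of _ _ "\<lambda>k. if k = i then 1 else 0"]) (simp add: if_distrib[of "\<lambda>r. r *\<^sub>R _"] cong: if_cong)
  qed
  ultimately have "span (set us) \<subseteq> ?R" by (rule span_minimal[rotated])
  then show "x \<in> span (set us) \<Longrightarrow> \<exists>c. x = (\<Sum>k<length us. c k *\<^sub>R us ! k)" by auto
next
  assume "\<exists>c. x = (\<Sum>k<length us. c k *\<^sub>R us ! k)"
  then obtain c where x: "x = (\<Sum>k<length us. c k *\<^sub>R us ! k)" ..
  show "x \<in> span (set us)"
    unfolding x by (intro span_sum span_scale span_base) simp
qed

lemma basis_listI:
  fixes W :: "'v::euclidean_space set"
  assumes "span (set us) = W" "length us = dim W"
  shows "basis_list W us"
proof -
  have "dim W \<le> card (set us)"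
    using assms dim_le_card[of W "set us"] by (simp add: span_superset)
  with assms(2) have "distinct us" "card (set us) \<le> dim W"
    using card_distinct[of us] card_length[of us] by auto
  moreover from this have "independent (set us)"
    using assms(1) span_superset[of "set us"] by (intro card_le_dim_spanning[of _ W]) auto
  ultimately show ?thesis
    using assms(1) by (simp add: basis_list_def)
qed

lemma basis_list_length: "basis_list W us \<Longrightarrow> length us = dim (W :: 'v::euclidean_space set)"
  unfolding basis_list_def by (metis dim_eq_card_independent dim_span distinct_card)

lemma ex_basis_list:
  assumes "subspace (W :: 'v::euclidean_space set)"
  shows "\<exists>us. basis_list W us"
proof -
  obtain B where "B \<subseteq> W" "independent B" "W \<subseteq> span B"
    by (rule basis_exists)
  then obtain us where "set us = B" "distinct us"
    using finite_distinct_list[of B] independent_bound[of B] by auto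
  with \<open>B \<subseteq> W\<close> \<open>independent B\<close> \<open>W \<subseteq> span B\<close> assms show ?thesis
    unfolding basis_list_def using span_minimal[of B W] by (intro exI[of _ us]) auto
qed

lemma basis_list_replace:
  fixes W :: "'v::euclidean_space set"
  assumes "basis_list W us" "i < length us" "c i \<noteq> 0"
  shows "basis_list W (us[i := \<Sum>k<length us. c k *\<^sub>R us ! k])"
proof (rule basis_listI)
  let ?x = "\<Sum>k<length us. c k *\<^sub>R us ! k"
  let ?us = "us[i := ?x]"
  have W: "W = span (set us)" using assms by (simp add: basis_list_def)
  show "length ?us = dim W" using basis_list_length[OF assms(1)] by simp
  have mem: "us ! k \<in> set ?us" if "k < length us" "k \<noteq> i" for k
    using that by (metis length_list_update nth_list_update_neq nth_mem)
  have x: "?x \<in> set ?us" using assms(2) by (simp add: set_update_memI)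
  have "?x = c i *\<^sub>R us ! i + (\<Sum>k\<in>{..<length us} - {i}. c k *\<^sub>R us ! k)"
    using assms(2) by (intro sum.remove) auto
  then have "us ! i = (1 / c i) *\<^sub>R (?x - (\<Sum>k\<in>{..<length us} - {i}. c k *\<^sub>R us ! k))"
    using assms(3) by simp
  also have "\<dots> \<in> span (set ?us)"
    using x mem by (intro span_scale span_diff span_sum span_base) auto
  finally have i: "us ! i \<in> span (set ?us)" .
  have "set us \<subseteq> span (set ?us)"
  proof
    fix w assume "w \<in> set us"
    then obtain k where "k < length us" "w = us ! k" by (auto simp: in_set_conv_nth)
    then show "w \<in> span (set ?us)" using i mem by (cases "k = i") (auto intro: span_base)
  qed
  then have "span (set us) \<subseteq> span (set ?us)" by (simp add: span_minimal)
  moreover have "set ?us \<subseteq> span (set us)"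
    using set_update_subset_insert[of us i ?x] span_list_conv[of ?x us] span_superset[of "set us"] by blast
  then have "span (set ?us) \<subseteq> span (set us)" by (simp add: span_minimal)
  ultimately show "span (set ?us) = W" using W by simp
qed

text \<open>Linearity in slot \<open>i\<close> leaves only the term \<open>k = i\<close>, because
  every other term repeats a vector of the list.\<close>

lemma alternating_form_replace:
  assumes "alternating_form n \<eta>" "length us = n" "i < n"
  shows "\<eta> (us[i := \<Sum>k<n. c k *\<^sub>R us ! k]) = c i * \<eta> us"
proof -
  have lin: "linear (\<lambda>x. \<eta> (us[i := x]))"
    using assms unfolding alternating_form_def by blast
  have zero: "\<eta> (us[i := us ! k]) = 0" if "k < n" "k \<noteq> i" for k
  proof -
    have "\<not> distinct (us[i := us ! k])"
      using that assms unfolding distinct_conv_nth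
      by (metis length_list_update nth_list_update_eq nth_list_update_neq)
    then show ?thesis
      using assms unfolding alternating_form_def by simp
  qed
  have "\<eta> (us[i := \<Sum>k<n. c k *\<^sub>R us ! k]) = (\<Sum>k<n. c k * \<eta> (us[i := us ! k]))"
    using linear_sum[OF lin, of "\<lambda>k. c k *\<^sub>R us ! k" "{..<n}"] linear_scale[OF lin] by simp
  also have "\<dots> = (\<Sum>k\<in>{i}. c k * \<eta> (us[i := us ! k]))"
    using assms(3) zero by (intro sum.mono_neutral_right) auto
  finally show ?thesis by simp
qed

definition list_integral :: "'v::euclidean_space list \<Rightarrow> ('v \<Rightarrow> ennreal) \<Rightarrow> ennreal" where
  "list_integral us = lincomb_integral {..<length us} ((!) us)"

lemma list_integral_replace:
  assumes "alternating_form n \<eta>" "length us = n" "i < n" "c i \<noteq> 0"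
    and "g \<in> borel_measurable borel"
  defines "us' \<equiv> us[i := \<Sum>k<n. c k *\<^sub>R us ! k]"
  shows "ennreal \<bar>\<eta> us'\<bar> * list_integral us' g = ennreal \<bar>\<eta> us\<bar> * list_integral us g"
proof -
  have "list_integral us' g = lincomb_integral {..<n} (((!) us)(i := \<Sum>k<n. c k *\<^sub>R us ! k)) g"
    unfolding list_integral_def us'_def length_list_update assms(2)
    using assms(2,3) by (intro lincomb_integral_cong) auto
  moreover have "\<bar>\<eta> us'\<bar> = \<bar>\<eta> us\<bar> * \<bar>c i\<bar>"
    unfolding us'_def alternating_form_replace[OF assms(1-3)] by (simp add: abs_mult)
  ultimately have "ennreal \<bar>\<eta> us'\<bar> * list_integral us' g
    = ennreal \<bar>\<eta> us\<bar> * (ennreal \<bar>c i\<bar> * lincomb_integral {..<n} (((!) us)(i := \<Sum>k<n. c k *\<^sub>R us ! k)) g)"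
    by (simp add: ennreal_mult mult.assoc)
  also have "\<dots> = ennreal \<bar>\<eta> us\<bar> * list_integral us g"
    using assms by (subst lincomb_integral_replace) (auto simp: list_integral_def)
  finally show ?thesis .
qed

text \<open>As in Steinitz exchange, \<open>us\<close> is turned into \<open>ws\<close> position by
  position while the treated prefix is kept. Every move replaces a single vector, and by
  \<open>list_integral_replace\<close> the product of form and integral is invariant under such a
  move.\<close>

lemma list_integral_basis_change:
  fixes W :: "'v::euclidean_space set"
  assumes alt: "alternating_form (dim W) \<eta>" and us: "basis_list W us" and ws: "basis_list W ws"
    and g: "g \<in> borel_measurable borel"
  shows "ennreal \<bar>\<eta> us\<bar> * list_integral us g = ennreal \<bar>\<eta> ws\<bar> * list_integral ws g"
proof -
  define n where "n = dim W"
  have len: "length L = n" if "basis_list W L" for L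
    using that basis_list_length n_def by blast
  let ?E = "\<lambda>L. ennreal \<bar>\<eta> L\<bar> * list_integral L g"
  have "\<exists>L. basis_list W L \<and> take m L = take m ws \<and> ?E L = ?E us" if "m \<le> n" for m
    using that
  proof (induction m)
    case 0
    then show ?case using us by auto
  next
    case (Suc m)
    then obtain L where L: "basis_list W L" "take m L = take m ws" "?E L = ?E us" by auto
    have lenL: "length L = n" using L len by auto
    have m: "m < n" using Suc by simp
    have "ws ! m \<in> W"
      using m ws len[OF ws] unfolding basis_list_def by (metis nth_mem span_base)
    then obtain c where c: "ws ! m = (\<Sum>k<n. c k *\<^sub>R L ! k)"
      using L(1) span_list_conv[of _ L] lenL unfolding basis_list_def by auto
    \<comment> \<open>The first \<open>m\<close> entries of \<open>L\<close> are those of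
      \<open>ws\<close>; if all later coefficients vanished, \<open>ws ! m\<close> would depend on
      its predecessors.\<close>
    have "\<exists>j\<in>{m..<n}. c j \<noteq> 0"
    proof (rule ccontr)
      assume *: "\<not> (\<exists>j\<in>{m..<n}. c j \<noteq> 0)"
      have "ws ! m = (\<Sum>k<m. c k *\<^sub>R L ! k)"
        unfolding c using * m by (intro sum.mono_neutral_right) auto
      also have "\<dots> = (\<Sum>k<m. c k *\<^sub>R ws ! k)"
        using L(2) by (intro sum.cong refl) (metis lessThan_iff nth_take)
      also have "\<dots> \<in> span (set ws - {ws ! m})"
      proof (intro span_sum span_scale span_base)
        fix k assume "k \<in> {..<m}"
        then show "ws ! k \<in> set ws - {ws ! m}"
          using m len[OF ws] ws unfolding basis_list_def
          by (auto simp: nth_eq_iff_index_eq)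
      qed
      finally have "dependent (set ws)"
        unfolding dependent_def using m len[OF ws] by (auto intro!: bexI[of _ "ws ! m"])
      then show False using ws by (simp add: basis_list_def)
    qed
    then obtain j where j: "m \<le> j" "j < n" "c j \<noteq> 0" by auto
    have "\<exists>L c. basis_list W L \<and> take m L = take m ws \<and> ?E L = ?E us
        \<and> ws ! m = (\<Sum>k<n. c k *\<^sub>R L ! k) \<and> c m \<noteq> 0"
    proof (cases "c m = 0")
      case False
      then show ?thesis using L c by blast
    next
      case True
      then have jm: "j \<noteq> m" using j by auto
      \<comment> \<open>Only single replacements are available, so a nonzero coefficient at a later
        position \<open>j\<close> is not swapped into position \<open>m\<close> but created there:
        after replacing \<open>L ! j\<close> by \<open>L ! j - L ! m\<close>, the old term at
        \<open>j\<close> splits into one at \<open>j\<close> and one at \<open>m\<close>, both with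
        coefficient \<open>c j\<close>.\<close>
      define e :: "nat \<Rightarrow> real" where "e k = (if k = j then 1 else if k = m then -1 else 0)" for k
      define L' where "L' = L[j := \<Sum>k<length L. e k *\<^sub>R L ! k]"
      have "(\<Sum>k<n. e k *\<^sub>R L ! k) = (\<Sum>k\<in>{j, m}. e k *\<^sub>R L ! k)"
        using j m by (intro sum.mono_neutral_right) (auto simp: e_def)
      then have L'j: "L' ! j = L ! j - L ! m" "\<And>k. k \<noteq> j \<Longrightarrow> L' ! k = L ! k"
        using jm j lenL by (auto simp: e_def L'_def)
      have "basis_list W L'"
        unfolding L'_def using j L(1) lenL by (intro basis_list_replace) (auto simp: e_def)
      moreover have "take m L' = take m ws"
        unfolding L'_def using L(2) j by simp
      moreover have "?E L' = ?E us"
        unfolding L(3)[symmetric] L'_def lenL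
        using alt j lenL g by (intro list_integral_replace) (auto simp: n_def e_def)
      moreover have "(\<Sum>k<n. (c(m := c j)) k *\<^sub>R L' ! k) = ws ! m"
      proof -
        have split: "(\<Sum>k<n. f k) = f j + (f m + (\<Sum>k\<in>{..<n} - {j} - {m}. f k))" for f :: "nat \<Rightarrow> 'v"
          using j m jm by (subst sum.remove[of _ j], simp, simp, subst sum.remove[of _ m]) auto
        have "(\<Sum>k\<in>{..<n} - {j} - {m}. (c(m := c j)) k *\<^sub>R L' ! k) = (\<Sum>k\<in>{..<n} - {j} - {m}. c k *\<^sub>R L ! k)"
          using L'j by (intro sum.cong) auto
        then show ?thesis
          unfolding c split using jm True by (simp add: L'j scaleR_diff_right)
      qed
      ultimately show ?thesis
        using j(3) by (intro exI[of _ L'] exI[of _ "c(m := c j)"]) auto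
    qed
    then obtain L c where L: "basis_list W L" "take m L = take m ws" "?E L = ?E us"
        and c: "ws ! m = (\<Sum>k<n. c k *\<^sub>R L ! k)" "c m \<noteq> 0" by blast
    have lenL: "length L = n" using L len by auto
    have "basis_list W (L[m := ws ! m])"
      using basis_list_replace[OF L(1), of m c] c m lenL by simp
    moreover have "?E (L[m := ws ! m]) = ?E us"
      unfolding L(3)[symmetric] c(1)
      using alt m lenL g c(2) by (intro list_integral_replace) (auto simp: n_def)
    moreover have "take (Suc m) (L[m := ws ! m]) = take (Suc m) ws"
      using L(2) m lenL len[OF ws] by (simp add: take_Suc_conv_app_nth)
    ultimately show ?case by blast
  qed
  from this[of n] obtain L where "basis_list W L" "take n L = take n ws" "?E L = ?E us" by auto
  then show ?thesis using len[of L] len[OF ws] by simp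
qed

lemma basis_list_coordinates:
  fixes W :: "'v::euclidean_space set"
  assumes "basis_list W us"
  obtains f :: "nat \<Rightarrow> 'v \<Rightarrow> real" where "\<And>i. i < length us \<Longrightarrow> linear (f i)"
    "\<And>i x. i < length us \<Longrightarrow> f i (\<Sum>k<length us. x k *\<^sub>R us ! k) = x i"
proof -
  have us: "independent (set us)" "distinct us" using assms by (auto simp: basis_list_def)
  have "\<exists>g :: 'v \<Rightarrow> real. linear g \<and> (\<forall>x\<in>set us. g x = (if x = us ! i then 1 else 0))" for i
    by (rule linear_independent_extend[OF us(1)])
  then obtain f :: "nat \<Rightarrow> 'v \<Rightarrow> real"
    where f: "\<And>i. linear (f i)" "\<And>i x. x \<in> set us \<Longrightarrow> f i x = (if x = us ! i then 1 else 0)"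
    by metis
  show ?thesis
  proof (rule that[of f])
    fix i :: nat and x :: "nat \<Rightarrow> real" assume i: "i < length us"
    have "f i (\<Sum>k<length us. x k *\<^sub>R us ! k) = (\<Sum>k<length us. x k * f i (us ! k))"
      using linear_sum[OF f(1), of i "\<lambda>k. x k *\<^sub>R us ! k" "{..<length us}"] linear_scale[OF f(1)] by simp
    also have "\<dots> = (\<Sum>k<length us. if k = i then x i else 0)"
      using i us(2) by (intro sum.cong refl) (simp add: f(2) nth_eq_iff_index_eq)
    finally show "f i (\<Sum>k<length us. x k *\<^sub>R us ! k) = x i" using i by simp
  qed (use f in auto)
qed

section \<open>Volume with respect to a top-degree form\<close>

locale form_volume =
  fixes W :: "'v::euclidean_space set" and \<eta> :: "'v list \<Rightarrow> real" and n :: nat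
  assumes W: "subspace W" and dim_W: "dim W = n" and alt: "alternating_form n \<eta>"
begin

abbreviation "vol \<equiv> density_measure W \<eta>"

lemma sets_vol [simp, measurable_cong]: "sets vol = sets borel"
  by (simp add: density_measure_def Let_def)

text \<open>This frees the measure from the basis chosen by \<open>SOME\<close>: each later
  computation may take the basis that suits it.\<close>

lemma emeasure_vol:
  assumes us: "basis_list W us" and A: "A \<in> sets borel"
  shows "emeasure vol A = ennreal \<bar>\<eta> us\<bar> * list_integral us (indicator A)"
proof -
  define ws where "ws = (SOME ws. basis_list W ws)"
  have ws: "basis_list W ws"
    unfolding ws_def using ex_basis_list[OF W] by (rule someI_ex)
  have ind: "(indicator A :: 'v \<Rightarrow> ennreal) \<in> borel_measurable borel" using A by simp
  have "emeasure vol A = ennreal \<bar>\<eta> ws\<bar> * list_integral ws (indicator A)"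
    unfolding density_measure_def ws_def[symmetric] Let_def list_integral_def lincomb_integral_def
    using A nn_integral_distr[OF measurable_lincomb[where I = "{..<length ws}" and u = "(!) ws"], of "indicator A"]
    by simp
  also have "\<dots> = ennreal \<bar>\<eta> us\<bar> * list_integral us (indicator A)"
    using list_integral_basis_change[OF _ us ws ind] alt dim_W by simp
  finally show ?thesis .
qed

lemma hyperplane_null:
  assumes "w \<in> W" "z \<bullet> w \<noteq> 0"
  shows "{x. z \<bullet> x = c} \<in> null_sets vol"
proof -
  obtain us where us: "basis_list W us" using ex_basis_list[OF W] by blast
  have "\<exists>i<length us. z \<bullet> us ! i \<noteq> 0"
  proof (rule ccontr)
    assume "\<not> ?thesis"
    then have "z \<bullet> (\<Sum>k<length us. x k *\<^sub>R us ! k) = 0" for x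
      by (simp add: inner_sum_right)
    moreover have "w \<in> span (set us)" using us assms by (simp add: basis_list_def)
    ultimately show False using assms span_list_conv by metis
  qed
  then show ?thesis
    by (intro null_setsI) (auto simp: emeasure_vol[OF us] borel_closed closed_hyperplane list_integral_def
        intro!: lincomb_integral_hyperplane)
qed

lemma emeasure_vol_translate:
  assumes w: "w \<in> W" and A: "A \<in> sets borel"
  shows "emeasure vol ((+) w ` A) = emeasure vol A"
proof -
  obtain us where us: "basis_list W us" using ex_basis_list[OF W] by blast
  have "- w \<in> span (set us)" using us w W by (simp add: basis_list_def subspace_neg)
  then obtain c where c: "- w = (\<Sum>k<length us. c k *\<^sub>R us ! k)" using span_list_conv by metis
  have eq: "(+) w ` A = (\<lambda>z. z + - w) -` A" 
  proof (intro subset_antisym subsetI)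
    fix x assume "x \<in> (\<lambda>z. z + - w) -` A"
    then show "x \<in> (+) w ` A" by (intro image_eqI[of _ _ "x - w"]) auto
  qed auto
  have "(\<lambda>z. z + - w) -` A \<inter> space borel \<in> sets borel"
    using A by (intro measurable_sets[of _ borel]) auto
  then have m: "(+) w ` A \<in> sets borel" unfolding eq by simp
  have "indicator ((+) w ` A) = (\<lambda>z. indicator A (z + (\<Sum>k<length us. c k *\<^sub>R us ! k)) :: ennreal)"
    unfolding c[symmetric] eq by (auto simp: indicator_def)
  then show ?thesis
    unfolding emeasure_vol[OF us A] emeasure_vol[OF us m] list_integral_def
    using A by (subst lincomb_integral_translate[symmetric, of _ "{..<length us}" _ _ c]) auto
qed

lemma measure_vol_translate:
  "w \<in> W \<Longrightarrow> A \<in> sets borel \<Longrightarrow> measure vol ((+) w ` A) = measure vol A"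
  by (simp add: measure_def emeasure_vol_translate)

text \<open>The coordinate functionals of a basis are continuous, hence bounded on \<open>K\<close>;
  the parameters that land in \<open>K\<close> therefore lie in a box of finite measure.\<close>

lemma compact_fmeasurable:
  assumes K: "compact K"
  shows "K \<in> fmeasurable vol"
proof (rule fmeasurableI)
  obtain us where us: "basis_list W us" using ex_basis_list[OF W] by blast
  obtain f where f: "\<And>i. i < length us \<Longrightarrow> linear (f i)"
      "\<And>i x. i < length us \<Longrightarrow> f i (\<Sum>k<length us. x k *\<^sub>R us ! k) = x i"
    using basis_list_coordinates[OF us] by blast
  have "\<exists>R. \<forall>x\<in>K. \<bar>f i x\<bar> \<le> R" if "i < length us" for i
  proof -
    have "compact (f i ` K)"
      using K f(1)[OF that] by (intro compact_continuous_image linear_continuous_on) (auto simp: linear_conv_bounded_linear)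
    then show ?thesis using compact_imp_bounded[of "f i ` K"] by (auto simp: bounded_real)
  qed
  then obtain R where R: "\<And>i x. i < length us \<Longrightarrow> x \<in> K \<Longrightarrow> \<bar>f i x\<bar> \<le> R i" by metis
  have Kb: "K \<in> sets borel" using K by (simp add: borel_closed compact_imp_closed)
  then show "K \<in> sets vol" by simp
  have "list_integral us (indicator K)
     \<le> (\<integral>\<^sup>+x. indicator (Pi\<^sub>E {..<length us} (\<lambda>i. {-R i..R i})) x \<partial>Pi\<^sub>M {..<length us} (\<lambda>_. lborel))"
    unfolding list_integral_def lincomb_integral_def
  proof (rule nn_integral_mono)
    fix x :: "nat \<Rightarrow> real" assume x: "x \<in> space (Pi\<^sub>M {..<length us} (\<lambda>_. lborel))"
    have "x \<in> Pi\<^sub>E {..<length us} (\<lambda>i. {-R i..R i})" if "(\<Sum>k<length us. x k *\<^sub>R us ! k) \<in> K"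
    proof -
      have "\<bar>x i\<bar> \<le> R i" if "i < length us" for i
        using R[OF that \<open>_ \<in> K\<close>] f(2)[OF that, of x] by simp
      then show ?thesis using x by (simp add: space_PiM PiE_iff abs_le_iff minus_le_iff)
    qed
    then show "indicator K (\<Sum>k<length us. x k *\<^sub>R us ! k)
        \<le> (indicator (Pi\<^sub>E {..<length us} (\<lambda>i. {-R i..R i})) x :: ennreal)"
      by (auto simp: indicator_def)
  qed
  also have "\<dots> = (\<Prod>i<length us. emeasure lborel {-R i..R i})"
    by (subst nn_integral_indicator) (auto intro!: lborel_product.emeasure_PiM sets_PiM_I_finite)
  also have "\<dots> < \<infinity>"
    by (simp add: ennreal_prod_eq_top less_top[symmetric] emeasure_lborel_Icc_eq)
  finally show "emeasure vol K < \<infinity>"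
    by (simp add: emeasure_vol[OF us Kb] ennreal_mult_less_top)
qed

text \<open>Coordinates in a basis are unique, so the parallelepiped pulls back to the box with
  sides \<open>c k\<close>, and the density contributes the value of the form on that same
  basis.\<close>

lemma parallelepiped_volume:
  assumes us: "basis_list W us" and c: "\<And>k. k < n \<Longrightarrow> c k > 0"
  shows "measure vol (wsum {..<n} c (\<lambda>k. closed_segment 0 (us ! k))) = (\<Prod>k<n. c k) * \<bar>\<eta> us\<bar>"
proof -
  let ?P = "wsum {..<n} c (\<lambda>k. closed_segment 0 (us ! k))"
  have len: "length us = n" using basis_list_length[OF us] dim_W by simp
  obtain f where f: "\<And>i. i < length us \<Longrightarrow> linear (f i)"
      "\<And>i x. i < length us \<Longrightarrow> f i (\<Sum>k<length us. x k *\<^sub>R us ! k) = x i"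
    using basis_list_coordinates[OF us] by blast
  have "us ! k \<in> W" if "k < n" for k
    using that us len unfolding basis_list_def by (metis nth_mem span_base)
  then have "closed_segment 0 (us ! k) \<in> convex_bodies W" if "k < n" for k
    using that W closed_segment_subset[of 0 W "us ! k"]
    by (auto simp: convex_bodies_def subspace_0 subspace_imp_convex)
  then have "?P \<in> convex_bodies W" by (intro convex_bodies_wsum W) auto
  then have Pb: "?P \<in> sets borel" by (auto simp: convex_bodies_def borel_closed compact_imp_closed)
  have "list_integral us (indicator ?P)
     = (\<integral>\<^sup>+x. indicator (Pi\<^sub>E {..<n} (\<lambda>i. {0..c i})) x \<partial>Pi\<^sub>M {..<n} (\<lambda>_. lborel))"
    unfolding list_integral_def lincomb_integral_def len
  proof (rule nn_integral_cong)
    fix x :: "nat \<Rightarrow> real" assume x: "x \<in> space (Pi\<^sub>M {..<n} (\<lambda>_. lborel))"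
    have "(\<Sum>k<n. x k *\<^sub>R us ! k) \<in> ?P \<longleftrightarrow> x \<in> Pi\<^sub>E {..<n} (\<lambda>i. {0..c i})"
    proof
      assume "(\<Sum>k<n. x k *\<^sub>R us ! k) \<in> ?P"
      then obtain y where y: "(\<Sum>k<n. x k *\<^sub>R us ! k) = (\<Sum>k<n. c k *\<^sub>R y k)"
          "\<forall>k\<in>{..<n}. \<exists>t. 0 \<le> t \<and> t \<le> 1 \<and> y k = t *\<^sub>R us ! k"
        unfolding wsum_def by (auto simp: in_segment)
      from y(2) obtain t where t: "\<And>k. k < n \<Longrightarrow> 0 \<le> t k \<and> t k \<le> 1 \<and> y k = t k *\<^sub>R us ! k" by (metis lessThan_iff)
      have "(\<Sum>k<n. x k *\<^sub>R us ! k) = (\<Sum>k<n. (c k * t k) *\<^sub>R us ! k)"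
        unfolding y(1) using t by (intro sum.cong) auto
      then have "x k = c k * t k" if "k < n" for k
        using f(2)[of k x] f(2)[of k "\<lambda>k. c k * t k"] that by (simp add: len)
      then show "x \<in> Pi\<^sub>E {..<n} (\<lambda>i. {0..c i})"
        using x t c by (auto simp: space_PiM PiE_iff less_imp_le mult_left_le)
    next
      assume *: "x \<in> Pi\<^sub>E {..<n} (\<lambda>i. {0..c i})"
      have "x k *\<^sub>R us ! k = c k *\<^sub>R (x k / c k) *\<^sub>R us ! k" if "k < n" for k
        using c[OF that] by simp
      then have "(\<Sum>k<n. x k *\<^sub>R us ! k) = (\<Sum>k<n. c k *\<^sub>R (x k / c k) *\<^sub>R us ! k)"
        by (intro sum.cong) auto
      moreover have "\<forall>k\<in>{..<n}. (x k / c k) *\<^sub>R us ! k \<in> closed_segment 0 (us ! k)"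
        using * c by (auto simp: in_segment PiE_iff less_imp_le intro!: exI[of _ "x _ / c _"] divide_nonneg_pos)
      ultimately show "(\<Sum>k<n. x k *\<^sub>R us ! k) \<in> ?P"
        unfolding wsum_def by (intro CollectI exI[of _ "\<lambda>k. (x k / c k) *\<^sub>R us ! k"]) auto
    qed
    then show "indicator ?P (\<Sum>k<n. x k *\<^sub>R us ! k)
        = (indicator (Pi\<^sub>E {..<n} (\<lambda>i. {0..c i})) x :: ennreal)"
      by (simp add: indicator_def)
  qed
  also have "\<dots> = (\<Prod>i<n. emeasure lborel {0..c i})"
    by (subst nn_integral_indicator) (auto intro!: lborel_product.emeasure_PiM sets_PiM_I_finite)
  also have "\<dots> = (\<Prod>i<n. ennreal (c i))"
    using c by (intro prod.cong) (auto simp: less_imp_le)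
  also have "\<dots> = ennreal (\<Prod>i<n. c i)"
    using c by (intro prod_ennreal) (auto simp: less_imp_le)
  finally have "emeasure vol ?P = ennreal (\<bar>\<eta> us\<bar> * (\<Prod>i<n. c i))"
    by (simp add: emeasure_vol[OF us Pb] ennreal_mult')
  moreover have "0 \<le> (\<Prod>i<n. c i)" using c by (intro prod_nonneg) (auto simp: less_imp_le)
  ultimately show ?thesis by (simp add: measure_def)
qed

end

section \<open>Regular and mixed subdivisions\<close>

definition maximizers :: "'s set \<Rightarrow> ('s \<Rightarrow> real) \<Rightarrow> 's set" where
  "maximizers S g = {s \<in> S. \<forall>s'\<in>S. g s' \<le> g s}"

lemma maximizers_nonempty:
  assumes "finite S" "S \<noteq> {}"
  shows "maximizers S g \<noteq> {}"
proof -
  obtain s where "s \<in> S" "g s = Max (g ` S)"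
    using Max_in[of "g ` S"] assms by fastforce
  then show ?thesis
    using assms by (auto simp: maximizers_def intro!: exI[of _ s])
qed

lemma maximizers_subset: "maximizers S g \<subseteq> S"
  by (auto simp: maximizers_def)

text \<open>In a convex combination for \<open>x\<close> the terms
  \<open>u t * (m - l \<bullet> t)\<close> are nonnegative with sum at most 0. All of them vanish,
  so the coefficients are concentrated on the points where the maximum is attained.\<close>

lemma convex_hull_exposed_face:
  fixes q :: "'s \<Rightarrow> 'a::euclidean_space"
  assumes fin: "finite S" and x: "x \<in> convex hull (q ` S)"
    and le: "\<And>s. s \<in> S \<Longrightarrow> l \<bullet> q s \<le> m" and ge: "m \<le> l \<bullet> x"
  shows "x \<in> convex hull (q ` {s\<in>S. l \<bullet> q s = m})"
proof -
  let ?Q = "q ` S" and ?Q' = "q ` {s\<in>S. l \<bullet> q s = m}"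
  obtain u where u: "\<forall>t\<in>?Q. 0 \<le> u t" "sum u ?Q = 1" "(\<Sum>t\<in>?Q. u t *\<^sub>R t) = x"
    using x fin by (auto simp: convex_hull_finite)
  have "(\<Sum>t\<in>?Q. u t * (m - l \<bullet> t)) = m * sum u ?Q - l \<bullet> (\<Sum>t\<in>?Q. u t *\<^sub>R t)"
    by (simp add: right_diff_distrib sum_subtractf inner_sum_right sum_distrib_left mult.commute)
  also have "\<dots> \<le> 0" using u ge by simp
  finally have "(\<Sum>t\<in>?Q. u t * (m - l \<bullet> t)) \<le> 0" .
  moreover have nn: "0 \<le> u t * (m - l \<bullet> t)" if "t \<in> ?Q" for t
    using that u(1) le by auto
  ultimately have "(\<Sum>t\<in>?Q. u t * (m - l \<bullet> t)) = 0"
    using sum_nonneg[of ?Q "\<lambda>t. u t * (m - l \<bullet> t)"] by auto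
  then have "\<forall>t\<in>?Q. u t * (m - l \<bullet> t) = 0"
    using sum_nonneg_eq_0_iff[of ?Q "\<lambda>t. u t * (m - l \<bullet> t)"] nn fin by auto
  then have zero: "\<forall>t\<in>?Q - ?Q'. u t = 0" by auto
  have sub: "?Q' \<subseteq> ?Q" by auto
  have "sum u ?Q' = 1" "(\<Sum>t\<in>?Q'. u t *\<^sub>R t) = x"
    using u(2,3) sum.mono_neutral_right[of ?Q ?Q' u] sum.mono_neutral_right[of ?Q ?Q' "\<lambda>t. u t *\<^sub>R t"]
      zero sub fin by auto
  then show ?thesis
    using u(1) sub fin by (subst convex_hull_finite) (auto intro!: exI[of _ u])
qed

text \<open>
  Functionals on \<open>W\<close> are represented by the vectors orthogonal to \<open>v\<close>, for a fixed \<open>v\<close> outside \<open>W\<close>.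
\<close>

locale flat_volume = form_volume W \<eta> n for W :: "'v::euclidean_space set" and \<eta> and n +
  fixes f v :: 'v
  assumes W_eq: "W = {w. f \<bullet> w = 0}" and fv: "f \<bullet> v = 1"
begin

text \<open>The witness is the projection of \<open>z\<close> to \<open>W\<close> along
  \<open>v\<close>. As \<open>z\<close> is orthogonal to \<open>v\<close>, its inner product with
  this projection is that of \<open>z\<close> with itself.\<close>

lemma functional_nonzero:
  assumes "z \<bullet> v = 0" "z \<noteq> 0"
  shows "\<exists>w\<in>W. z \<bullet> w \<noteq> 0"
proof
  show "z - (f \<bullet> z) *\<^sub>R v \<in> W" by (simp add: W_eq inner_diff_right fv)
  show "z \<bullet> (z - (f \<bullet> z) *\<^sub>R v) \<noteq> 0" using assms by (simp add: inner_diff_right)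
qed

text \<open>For points of \<open>W\<close> this says that they do not affinely span
  \<open>W\<close>. Stating it by a functional that is not zero on \<open>W\<close> gives the null
  hyperplane directly and avoids affine dimension.\<close>

definition degenerate :: "('s \<Rightarrow> 'v) \<Rightarrow> 's set \<Rightarrow> bool" where
  "degenerate p T \<longleftrightarrow> (\<exists>z c. (\<exists>w\<in>W. z \<bullet> w \<noteq> 0) \<and> (\<forall>s\<in>T. z \<bullet> p s = c))"

lemma degenerate_null:
  assumes "finite T" "degenerate p T"
  shows "convex hull (p ` T) \<in> null_sets vol"
proof -
  obtain z c w where zc: "w \<in> W" "z \<bullet> w \<noteq> 0" "\<forall>s\<in>T. z \<bullet> p s = c"
    using assms unfolding degenerate_def by blast
  have "convex hull (p ` T) \<subseteq> {x. z \<bullet> x = c}"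
    using zc by (intro hull_minimal convex_hyperplane) auto
  moreover have "convex hull (p ` T) \<in> sets vol"
    using assms by (simp add: borel_closed compact_imp_closed finite_imp_compact_convex_hull)
  ultimately show ?thesis
    using hyperplane_null[OF zc(1,2)] null_sets_subset by blast
qed

text \<open>The highest point above \<open>x\<close> in the lifted hull is separated from the
  vertical ray over it. If the separating hyperplane is not vertical, dividing by its last
  coefficient gives the slope; the assumption \<open>nd\<close> excludes the vertical case.\<close>

lemma upper_face_covers:
  assumes fin: "finite S" and pW: "p ` S \<subseteq> W" and x: "x \<in> convex hull (p ` S)"
    and nd: "\<And>T. T \<subseteq> S \<Longrightarrow> degenerate p T \<Longrightarrow> x \<notin> convex hull (p ` T)"
  shows "\<exists>y. y \<bullet> v = 0 \<and> x \<in> convex hull (p ` maximizers S (\<lambda>s. y \<bullet> p s + h s))"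
proof -
  define q where "q s = (p s, h s)" for s
  define C where "C = convex hull (q ` S)"
  have fst_hull: "fst ` (convex hull (q ` T)) = convex hull (p ` T)" for T
    using convex_hull_linear_image[of fst "q ` T"] by (simp add: linear_fst image_image q_def)
  have "C \<inter> ({x} \<times> UNIV) \<noteq> {}"
    using x fst_hull[of S] unfolding C_def by force
  moreover have "compact (C \<inter> ({x} \<times> UNIV))"
    unfolding C_def using fin
    by (intro compact_Int_closed finite_imp_compact_convex_hull closed_Times) auto
  ultimately obtain a where a: "a \<in> C \<inter> ({x} \<times> UNIV)"
      "\<forall>b\<in>C \<inter> ({x} \<times> UNIV). snd b \<le> snd a"
    using continuous_attains_sup[of "C \<inter> ({x} \<times> UNIV)" snd] continuous_on_snd[OF continuous_on_id]
    by blast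
  define c where "c = snd a"
  have c: "(x, c) \<in> C" using a(1) by (auto simp: c_def)
  have c_max: "t \<le> c" if "(x, t) \<in> C" for t
    using bspec[OF a(2), of "(x, t)"] that by (simp add: c_def)
  \<comment> \<open>Adding the full line spanned by \<open>v\<close> to the hull forces the
    separating functional to vanish on \<open>v\<close>, as is required of a slope.\<close>
  define L where "L = range (\<lambda>t::real. (t *\<^sub>R v, 0::real))"
  define C' where "C' = (\<Union>a\<in>C. \<Union>b\<in>L. {a + b})"
  have "C \<subseteq> W \<times> UNIV"
    unfolding C_def using pW W
    by (intro hull_minimal convex_Times) (auto simp: q_def subspace_imp_convex)
  have xW: "x \<in> W" using x pW hull_minimal[of "p ` S" W convex] W by (auto simp: subspace_imp_convex)
  \<comment> \<open>A nonzero step along \<open>v\<close> leaves \<open>W\<close>, so over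
    \<open>x\<close> the enlarged hull reaches no height that the original one does not
    reach.\<close>
  have disj: "C' \<inter> ({x} \<times> {c<..}) = {}"
  proof -
    have False if a: "a \<in> C" "a + (t *\<^sub>R v, 0) = (x, s)" "s > c" for a t s
    proof -
      have "fst a \<in> W" using a \<open>C \<subseteq> W \<times> UNIV\<close> by auto
      moreover have "fst a + t *\<^sub>R v = x" using a(2) by (cases a) auto
      ultimately have "t = 0" using xW fv unfolding W_eq by (auto simp: inner_add_right)
      then have "(x, s) \<in> C" using a by (cases a) auto
      then show False using c_max[of s] a(3) by simp
    qed
    then show ?thesis unfolding C'_def L_def by fastforce
  qed
  have "convex L"
    unfolding L_def using convex_linear_image[of "\<lambda>t::real. (t *\<^sub>R v, 0::real)" UNIV]
    by (simp add: linear_iff scaleR_add_left)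
  then have "convex C'"
    unfolding C'_def C_def by (intro convex_sums) auto
  moreover have "C' \<noteq> {}" using c by (auto simp: C'_def L_def)
  moreover have "convex ({x} \<times> {c<..})" by (intro convex_Times) auto
  moreover have "{x} \<times> {c<..} \<noteq> {}" using lt_ex[of c] gt_ex[of c] by auto
  ultimately obtain ze b where sep: "ze \<noteq> 0" "\<And>a. a \<in> C' \<Longrightarrow> ze \<bullet> a \<le> b"
      "\<And>a. a \<in> {x} \<times> {c<..} \<Longrightarrow> b \<le> ze \<bullet> a"
    using separating_hyperplane_sets[OF _ _ _ _ disj] by metis
  obtain z e where ze: "ze = (z, e)" by (cases ze)
  have C'mem: "a + (t *\<^sub>R v, 0) \<in> C'" if "a \<in> C" for a t using that by (auto simp: C'_def L_def)
  have sepC: "z \<bullet> fst a + t * (z \<bullet> v) + e * snd a \<le> b" if "a \<in> C" for a t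
    using sep(2)[OF C'mem[OF that, of t]] by (cases a) (simp add: ze inner_add_right)
  have sepD: "b \<le> z \<bullet> x + e * t" if "t > c" for t
    using sep(3)[of "(x, t)"] that by (simp add: ze)
  have zv: "z \<bullet> v = 0"
  proof (rule ccontr)
    assume "z \<bullet> v \<noteq> 0"
    then show False
      using sepC[OF c, of "(b + 1 - z \<bullet> x - e * c) / (z \<bullet> v)"] by simp
  qed
  have e: "0 \<le> e"
  proof (rule ccontr)
    assume "\<not> 0 \<le> e"
    then have "e < 0" by simp
    \<comment> \<open>For negative \<open>e\<close> the bound in \<open>sepD\<close> fails at large
      heights; the second argument of \<open>max\<close> is the height at which its right-hand side
      has dropped to \<open>b - 1\<close>.\<close>
    define t where "t = max (c + 1) ((b - 1 - z \<bullet> x) / e)"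
    have "e * t \<le> e * ((b - 1 - z \<bullet> x) / e)"
      using \<open>e < 0\<close> by (intro mult_left_mono_neg) (auto simp: t_def)
    then have "e * t \<le> b - 1 - z \<bullet> x" using \<open>e < 0\<close> by simp
    moreover have "t > c" by (simp add: t_def)
    ultimately show False using sepD[of t] by simp
  qed
  \<comment> \<open>The inequality \<open>sepD\<close> holds only strictly above \<open>c\<close>.
    If it failed at \<open>c\<close> itself, a height that makes up half of the gap would contradict
    it.\<close>
  have top: "b \<le> z \<bullet> x + e * c"
  proof (cases "e = 0")
    case True then show ?thesis using sepD[of "c + 1"] by simp
  next
    case False
    then have "e > 0" using e by simp
    show ?thesis
    proof (rule ccontr)
      assume *: "\<not> ?thesis"
      then have "c < c + (b - z \<bullet> x - e * c) / (2 * e)" using \<open>e > 0\<close> by simp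
      then have "b \<le> z \<bullet> x + e * (c + (b - z \<bullet> x - e * c) / (2 * e))"
        by (rule sepD)
      also have "e * (c + (b - z \<bullet> x - e * c) / (2 * e)) = e * c + (b - z \<bullet> x - e * c) / 2"
        using \<open>e > 0\<close> by (simp add: distrib_left)
      finally have "2 * b \<le> b + (z \<bullet> x + e * c)" by (simp add: field_simps)
      then show False using * by simp
    qed
  qed
  define T where "T = {s\<in>S. (z, e) \<bullet> q s = b}"
  have "(x, c) \<in> convex hull (q ` T)"
    unfolding T_def
  proof (rule convex_hull_exposed_face[OF fin])
    show "(x, c) \<in> convex hull (q ` S)" using c by (simp add: C_def)
    fix s assume "s \<in> S"
    then have "q s \<in> C" by (simp add: C_def hull_inc)
    from sepC[OF this, of 0] show "(z, e) \<bullet> q s \<le> b" by (simp add: q_def)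
  qed (use top in simp)
  then have xT: "x \<in> convex hull (p ` T)"
    using fst_hull[of T] by force
  \<comment> \<open>A vertical supporting hyperplane would place \<open>x\<close> in the hull of
    labels on which a functional nonzero on \<open>W\<close> is constant.\<close>
  have "e \<noteq> 0"
  proof
    assume "e = 0"
    then have "z \<noteq> 0" using sep(1) ze by (auto simp: zero_prod_def)
    then have "degenerate p T"
      unfolding degenerate_def using functional_nonzero[OF zv] \<open>e = 0\<close>
      by (auto simp: T_def q_def)
    then show False using nd[of T] xT by (auto simp: T_def)
  qed
  then have "e > 0" using e by simp
  define y where "y = (1 / e) *\<^sub>R z"
  have val: "e * (y \<bullet> p s + h s) = (z, e) \<bullet> q s" for s
    using \<open>e > 0\<close> by (simp add: y_def q_def field_simps)
  have "T \<subseteq> maximizers S (\<lambda>s. y \<bullet> p s + h s)"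
  proof
    fix s assume s: "s \<in> T"
    have "y \<bullet> p s' + h s' \<le> y \<bullet> p s + h s" if "s' \<in> S" for s'
    proof -
      have "q s' \<in> C" using that by (simp add: C_def hull_inc)
      then have "(z, e) \<bullet> q s' \<le> b" using sepC[of "q s'" 0] by (simp add: q_def)
      then have "e * (y \<bullet> p s' + h s') \<le> e * (y \<bullet> p s + h s)"
        unfolding val using s by (simp add: T_def)
      then show ?thesis using \<open>e > 0\<close> by simp
    qed
    then show "s \<in> maximizers S (\<lambda>s. y \<bullet> p s + h s)"
      using s by (auto simp: maximizers_def T_def)
  qed
  from subsetD[OF hull_mono[OF image_mono[OF this]] xT]
  have "x \<in> convex hull (p ` maximizers S (\<lambda>s. y \<bullet> p s + h s))" .
  moreover have "y \<bullet> v = 0" using zv by (simp add: y_def)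
  ultimately show ?thesis by blast
qed

text \<open>Finiteness comes from the labels: a nondegenerate cell determines its slope, and there
  are only finitely many sets of labels. The last clause allows any further slopes to be added to
  \<open>Y\<close> at no cost, which later makes it possible to compare the slopes found for
  different weights.\<close>

lemma volume_regular_subdivision:
  fixes p :: "'s \<Rightarrow> 'v" and h :: "'s \<Rightarrow> real"
  assumes fin: "finite S" and pW: "p ` S \<subseteq> W"
  defines "F \<equiv> \<lambda>y. convex hull (p ` maximizers S (\<lambda>s. y \<bullet> p s + h s))"
  shows "\<exists>Y. finite Y \<and> Y \<subseteq> {y. y \<bullet> v = 0} \<and>
    measure vol (convex hull (p ` S)) = (\<Sum>y\<in>Y. measure vol (F y)) \<and>
    (\<forall>y. y \<bullet> v = 0 \<longrightarrow> y \<notin> Y \<longrightarrow> measure vol (F y) = 0)"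
proof -
  define G where "G y = maximizers S (\<lambda>s. y \<bullet> p s + h s)" for y
  define Y where "Y = {y. y \<bullet> v = 0 \<and> \<not> degenerate p (G y)}"
  define M where "M y = Max ((\<lambda>s. y \<bullet> p s + h s) ` S)" for y
  have G_sub: "G y \<subseteq> S" and G_fin: "finite (G y)" for y
    using fin finite_subset[of "G y" S] by (auto simp: G_def maximizers_def)
  have G_val: "y \<bullet> p s + h s = M y" if "s \<in> G y" for y s
    unfolding M_def using that fin by (intro Max_eqI[symmetric]) (auto simp: G_def maximizers_def)
  have M_ge: "y \<bullet> p s + h s \<le> M y" if "s \<in> S" for y s
    unfolding M_def using that fin by (intro Max_ge) auto
  \<comment> \<open>Two slopes with the same maximizers differ by a functional that is constant on
    these, so their common cell would be degenerate.\<close>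
  have inj: "inj_on G Y"
  proof (rule inj_onI, rule ccontr)
    fix y y' assume y: "y \<in> Y" "y' \<in> Y" "G y = G y'" "y \<noteq> y'"
    have "(y - y') \<bullet> p s = M y - M y'" if "s \<in> G y" for s
      using G_val[OF that] G_val[of s y'] that y(3) by (simp add: inner_diff_left)
    moreover have "\<exists>w\<in>W. (y - y') \<bullet> w \<noteq> 0"
      using y by (intro functional_nonzero) (auto simp: Y_def inner_diff_left)
    ultimately have "degenerate p (G y)" unfolding degenerate_def by blast
    then show False using y by (simp add: Y_def)
  qed
  have "G ` Y \<subseteq> Pow S" using G_sub by blast
  then have "finite (G ` Y)" using fin by (simp add: finite_subset)
  then have finY: "finite Y" using inj by (rule finite_imageD)
  have F_eq: "F y = convex hull (p ` G y)" for y by (simp add: F_def G_def)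
  have F_fm: "F y \<in> fmeasurable vol" for y
    unfolding F_eq by (intro compact_fmeasurable finite_imp_compact_convex_hull finite_imageI G_fin)
  have overlap: "F y \<inter> F y' \<in> null_sets vol" if y: "y \<in> Y" "y' \<in> Y" "y \<noteq> y'" for y y'
  proof -
    \<comment> \<open>On its own cell the slope \<open>y\<close> attains \<open>M y\<close>, while
      \<open>y'\<close> attains at most \<open>M y'\<close>. Exchanging the slopes gives the
      opposite inequality, so the overlap of two cells lies in a hyperplane.\<close>
    have half: "F y \<subseteq> {x. (y' - y) \<bullet> x \<le> M y' - M y}" for y y'
      unfolding F_eq
    proof (rule hull_minimal)
      show "p ` G y \<subseteq> {x. (y' - y) \<bullet> x \<le> M y' - M y}"
      proof clarify
        fix s assume s: "s \<in> G y"
        show "(y' - y) \<bullet> p s \<le> M y' - M y"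
          using G_val[OF s] M_ge[of s y'] s G_sub[of y] by (auto simp: inner_diff_left)
      qed
    qed (rule convex_halfspace_le)
    have "F y \<inter> F y' \<subseteq> {x. (y' - y) \<bullet> x = M y' - M y}"
      using half[of y y'] half[of y' y] by (fastforce simp: inner_diff_left)
    moreover obtain w where "w \<in> W" "(y' - y) \<bullet> w \<noteq> 0"
      using functional_nonzero[of "y' - y"] y by (auto simp: Y_def inner_diff_left)
    ultimately show ?thesis
      by (intro null_sets_subset[OF hyperplane_null] sets.Int fmeasurableD F_fm)
  qed
  \<comment> \<open>Off this finite union of null sets \<open>upper_face_covers\<close> applies, and
    the cell that it provides is nondegenerate.\<close>
  define Z where "Z = (\<Union>T\<in>{T. T \<subseteq> S \<and> degenerate p T}. convex hull (p ` T))"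
  have Z: "Z \<in> null_sets vol"
    unfolding Z_def
  proof (rule null_sets_UN')
    show "countable {T. T \<subseteq> S \<and> degenerate p T}"
      using fin by (intro countable_finite) simp
    fix T assume "T \<in> {T. T \<subseteq> S \<and> degenerate p T}"
    then show "convex hull (p ` T) \<in> null_sets vol"
      using fin by (intro degenerate_null) (auto intro: finite_subset)
  qed
  have sub: "(\<Union>y\<in>Y. F y) \<subseteq> convex hull (p ` S)"
    unfolding F_eq using G_sub by (intro UN_least hull_mono image_mono)
  have cover: "convex hull (p ` S) \<subseteq> (\<Union>y\<in>Y. F y) \<union> Z"
  proof
    fix x assume x: "x \<in> convex hull (p ` S)"
    show "x \<in> (\<Union>y\<in>Y. F y) \<union> Z"
    proof (cases "x \<in> Z")
      case False
      then obtain y where y: "y \<bullet> v = 0" "x \<in> F y"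
        using upper_face_covers[OF fin pW x, of h] unfolding Z_def F_def by blast
      moreover have "\<not> degenerate p (G y)"
        using False y G_sub[of y] unfolding Z_def F_eq by blast
      ultimately show ?thesis by (auto simp: Y_def)
    qed simp
  qed
  have UF: "(\<Union>y\<in>Y. F y) \<in> sets vol"
    by (intro sets.finite_UN finY fmeasurableD F_fm)
  have "measure vol (convex hull (p ` S)) = measure vol (\<Union>y\<in>Y. F y)"
  proof (rule measure_eq_AE)
    show "AE x in vol. (x \<in> convex hull (p ` S)) = (x \<in> (\<Union>y\<in>Y. F y))"
      using AE_not_in[OF Z] by eventually_elim (use sub cover in blast)
    show "convex hull (p ` S) \<in> sets vol"
      using fin by (simp add: borel_closed compact_imp_closed finite_imp_compact_convex_hull)
  qed (rule UF)
  also have "\<dots> = (\<Sum>y\<in>Y. measure vol (F y))"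
  proof (rule measure_UNION_AE[OF finY F_fm], rule pairwiseI)
    fix y y' assume "y \<in> Y" "y' \<in> Y" "y \<noteq> y'"
    from AE_not_in[OF overlap[OF this]] show "AE x in vol. x \<notin> F y \<or> x \<notin> F y'"
      by eventually_elim auto
  qed
  finally have "measure vol (convex hull (p ` S)) = (\<Sum>y\<in>Y. measure vol (F y))" .
  moreover have "measure vol (F y) = 0" if "y \<bullet> v = 0" "y \<notin> Y" for y
    using that degenerate_null[OF G_fin] by (auto simp: Y_def F_eq null_sets_def measure_def)
  ultimately show ?thesis
    using finY by (intro exI[of _ Y]) (auto simp: Y_def)
qed

end

section \<open>From regular subdivisions to mixed subdivisions\<close>

lemma wsum_image:
  "wsum I c (\<lambda>k. p k ` S k) = (\<lambda>\<sigma>. \<Sum>k\<in>I. c k *\<^sub>R p k (\<sigma> k)) ` Pi\<^sub>E I S"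
proof (intro subset_antisym subsetI)
  fix z assume "z \<in> wsum I c (\<lambda>k. p k ` S k)"
  then obtain x where x: "z = (\<Sum>k\<in>I. c k *\<^sub>R x k)" "\<forall>k\<in>I. x k \<in> p k ` S k"
    unfolding wsum_def by blast
  from x(2) have "\<forall>k\<in>I. \<exists>s. s \<in> S k \<and> x k = p k s" by blast
  from bchoice[OF this] obtain \<sigma> where \<sigma>: "\<forall>k\<in>I. \<sigma> k \<in> S k \<and> x k = p k (\<sigma> k)" ..
  show "z \<in> (\<lambda>\<sigma>. \<Sum>k\<in>I. c k *\<^sub>R p k (\<sigma> k)) ` Pi\<^sub>E I S"
  proof (rule image_eqI)
    show "z = (\<Sum>k\<in>I. c k *\<^sub>R p k (restrict \<sigma> I k))"
      unfolding x using \<sigma> by (intro sum.cong) auto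
    show "restrict \<sigma> I \<in> Pi\<^sub>E I S" using \<sigma> by auto
  qed
next
  fix z assume "z \<in> (\<lambda>\<sigma>. \<Sum>k\<in>I. c k *\<^sub>R p k (\<sigma> k)) ` Pi\<^sub>E I S"
  then obtain \<sigma> where \<sigma>: "\<sigma> \<in> Pi\<^sub>E I S" "z = (\<Sum>k\<in>I. c k *\<^sub>R p k (\<sigma> k))" by blast
  show "z \<in> wsum I c (\<lambda>k. p k ` S k)"
    unfolding wsum_def using \<sigma> by (intro CollectI exI[of _ "\<lambda>k. p k (\<sigma> k)"]) (auto simp: PiE_iff)
qed

lemma wsum_convex_hull:
  assumes "finite I"
  shows "wsum I c (\<lambda>k. convex hull (X k)) = convex hull (wsum I c X)"
  using assms
proof (induction I rule: finite_induct)
  case (insert k I)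
  have plus: "mink_comb s A t B = (*\<^sub>R) s ` A + (*\<^sub>R) t ` B" for s t and A B :: "'b set"
    unfolding mink_comb_def set_plus_def by blast
  show ?case
    using insert by (simp add: wsum_insert plus convex_hull_set_plus convex_hull_scaling)
qed simp

text \<open>The objective is separable, so a choice is optimal exactly when each coordinate is.
  Positive weights do not affect which coordinates are optimal; a weight 0 would.\<close>

lemma maximizers_PiE:
  assumes "finite I" "\<And>k. k \<in> I \<Longrightarrow> 0 < c k"
  shows "maximizers (Pi\<^sub>E I S) (\<lambda>\<sigma>. \<Sum>k\<in>I. c k * g k (\<sigma> k)) = Pi\<^sub>E I (\<lambda>k. maximizers (S k) (g k))"
proof (intro subset_antisym subsetI)
  fix \<sigma> assume \<sigma>: "\<sigma> \<in> maximizers (Pi\<^sub>E I S) (\<lambda>\<sigma>. \<Sum>k\<in>I. c k * g k (\<sigma> k))"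
  have "g k s \<le> g k (\<sigma> k)" if k: "k \<in> I" and s: "s \<in> S k" for k s
  proof -
    have "\<sigma>(k := s) \<in> Pi\<^sub>E I S"
      using \<sigma> k s by (auto simp: maximizers_def PiE_iff extensional_def)
    then have "(\<Sum>j\<in>I. c j * g j ((\<sigma>(k := s)) j)) \<le> (\<Sum>j\<in>I. c j * g j (\<sigma> j))"
      using \<sigma> by (auto simp: maximizers_def)
    moreover have "(\<Sum>j\<in>I - {k}. c j * g j ((\<sigma>(k := s)) j)) = (\<Sum>j\<in>I - {k}. c j * g j (\<sigma> j))"
      by (intro sum.cong) auto
    ultimately have "c k * g k s \<le> c k * g k (\<sigma> k)"
      using sum.remove[OF assms(1) k, of "\<lambda>j. c j * g j ((\<sigma>(k := s)) j)"]
        sum.remove[OF assms(1) k, of "\<lambda>j. c j * g j (\<sigma> j)"] by simp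
    then show ?thesis using assms(2)[OF k] by simp
  qed
  then show "\<sigma> \<in> Pi\<^sub>E I (\<lambda>k. maximizers (S k) (g k))"
    using \<sigma> by (auto simp: maximizers_def PiE_iff)
next
  fix \<sigma> assume \<sigma>: "\<sigma> \<in> Pi\<^sub>E I (\<lambda>k. maximizers (S k) (g k))"
  have "(\<Sum>k\<in>I. c k * g k (\<tau> k)) \<le> (\<Sum>k\<in>I. c k * g k (\<sigma> k))" if "\<tau> \<in> Pi\<^sub>E I S" for \<tau>
    using that \<sigma> assms(2) by (intro sum_mono mult_left_mono) (auto simp: PiE_iff maximizers_def less_imp_le)
  then show "\<sigma> \<in> maximizers (Pi\<^sub>E I S) (\<lambda>\<sigma>. \<Sum>k\<in>I. c k * g k (\<sigma> k))"
    using \<sigma> by (auto simp: maximizers_def PiE_iff)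
qed

locale flat_mixed_volume =
  flat_volume W \<eta> n f v + mixed_volume W "density_measure W \<eta>" MV
  for W :: "'v::euclidean_space set" and \<eta> n f v MV
begin

lemma convex_body_borel: "K \<in> convex_bodies W \<Longrightarrow> K \<in> sets borel"
  by (auto simp: convex_bodies_def borel_closed compact_imp_closed)

text \<open>Translation invariance is not among the defining properties of \<open>MV\<close>; it is
  inherited from the volume through polarization.\<close>

lemma MV_translate:
  assumes "\<And>k. k < n \<Longrightarrow> K k \<in> convex_bodies W" "\<And>k. k < n \<Longrightarrow> t k \<in> W"
  shows "MV (map (\<lambda>k. (+) (t k) ` K k) [0..<n]) = MV (map K [0..<n])"
proof -
  have body: "(+) x ` L \<in> convex_bodies W" if "L \<in> convex_bodies W" "x \<in> W" for x L
    using that W by (auto simp: convex_bodies_def compact_translation subspace_add)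
  have "measure vol (wsum {..<n} c (\<lambda>k. (+) (t k) ` K k)) = measure vol (wsum {..<n} c K)" for c
    unfolding wsum_translate[OF finite_lessThan] using assms
    by (intro measure_vol_translate subspace_sum subspace_scale convex_body_borel convex_bodies_wsum W) auto
  then have "fact n * MV (map (\<lambda>k. (+) (t k) ` K k) [0..<n]) = fact n * MV (map K [0..<n])"
    using assms by (subst (1 2) polarization) (auto simp: dim_W intro!: body)
  then show ?thesis by simp
qed

text \<open>After a translation the point is the origin, which is an empty weighted sum, and
  linearity in its slot gives 0.\<close>

lemma MV_point:
  assumes K: "\<And>k. k < n \<Longrightarrow> K k \<in> convex_bodies W" and k0: "k0 < n" "K k0 = {x}"
  shows "MV (map K [0..<n]) = 0"
proof -
  have x: "x \<in> W" using K[OF k0(1)] k0(2) by (auto simp: convex_bodies_def)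
  define K' where "K' = K(k0 := {0})"
  have K': "K' k \<in> convex_bodies W" if "k < n" for k
    using that K zero_convex_body[OF W] by (auto simp: K'_def)
  have "MV (map K [0..<n]) = MV (map (\<lambda>k. (+) (if k = k0 then x else 0) ` K' k) [0..<n])"
    using k0 by (intro arg_cong[of _ _ MV] map_cong) (auto simp: K'_def)
  also have "\<dots> = MV (map K' [0..<n])"
    using x W by (intro MV_translate K') (auto simp: subspace_0)
  also have "map K' [0..<n] = (map K' [0..<n])[k0 := wsum {} (\<lambda>_::nat. 0) K']"
    using k0 by (intro nth_equalityI) (auto simp: nth_list_update K'_def)
  also have "MV \<dots> = 0"
    using k0 K' by (subst MV_slot_wsum) (auto simp: dim_W)
  finally show ?thesis .
qed

text \<open>The weighted sums are parallelepipeds, whose volume is the squarefree monomial in the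
  weights times the value of the form; polarization returns exactly this coefficient.\<close>

lemma MV_segments:
  assumes us: "basis_list W us"
  shows "fact n * MV (map (\<lambda>k. closed_segment 0 (us ! k)) [0..<n]) = \<bar>\<eta> us\<bar>"
proof -
  have len: "length us = n" using basis_list_length[OF us] dim_W by simp
  have "us ! k \<in> W" if "k < n" for k
    using that us len unfolding basis_list_def by (metis nth_mem span_base)
  then have body: "closed_segment 0 (us ! k) \<in> convex_bodies W" if "k < n" for k
    using that W closed_segment_subset[of 0 W "us ! k"]
    by (auto simp: convex_bodies_def subspace_0 subspace_imp_convex)
  have prod: "(\<Prod>k<n. cube_point S k) = prod_list (map (cube_point S) [0..<n])" for S
    using prod.distinct_set_conv_list[of "[0..<n]" "cube_point S"] by (simp add: atLeast0LessThan)
  have "fact n * MV (map (\<lambda>k. closed_segment 0 (us ! k)) [0..<n])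
      = (\<Sum>S\<in>Pow {..<n}. (-1) ^ (n - card S) * prod_list (map (cube_point S) [0..<n])) * \<bar>\<eta> us\<bar>"
    using body by (subst polarization)
      (simp_all add: dim_W parallelepiped_volume[OF us] cube_point_pos prod sum_distrib_right mult.assoc)
  also have "\<dots> = \<bar>\<eta> us\<bar>"
    by (subst cube_difference_monomial) auto
  finally show ?thesis .
qed

text \<open>Here \<open>y\<close> runs over the slopes of the upper faces of the lifted Minkowski sum.\<close>

lemma MV_mixed_subdivision:
  fixes p :: "nat \<Rightarrow> 's \<Rightarrow> 'v" and h :: "nat \<Rightarrow> 's \<Rightarrow> real"
  assumes S: "\<And>k. k < n \<Longrightarrow> finite (S k)" "\<And>k. k < n \<Longrightarrow> S k \<noteq> {}"
    and p: "\<And>k s. k < n \<Longrightarrow> s \<in> S k \<Longrightarrow> p k s \<in> W"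
  defines "F \<equiv> \<lambda>y k. convex hull (p k ` maximizers (S k) (\<lambda>s. y \<bullet> p k s + h k s))"
  assumes Y: "finite Y" "Y \<subseteq> {y. y \<bullet> v = 0}"
    and out: "\<And>y. y \<bullet> v = 0 \<Longrightarrow> y \<notin> Y \<Longrightarrow> MV (map (F y) [0..<n]) = 0"
  shows "MV (map (\<lambda>k. convex hull (p k ` S k)) [0..<n]) = (\<Sum>y\<in>Y. MV (map (F y) [0..<n]))"
proof -
  have body: "convex hull (p k ` T) \<in> convex_bodies W" if "k < n" "T \<subseteq> S k" "T \<noteq> {}" for k T
    using that S(1)[of k] p by (intro convex_hull_convex_body W finite_imageI) (auto intro: finite_subset)
  have F_body: "F y k \<in> convex_bodies W" if "k < n" for y k
    unfolding F_def using that S by (intro body maximizers_subset maximizers_nonempty) auto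
  \<comment> \<open>For each choice of weights, the vertices of the weighted sum are indexed by
    choice functions, with heights added up using the same weights. The upper face of slope
    \<open>y\<close> is then the weighted sum of the faces \<open>F y k\<close>, which do not depend
    on the weights.\<close>
  have ex: "\<exists>Y. finite Y \<and> Y \<subseteq> {y. y \<bullet> v = 0} \<and>
      measure vol (wsum {..<n} (cube_point D) (\<lambda>k. convex hull (p k ` S k)))
        = (\<Sum>y\<in>Y. measure vol (wsum {..<n} (cube_point D) (F y))) \<and>
      (\<forall>y. y \<bullet> v = 0 \<longrightarrow> y \<notin> Y \<longrightarrow> measure vol (wsum {..<n} (cube_point D) (F y)) = 0)" for D
  proof -
    let ?c = "cube_point D"
    let ?P = "\<lambda>\<sigma>. \<Sum>k<n. ?c k *\<^sub>R p k (\<sigma> k)" and ?H = "\<lambda>\<sigma>. \<Sum>k<n. ?c k * h k (\<sigma> k)"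
    have "(\<lambda>\<sigma>. y \<bullet> ?P \<sigma> + ?H \<sigma>) = (\<lambda>\<sigma>. \<Sum>k<n. ?c k * (y \<bullet> p k (\<sigma> k) + h k (\<sigma> k)))" for y
      by (simp add: inner_sum_right distrib_left sum.distrib)
    then have max: "maximizers (Pi\<^sub>E {..<n} S) (\<lambda>\<sigma>. y \<bullet> ?P \<sigma> + ?H \<sigma>)
        = Pi\<^sub>E {..<n} (\<lambda>k. maximizers (S k) (\<lambda>s. y \<bullet> p k s + h k s))" for y
      using maximizers_PiE[of "{..<n}" ?c S "\<lambda>k s. y \<bullet> p k s + h k s"] by (simp add: cube_point_pos)
    have "convex hull (?P ` maximizers (Pi\<^sub>E {..<n} S) (\<lambda>\<sigma>. y \<bullet> ?P \<sigma> + ?H \<sigma>)) = wsum {..<n} ?c (F y)" for y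
      unfolding max F_def wsum_convex_hull[OF finite_lessThan] wsum_image ..
    moreover have "convex hull (?P ` Pi\<^sub>E {..<n} S) = wsum {..<n} ?c (\<lambda>k. convex hull (p k ` S k))"
      unfolding wsum_convex_hull[OF finite_lessThan] wsum_image ..
    moreover have "finite (Pi\<^sub>E {..<n} S)"
      using S(1) by (intro finite_PiE) auto
    moreover have "?P ` Pi\<^sub>E {..<n} S \<subseteq> W"
      using p W by (auto intro!: subspace_sum subspace_scale simp: PiE_iff)
    ultimately show ?thesis
      using volume_regular_subdivision[of "Pi\<^sub>E {..<n} S" ?P ?H] by simp
  qed
  from choice[OF allI[OF ex]] obtain Z where "\<forall>D. finite (Z D) \<and> Z D \<subseteq> {y. y \<bullet> v = 0} \<and>
      measure vol (wsum {..<n} (cube_point D) (\<lambda>k. convex hull (p k ` S k)))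
        = (\<Sum>y\<in>Z D. measure vol (wsum {..<n} (cube_point D) (F y))) \<and>
      (\<forall>y. y \<bullet> v = 0 \<longrightarrow> y \<notin> Z D \<longrightarrow> measure vol (wsum {..<n} (cube_point D) (F y)) = 0)" ..
  then have Z: "\<And>D. finite (Z D)" "\<And>D. Z D \<subseteq> {y. y \<bullet> v = 0}"
    "\<And>D. measure vol (wsum {..<n} (cube_point D) (\<lambda>k. convex hull (p k ` S k)))
        = (\<Sum>y\<in>Z D. measure vol (wsum {..<n} (cube_point D) (F y)))"
    "\<And>D y. y \<bullet> v = 0 \<Longrightarrow> y \<notin> Z D \<Longrightarrow> measure vol (wsum {..<n} (cube_point D) (F y)) = 0"
    by simp_all
  define Y' where "Y' = (\<Union>D\<in>Pow {..<n}. Z D)"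
  have Y': "finite Y'" "Y' \<subseteq> {y. y \<bullet> v = 0}" using Z(1,2) by (auto simp: Y'_def)
  have "MV (map (\<lambda>k. convex hull (p k ` S k)) [0..<n]) = (\<Sum>y\<in>Y'. MV (map (F y) [0..<n]))"
  proof (rule MV_eq_sum)
    fix D :: "nat set" assume D: "D \<subseteq> {..<n}"
    have "(\<Sum>y\<in>Z D. measure vol (wsum {..<n} (cube_point D) (F y)))
        = (\<Sum>y\<in>Y'. measure vol (wsum {..<n} (cube_point D) (F y)))"
    proof (rule sum.mono_neutral_left[OF Y'(1)])
      show "Z D \<subseteq> Y'" using D by (auto simp: Y'_def)
      show "\<forall>y\<in>Y' - Z D. measure vol (wsum {..<n} (cube_point D) (F y)) = 0"
        using Y'(2) by (intro ballI Z(4)) auto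
    qed
    then show "measure vol (wsum {..<n} (cube_point D) (\<lambda>k. convex hull (p k ` S k)))
       = (\<Sum>y\<in>Y'. measure vol (wsum {..<n} (cube_point D) (F y)))"
      by (simp add: Z(3))
  qed (use dim_W body S F_body in auto)
  also have "\<dots> = (\<Sum>y\<in>Y' \<inter> Y. MV (map (F y) [0..<n]))"
    using Y' out by (intro sum.mono_neutral_right) auto
  also have "\<dots> = (\<Sum>y\<in>Y. MV (map (F y) [0..<n]))"
  proof (rule sum.mono_neutral_left)
    \<comment> \<open>A slope of \<open>Y\<close> that never occurs has cells of volume 0 for all
      weights, so polarization makes its mixed volume vanish.\<close>
    have "MV (map (F y) [0..<n]) = 0" if "y \<in> Y" "y \<notin> Y'" for y
    proof -
      have "measure vol (wsum {..<n} (cube_point D) (F y)) = 0" if "D \<in> Pow {..<n}" for D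
        using that \<open>y \<in> Y\<close> \<open>y \<notin> Y'\<close> Y(2) by (intro Z(4)) (auto simp: Y'_def)
      then have "fact n * MV (map (F y) [0..<n]) = 0"
        using F_body by (subst polarization) (auto simp: dim_W)
      then show ?thesis by simp
    qed
    then show "\<forall>y\<in>Y - Y' \<inter> Y. MV (map (F y) [0..<n]) = 0" by blast
  qed (use Y in auto)
  finally show ?thesis .
qed

end

section \<open>Subsets of maximal weight\<close>

text \<open>Two different optimal sets of equal size contain labels \<open>p\<close> and
  \<open>q\<close>, each missing from the other set, and since no exchange improves an optimal set
  their values agree. This value is the level: everything above it lies in \<open>J1\<close> without
  \<open>p\<close>, while \<open>J1\<close> and \<open>q\<close> all reach it.\<close>

lemma tie_of_two_maximizers:
  fixes val :: "'m \<Rightarrow> real"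
  assumes fin: "finite X"
    and J: "J1 \<in> maximizers {J. J \<subseteq> X \<and> card J = m} (sum val)"
      "J2 \<in> maximizers {J. J \<subseteq> X \<and> card J = m} (sum val)" "J1 \<noteq> J2"
  obtains \<tau> where "card {j\<in>X. \<tau> < val j} < m" "m < card {j\<in>X. \<tau> \<le> val j}"
proof -
  have exch: "val q \<le> val p" if J: "J \<in> maximizers {J. J \<subseteq> X \<and> card J = m} (sum val)"
    and pq: "p \<in> J" "q \<in> X" "q \<notin> J" for J p q
  proof -
    have JX: "J \<subseteq> X" "card J = m" using J by (auto simp: maximizers_def)
    then have finJ: "finite J" using fin finite_subset by blast
    let ?J = "insert q (J - {p})"
    have "card ?J = Suc (card (J - {p}))"
      using finJ pq by (intro card_insert_disjoint) auto
    also have "\<dots> = m" using card_Suc_Diff1[OF finJ pq(1)] JX(2) by (rule trans)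
    finally have "card ?J = m" .
    then have "?J \<in> {J. J \<subseteq> X \<and> card J = m}" using JX pq by blast
    then have "sum val ?J \<le> sum val J" using J unfolding maximizers_def by blast
    then show ?thesis using pq finJ sum.remove[OF finJ pq(1), of val] by simp
  qed
  have JX: "J1 \<subseteq> X" "card J1 = m" "J2 \<subseteq> X" "card J2 = m" using J by (auto simp: maximizers_def)
  then have finJ: "finite J1" "finite J2" using fin finite_subset by blast+
  obtain p where p: "p \<in> J1" "p \<notin> J2"
    using J(3) JX finJ card_subset_eq[of J2 J1] by auto
  obtain q where q: "q \<in> J2" "q \<notin> J1"
    using J(3) JX finJ card_subset_eq[of J1 J2] by auto
  have pq: "val p = val q"
    using exch[OF J(1) p(1), of q] exch[OF J(2) q(1), of p] p q JX by force
  show ?thesis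
  proof (rule that[of "val p"])
    have "{j\<in>X. val p < val j} \<subseteq> J1 - {p}"
      using exch[OF J(1) p(1)] by force
    then have "card {j\<in>X. val p < val j} \<le> card (J1 - {p})"
      using finJ by (intro card_mono) auto
    then show "card {j\<in>X. val p < val j} < m"
      using p finJ JX card_gt_0_iff[of J1] by (auto simp: card_Diff_singleton)
    have "insert q J1 \<subseteq> {j\<in>X. val p \<le> val j}"
      using exch[OF J(1)] q JX pq by auto
    then have "card (insert q J1) \<le> card {j\<in>X. val p \<le> val j}"
      using fin by (intro card_mono) auto
    then show "m < card {j\<in>X. val p \<le> val j}" using q finJ JX by simp
  qed
qed

text \<open>Relative to the level \<tau>, a set loses by omitting labels above it and by including
  labels below it. The bounds on \<open>m\<close> make it possible to do neither, so the optimal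
  sets are those with no loss at all.\<close>

lemma maximizers_sum_subsets:
  fixes val :: "'m \<Rightarrow> real" and \<tau> :: real
  assumes fin: "finite X"
  defines "A \<equiv> {j\<in>X. \<tau> < val j}" and "T \<equiv> {j\<in>X. val j = \<tau>}"
  assumes m: "card A \<le> m" "m \<le> card A + card T"
  shows "maximizers {J. J \<subseteq> X \<and> card J = m} (sum val) = (\<lambda>J. A \<union> J) ` {J. J \<subseteq> T \<and> card J = m - card A}"
proof -
  let ?S = "{J. J \<subseteq> X \<and> card J = m}"
  have finA: "finite A" and finT: "finite T" using fin by (auto simp: A_def T_def)
  have AT: "A \<inter> T = {}" by (auto simp: A_def T_def)
  have gap: "sum val J = m * \<tau> + (\<Sum>j\<in>A. val j - \<tau>) - (\<Sum>j\<in>A - J. val j - \<tau>) - (\<Sum>j\<in>J - A. \<tau> - val j)"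
    if "J \<in> ?S" for J
  proof -
    have finJ: "finite J" using that fin finite_subset by blast
    have "sum val J = m * \<tau> + (\<Sum>j\<in>J. val j - \<tau>)"
      using that by (simp add: sum_subtractf)
    also have "(\<Sum>j\<in>J. val j - \<tau>) = (\<Sum>j\<in>A \<inter> J. val j - \<tau>) + (\<Sum>j\<in>J - A. val j - \<tau>)"
      using sum.Int_Diff[OF finJ, of "\<lambda>j. val j - \<tau>" A] by (simp add: Int_commute)
    also have "(\<Sum>j\<in>A \<inter> J. val j - \<tau>) = (\<Sum>j\<in>A. val j - \<tau>) - (\<Sum>j\<in>A - J. val j - \<tau>)"
      using sum.Int_Diff[OF finA, of "\<lambda>j. val j - \<tau>" J] by simp
    also have "(\<Sum>j\<in>J - A. val j - \<tau>) = - (\<Sum>j\<in>J - A. \<tau> - val j)"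
      by (simp add: sum_negf[symmetric])
    finally show ?thesis by simp
  qed
  have nn: "0 \<le> (\<Sum>j\<in>A - J. val j - \<tau>)" "J \<subseteq> X \<Longrightarrow> 0 \<le> (\<Sum>j\<in>J - A. \<tau> - val j)" for J
    by (auto intro!: sum_nonneg simp: A_def)
  have le: "sum val J \<le> m * \<tau> + (\<Sum>j\<in>A. val j - \<tau>)" if "J \<in> ?S" for J
    using gap[OF that] nn[of J] that by simp
  have eq: "sum val J = m * \<tau> + (\<Sum>j\<in>A. val j - \<tau>) \<longleftrightarrow> A \<subseteq> J \<and> J - A \<subseteq> T" if J: "J \<in> ?S" for J
  proof
    have finJ: "finite J" using J fin finite_subset by blast
    assume "sum val J = m * \<tau> + (\<Sum>j\<in>A. val j - \<tau>)"
    then have "(\<Sum>j\<in>A - J. val j - \<tau>) = 0" "(\<Sum>j\<in>J - A. \<tau> - val j) = 0"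
      using gap[OF J] nn[of J] J by auto
    moreover have "\<forall>j\<in>A - J. 0 \<le> val j - \<tau>" "\<forall>j\<in>J - A. 0 \<le> \<tau> - val j"
      using J by (auto simp: A_def)
    ultimately have "\<forall>j\<in>A - J. val j - \<tau> = 0" "\<forall>j\<in>J - A. \<tau> - val j = 0"
      using sum_nonneg_eq_0_iff[of "A - J" "\<lambda>j. val j - \<tau>"] sum_nonneg_eq_0_iff[of "J - A" "\<lambda>j. \<tau> - val j"]
        finA finJ by simp_all
    note zero = this
    have "j \<in> J" if "j \<in> A" for j using that zero(1) by (auto simp: A_def)
    moreover have "j \<in> T" if "j \<in> J - A" for j using that zero(2) J by (auto simp: T_def)
    ultimately show "A \<subseteq> J \<and> J - A \<subseteq> T" by blast
  next
    assume *: "A \<subseteq> J \<and> J - A \<subseteq> T"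
    then have "A - J = {}" and z: "(\<Sum>j\<in>J - A. \<tau> - val j) = 0" by (auto intro!: sum.neutral simp: T_def)
    then show "sum val J = m * \<tau> + (\<Sum>j\<in>A. val j - \<tau>)" using gap[OF J] by (simp only: z) simp
  qed
  have mem: "J \<in> (\<lambda>J. A \<union> J) ` {J. J \<subseteq> T \<and> card J = m - card A} \<longleftrightarrow> J \<in> ?S \<and> A \<subseteq> J \<and> J - A \<subseteq> T" for J
  proof
    assume "J \<in> (\<lambda>J. A \<union> J) ` {J. J \<subseteq> T \<and> card J = m - card A}"
    then obtain J' where J': "J = A \<union> J'" "J' \<subseteq> T" "card J' = m - card A" by auto
    have "card J = card A + card J'"
      unfolding J'(1) using J' AT finA finT by (intro card_Un_disjoint) (auto intro: finite_subset)
    then show "J \<in> ?S \<and> A \<subseteq> J \<and> J - A \<subseteq> T"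
      using J' m(1) by (auto simp: A_def T_def)
  next
    assume *: "J \<in> ?S \<and> A \<subseteq> J \<and> J - A \<subseteq> T"
    then have "card (J - A) = m - card A" using finA by (auto simp: card_Diff_subset)
    moreover have "J = A \<union> (J - A)" using * by auto
    ultimately show "J \<in> (\<lambda>J. A \<union> J) ` {J. J \<subseteq> T \<and> card J = m - card A}"
      using * by blast
  qed
  obtain J0 where "J0 \<subseteq> T" "card J0 = m - card A"
    using m by (metis le_diff_conv add.commute obtain_subset_with_card_n)
  then have J0: "A \<union> J0 \<in> ?S" "sum val (A \<union> J0) = m * \<tau> + (\<Sum>j\<in>A. val j - \<tau>)"
    using mem[of "A \<union> J0"] eq[of "A \<union> J0"] by blast+
  show ?thesis
  proof (intro subset_antisym subsetI)
    fix J assume J: "J \<in> maximizers ?S (sum val)"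
    then have "J \<in> ?S" "sum val (A \<union> J0) \<le> sum val J" using J0(1) by (auto simp: maximizers_def)
    then show "J \<in> (\<lambda>J. A \<union> J) ` {J. J \<subseteq> T \<and> card J = m - card A}"
      using J0(2) le[of J] eq[of J] mem[of J] by simp
  next
    fix J assume "J \<in> (\<lambda>J. A \<union> J) ` {J. J \<subseteq> T \<and> card J = m - card A}"
    then have J: "J \<in> ?S" "sum val J = m * \<tau> + (\<Sum>j\<in>A. val j - \<tau>)"
      using mem[of J] eq[of J] by blast+
    then show "J \<in> maximizers ?S (sum val)" using le by (auto simp: maximizers_def)
  qed
qed

text \<open>If each of the \<open>n\<close> lists obtained from \<open>t\<close> by adding one of the entries \<open>0 > -1 > \<dots>\<close> has a tie
  at the prescribed position, every tie must involve the added entry.\<close>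

lemma ties_hit_all_levels:
  fixes t :: "'m \<Rightarrow> real"
  assumes fin: "finite B" "card B = n"
    and tie: "\<And>k. k < n \<Longrightarrow> \<exists>\<tau>. card {j\<in>B. \<tau> < t j} + (if \<tau> < - real k then 1 else 0) < Suc k
        \<and> Suc k < card {j\<in>B. \<tau> \<le> t j} + (if \<tau> \<le> - real k then 1 else 0)"
    and k: "k < n"
  shows "\<exists>j\<in>B. t j = - real k"
proof -
  let ?G = "\<lambda>\<tau>. card {j\<in>B. \<tau> < t j}" and ?E = "\<lambda>\<tau>. card {j\<in>B. \<tau> \<le> t j}"
  have GE: "?E \<tau> \<le> ?G \<sigma>" if "\<sigma> < \<tau>" for \<sigma> \<tau> using fin that by (intro card_mono) auto
  have GG: "?G \<tau> \<le> ?G \<sigma>" if "\<sigma> \<le> \<tau>" for \<sigma> \<tau> using fin that by (intro card_mono) auto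
  have EE: "?E \<tau> \<le> ?E \<sigma>" if "\<sigma> \<le> \<tau>" for \<sigma> \<tau> using fin that by (intro card_mono) auto
  have G_le: "?G \<tau> \<le> n" for \<tau> using fin card_mono[of B "{j\<in>B. \<tau> < t j}"] by auto
  \<comment> \<open>Downward in \<open>k\<close>: a tie above the added entry would need at least
    \<open>k + 2\<close> entries of \<open>t\<close> above \<open>- real k\<close>, while the next
    level allows only \<open>k + 1\<close> entries above its own, lower threshold.\<close>
  have upper: "?G (- real k) \<le> k" if "k < n" for k
    using that
  proof (induction "n - k" arbitrary: k)
    case (Suc d)
    obtain \<tau> where \<tau>: "?G \<tau> + (if \<tau> < - real k then 1 else 0) < Suc k"
        "Suc k < ?E \<tau> + (if \<tau> \<le> - real k then 1 else 0)"
      using tie[OF Suc.prems] by blast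
    show ?case
    proof (cases "\<tau> \<le> - real k")
      case True
      then show ?thesis using GG[OF True] \<tau>(1) by (auto split: if_splits)
    next
      case False
      then have big: "Suc k < ?G (- real k)" using \<tau>(2) GE[of "- real k" \<tau>] by auto
      have "Suc k < n" using big G_le[of "- real k"] by simp
      then have "?G (- real (Suc k)) \<le> Suc k" using Suc by (intro Suc.hyps(1)) auto
      then show ?thesis using big GG[of "- real (Suc k)" "- real k"] by simp
    qed
  qed simp
  \<comment> \<open>Upward in \<open>k\<close>: a tie below the added entry leaves room for too few
    entries of \<open>t\<close> above it, since the preceding level already supplies more.\<close>
  have lower: "Suc k \<le> ?E (- real k)" if "k < n" for k
    using that
  proof (induction k)
    case 0
    obtain \<tau> where \<tau>: "?G \<tau> + (if \<tau> < - real 0 then 1 else 0) < Suc 0"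
        "Suc 0 < ?E \<tau> + (if \<tau> \<le> - real 0 then 1 else 0)"
      using tie[OF 0] by blast
    then have "\<not> \<tau> < 0" by auto
    then show ?case using \<tau>(2) EE[of 0 \<tau>] by (auto split: if_splits)
  next
    case (Suc k)
    obtain \<tau> where \<tau>: "?G \<tau> + (if \<tau> < - real (Suc k) then 1 else 0) < Suc (Suc k)"
        "Suc (Suc k) < ?E \<tau> + (if \<tau> \<le> - real (Suc k) then 1 else 0)"
      using tie[OF Suc.prems] by blast
    have "\<not> \<tau> < - real (Suc k)"
    proof
      assume *: "\<tau> < - real (Suc k)"
      then have "?G \<tau> \<le> k" using \<tau>(1) by simp
      moreover have "Suc k \<le> ?E (- real k)" using Suc by simp
      moreover have "?E (- real k) \<le> ?G \<tau>" using * by (intro GE) auto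
      ultimately show False by simp
    qed
    then show ?case using \<tau>(2) EE[of "- real (Suc k)" \<tau>] by (auto split: if_splits)
  qed
  have "?G (- real k) < ?E (- real k)" using upper[OF k] lower[OF k] by simp
  then have "{j\<in>B. - real k < t j} \<noteq> {j\<in>B. - real k \<le> t j}" by auto
  then show ?thesis by force
qed

section \<open>Hypersimplices of a single simplex\<close>

context flat_volume
begin

lemma ex1_functional:
  assumes us: "basis_list W us"
  shows "\<exists>!y. y \<bullet> v = 0 \<and> (\<forall>k<n. y \<bullet> us ! k = c k)"
proof -
  have len: "length us = n" using basis_list_length[OF us] dim_W by simp
  obtain g where g: "\<And>i. i < length us \<Longrightarrow> linear (g i)"
      "\<And>i x. i < length us \<Longrightarrow> g i (\<Sum>k<length us. x k *\<^sub>R us ! k) = x i"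
    using basis_list_coordinates[OF us] by blast
  define G where "G x = (\<Sum>i<n. c i * g i x)" for x
  have "linear G"
    unfolding G_def using g(1) len
    by (intro linear_compose_sum ballI linear_compose_scale_right[where 'b = real, simplified]) auto
  define z where "z = (\<Sum>b\<in>Basis. G b *\<^sub>R b)"
  have z: "z \<bullet> x = G x" for x
  proof -
    have "G x = G (\<Sum>b\<in>Basis. (x \<bullet> b) *\<^sub>R b)" by (simp add: euclidean_representation)
    also have "\<dots> = (\<Sum>b\<in>Basis. (x \<bullet> b) * G b)"
      using linear_sum[OF \<open>linear G\<close>, of "\<lambda>b. (x \<bullet> b) *\<^sub>R b" Basis] linear_scale[OF \<open>linear G\<close>] by simp
    also have "\<dots> = z \<bullet> x" by (simp add: z_def inner_sum_left inner_commute[of x] mult.commute)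
    finally show ?thesis ..
  qed
  have usW: "us ! k \<in> W" if "k < n" for k
    using that us len unfolding basis_list_def by (metis nth_mem span_base)
  have zus: "z \<bullet> us ! k = c k" if "k < n" for k
  proof -
    have "g i (us ! k) = (if i = k then 1 else 0)" if "i < n" for i
      using g(2)[of i "\<lambda>j. if j = k then 1 else 0"] that \<open>k < n\<close> len
      by (simp add: if_distrib[of "\<lambda>r. r *\<^sub>R _"] cong: if_cong)
    then have "G (us ! k) = (\<Sum>i<n. if i = k then c k else 0)"
      unfolding G_def by (intro sum.cong) auto
    then show ?thesis using that by (simp add: z)
  qed
  show ?thesis
  proof (rule ex1I)
    \<comment> \<open>Subtracting a multiple of \<open>f\<close> changes nothing on
      \<open>W\<close>, and because \<open>f \<bullet> v = 1\<close> this multiple makes the result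
      orthogonal to \<open>v\<close>.\<close>
    show "(z - (z \<bullet> v) *\<^sub>R f) \<bullet> v = 0 \<and> (\<forall>k<n. (z - (z \<bullet> v) *\<^sub>R f) \<bullet> us ! k = c k)"
      using fv usW zus by (auto simp: inner_diff_left W_eq)
    fix y assume y: "y \<bullet> v = 0 \<and> (\<forall>k<n. y \<bullet> us ! k = c k)"
    let ?d = "y - (z - (z \<bullet> v) *\<^sub>R f)"
    have d0: "?d \<bullet> v = 0" using y fv by (simp add: inner_diff_left)
    have d: "?d \<bullet> us ! k = 0" if "k < n" for k
      using that y usW zus by (simp add: inner_diff_left W_eq)
    have "?d \<bullet> w = 0" if "w \<in> W" for w
    proof -
      obtain x where "w = (\<Sum>k<length us. x k *\<^sub>R us ! k)"
        using \<open>w \<in> W\<close> us span_list_conv[of w us] by (auto simp: basis_list_def)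
      then have "?d \<bullet> w = (\<Sum>k<n. x k * (?d \<bullet> us ! k))" by (simp add: inner_sum_right len)
      then show ?thesis using d by simp
    qed
    then have "?d = 0" using functional_nonzero[OF d0] by blast
    then show "y = z - (z \<bullet> v) *\<^sub>R f" by simp
  qed
qed

end

lemma convex_hull_translate: "convex hull ((\<lambda>x. t + g x) ` S) = (+) t ` (convex hull (g ` S))"
  using convex_hull_translation[of t "g ` S"] by (simp add: image_image)

context flat_mixed_volume
begin

text \<open>
  The lift raises only the vertex \<open>b\<close>, by \<open>0 > -1 > -2 > \<dots>\<close> in the successive hypersimplices. Its mixed
  cells are the \<open>n!\<close> parallelepipeds spanned by the edges at \<open>b\<close>, one for each ordering of these edges.
\<close>

lemma MV_simplex:
  fixes a :: "'m \<Rightarrow> 'v"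
  assumes bs: "distinct bs" "b \<notin> set bs" and ab: "a b = v"
    and basis: "basis_list W (map (\<lambda>j. a j - v) bs)"
  shows "MV (map (\<lambda>k. convex hull ((\<lambda>J. \<Sum>j\<in>J. a j - v) ` {J. J \<subseteq> insert b (set bs) \<and> card J = Suc k})) [0..<n])
    = \<bar>\<eta> (map (\<lambda>j. a j - v) bs)\<bar>"
proof -
  define B where "B = set bs"
  define e where "e j = a j - v" for j
  define p where "p J = (\<Sum>j\<in>J. e j)" for J
  define S where "S k = {J. J \<subseteq> insert b B \<and> card J = Suc k}" for k
  define h where "h k J = (if b \<in> J then - real k else 0)" for k J
  define F where "F y k = convex hull (p ` maximizers (S k) (\<lambda>J. y \<bullet> p J + h k J))" for y k
  have len: "length bs = n" using basis_list_length[OF basis] dim_W by simp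
  have finB: "finite B" "card B = n" and bB: "b \<notin> B"
    using bs len distinct_card[of bs] by (auto simp: B_def)
  have eb: "e b = 0" by (simp add: e_def ab)
  have eW: "e j \<in> W" if "j \<in> B" for j
    using basis that span_superset[of "e ` B"] by (auto simp: basis_list_def e_def[symmetric] B_def)
  have pW: "p J \<in> W" if "J \<subseteq> insert b B" for J
    unfolding p_def using that eW eb subspace_0[OF W] by (intro subspace_sum[OF W]) auto
  have finS: "finite (S k)" for k using finB by (simp add: S_def)
  have neS: "S k \<noteq> {}" if "k < n" for k
  proof -
    have "Suc k \<le> card (insert b B)" using that finB bB by simp
    then obtain J where "J \<subseteq> insert b B" "card J = Suc k" by (metis obtain_subset_with_card_n)
    then show ?thesis by (auto simp: S_def)
  qed
  have F_body: "F y k \<in> convex_bodies W" if "k < n" for y k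
    unfolding F_def using that finS neS[OF that] pW maximizers_nonempty[OF finS neS[OF that]]
      finite_subset[OF maximizers_subset finS]
    by (intro convex_hull_convex_body W finite_imageI) (auto simp: S_def maximizers_def)
  define val where "val y k j = (if j = b then - real k else y \<bullet> e j)" for y k j
  have height: "(y \<bullet> p J + h k J) = sum (val y k) J" if "J \<in> S k" for y k J
  proof -
    have finJ: "finite J" using that finB finite_subset by (auto simp: S_def)
    have "sum (val y k) J = (\<Sum>j\<in>J. y \<bullet> e j + (if j = b then - real k else 0))"
      by (intro sum.cong) (auto simp: val_def eb)
    then show ?thesis using finJ by (simp add: p_def h_def inner_sum_right sum.distrib)
  qed
  then have max_eq: "maximizers (S k) (\<lambda>J. y \<bullet> p J + h k J) = maximizers (S k) (sum (val y k))" for y k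
    by (auto simp: maximizers_def)
  have perm_basis: "basis_list W (map e xs)" if "xs \<in> permutations_of_set B" for xs
    using basis that distinct_card[of xs] finB len
    by (intro basis_listI) (auto simp: basis_list_def permutations_of_set_def B_def e_def[symmetric] dim_W)
  \<comment> \<open>At this slope the edges taken in the order \<open>xs\<close> have the values 0,
    -1, -2 and so on, so that in slot \<open>k\<close> the label \<open>b\<close> ties with
    \<open>xs ! k\<close> only.\<close>
  define Yof where "Yof xs = (THE y. y \<bullet> v = 0 \<and> (\<forall>k<n. y \<bullet> map e xs ! k = - real k))" for xs
  have Yof: "Yof xs \<bullet> v = 0 \<and> (\<forall>k<n. Yof xs \<bullet> map e xs ! k = - real k)"
    if "xs \<in> permutations_of_set B" for xs
    unfolding Yof_def using ex1_functional[OF perm_basis[OF that], of "\<lambda>k. - real k"] by (rule theI')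
  have Yof_eq: "y = Yof xs" if "xs \<in> permutations_of_set B" "y \<bullet> v = 0" "\<And>k. k < n \<Longrightarrow> y \<bullet> e (xs ! k) = - real k" for xs y
  proof -
    have "length xs = n" using that(1) finB distinct_card[of xs] by (auto simp: permutations_of_set_def)
    then show ?thesis
      using that ex1_functional[OF perm_basis[OF that(1)], of "\<lambda>k. - real k"] Yof[OF that(1)] by auto
  qed
  have perm_len: "length xs = n" "set xs = B" "distinct xs" if "xs \<in> permutations_of_set B" for xs
    using that finB distinct_card[of xs] by (auto simp: permutations_of_set_def)
  have inj: "inj_on Yof (permutations_of_set B)"
  proof (rule inj_onI)
    fix xs ys assume x: "xs \<in> permutations_of_set B" and y: "ys \<in> permutations_of_set B" and eq: "Yof xs = Yof ys"
    show "xs = ys"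
    proof (rule nth_equalityI)
      fix k assume "k < length xs"
      then have k: "k < n" using perm_len[OF x] by simp
      then have "xs ! k \<in> set ys" using perm_len[OF x] perm_len[OF y] by (metis nth_mem)
      then obtain l where l: "l < n" "xs ! k = ys ! l" using perm_len[OF y] by (auto simp: in_set_conv_nth)
      have "- real k = Yof xs \<bullet> e (xs ! k)" using Yof[OF x] k perm_len[OF x] by simp
      also have "\<dots> = - real l" using Yof[OF y] l perm_len[OF y] eq by simp
      finally show "xs ! k = ys ! k" using l by simp
    qed (use perm_len[OF x] perm_len[OF y] in simp)
  qed
  have out: "MV (map (F y) [0..<n]) = 0" if yv: "y \<bullet> v = 0" and y: "y \<notin> Yof ` permutations_of_set B" for y
  proof (rule ccontr)
    assume nz: "MV (map (F y) [0..<n]) \<noteq> 0"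
    \<comment> \<open>A slot with a unique maximizing set would have a point as its face and
      annihilate the mixed volume, so every slot has a tie at its position.\<close>
    have "\<exists>j\<in>B. y \<bullet> e j = - real k" if k: "k < n" for k
    proof (rule ties_hit_all_levels[OF finB _ k])
      fix k assume k: "k < n"
      let ?M = "maximizers (S k) (sum (val y k))"
      obtain J1 where J1: "J1 \<in> ?M" using maximizers_nonempty[OF finS neS[OF k]] by blast
      have "\<exists>J2\<in>?M. J2 \<noteq> J1"
      proof (rule ccontr)
        assume "\<not> ?thesis"
        then have "?M = {J1}" using J1 by blast
        then have "F y k = {p J1}" by (simp add: F_def max_eq)
        then have "MV (map (F y) [0..<n]) = 0" using F_body k by (intro MV_point[of "F y" k "p J1"])
        then show False using nz by contradiction
      qed
      then obtain J2 where J2: "J2 \<in> ?M" "J1 \<noteq> J2" by blast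
      obtain \<tau> where \<tau>: "card {j\<in>insert b B. \<tau> < val y k j} < Suc k" "Suc k < card {j\<in>insert b B. \<tau> \<le> val y k j}"
        using tie_of_two_maximizers[of "insert b B" J1 "Suc k" "val y k" J2] J1 J2 finB
        unfolding S_def by auto
      have "{j\<in>insert b B. P (val y k j)} = {j\<in>B. P (y \<bullet> e j)} \<union> (if P (- real k) then {b} else {})" for P
        using bB by (auto simp: val_def)
      then have c: "card {j\<in>insert b B. P (val y k j)} = card {j\<in>B. P (y \<bullet> e j)} + (if P (- real k) then 1 else 0)" for P
        using bB finB by (auto simp: card_insert_if)
      show "\<exists>\<tau>. card {j\<in>B. \<tau> < y \<bullet> e j} + (if \<tau> < - real k then 1 else 0) < Suc k
        \<and> Suc k < card {j\<in>B. \<tau> \<le> y \<bullet> e j} + (if \<tau> \<le> - real k then 1 else 0)"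
        using \<tau> c[of "\<lambda>x. \<tau> < x"] c[of "\<lambda>x. \<tau> \<le> x"] by (intro exI[of _ \<tau>]) simp
    qed
    then have "\<forall>k\<in>{..<n}. \<exists>j. j \<in> B \<and> y \<bullet> e j = - real k" by blast
    from bchoice[OF this] obtain l where "\<forall>k\<in>{..<n}. l k \<in> B \<and> y \<bullet> e (l k) = - real k" ..
    then have l: "l k \<in> B \<and> y \<bullet> e (l k) = - real k" if "k < n" for k using that by blast
    \<comment> \<open>Each of the \<open>n\<close> levels is hit and \<open>B\<close> has
      \<open>n\<close> elements, so the levels define an ordering of \<open>B\<close>.\<close>
    have "inj_on l {..<n}"
    proof (rule inj_onI)
      fix k k' assume k: "k \<in> {..<n}" "k' \<in> {..<n}" and eq: "l k = l k'"
      have "- real k = y \<bullet> e (l k)" using l k by simp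
      also have "\<dots> = - real k'" unfolding eq using l k by simp
      finally show "k = k'" by simp
    qed
    then have d: "distinct (map l [0..<n])" by (simp add: distinct_map atLeast0LessThan)
    have "set (map l [0..<n]) = B"
      using l finB distinct_card[OF d] by (intro card_subset_eq) auto
    with d have "map l [0..<n] \<in> permutations_of_set B" by (auto simp: permutations_of_set_def)
    moreover from this have "y = Yof (map l [0..<n])" using yv l by (intro Yof_eq) auto
    ultimately show False using y by blast
  qed
  have cell: "fact n * MV (map (F (Yof xs)) [0..<n]) = \<bar>\<eta> (map e bs)\<bar>" if xs: "xs \<in> permutations_of_set B" for xs
  proof -
    note xs' = perm_len[OF xs]
    let ?y = "Yof xs"
    have y: "?y \<bullet> e (xs ! k) = - real k" if "k < n" for k
      using Yof[OF xs] that xs' by simp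
    \<comment> \<open>The first \<open>k\<close> labels of \<open>xs\<close> lie above the level
      \<open>- real k\<close>, and \<open>b\<close> and \<open>xs ! k\<close> lie on it. Optimal
      sets differ only in the choice between these two, so the face is a translated edge.\<close>
    have Fk: "F ?y k = (+) (p (set (take k xs))) ` closed_segment 0 (map e xs ! k)" if k: "k < n" for k
    proof -
      let ?A = "set (take k xs)"
      have A: "{j\<in>insert b B. - real k < val ?y k j} = ?A"
      proof (intro subset_antisym subsetI)
        fix j assume "j \<in> {j\<in>insert b B. - real k < val ?y k j}"
        then have j: "j \<in> B" "- real k < ?y \<bullet> e j" by (auto simp: val_def split: if_splits)
        then obtain i where i: "i < n" "j = xs ! i" using xs' by (metis in_set_conv_nth)
        then have "i < k" using j y[of i] by simp
        then show "j \<in> ?A" using i xs' by (auto simp: in_set_conv_nth intro!: exI[of _ i])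
      next
        fix j assume "j \<in> ?A"
        then obtain i where i: "i < k" "j = xs ! i" using xs' k by (auto simp: in_set_conv_nth)
        then have "j \<in> B" using xs' k by (metis less_trans nth_mem)
        then show "j \<in> {j\<in>insert b B. - real k < val ?y k j}"
          using i y[of i] k bB by (auto simp: val_def)
      qed
      have T: "{j\<in>insert b B. val ?y k j = - real k} = {b, xs ! k}"
      proof (intro subset_antisym subsetI)
        fix j assume j: "j \<in> {j\<in>insert b B. val ?y k j = - real k}"
        show "j \<in> {b, xs ! k}"
        proof (cases "j = b")
          case False
          then have j: "j \<in> B" "?y \<bullet> e j = - real k" using j by (auto simp: val_def)
          then obtain i where i: "i < n" "j = xs ! i" using xs' by (metis in_set_conv_nth)
          then show ?thesis using j y[of i] by simp
        qed simp
      next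
        fix j assume "j \<in> {b, xs ! k}"
        moreover have "xs ! k \<in> B" using xs' k by (metis nth_mem)
        ultimately show "j \<in> {j\<in>insert b B. val ?y k j = - real k}"
          using y[OF k] bB by (auto simp: val_def)
      qed
      have cA: "card ?A = k" using xs' k by (simp add: distinct_card)
      have xkB: "xs ! k \<in> B" using xs' k by (metis nth_mem)
      then have "b \<noteq> xs ! k" using bB by blast
      then have "card {b, xs ! k} = 2" by simp
      then have "maximizers (S k) (sum (val ?y k)) = (\<lambda>J. ?A \<union> J) ` {J. J \<subseteq> {b, xs ! k} \<and> card J = 1}"
        using maximizers_sum_subsets[of "insert b B" "- real k" "val ?y k" "Suc k"] finB
        unfolding A T cA S_def by simp
      also have "{J. J \<subseteq> {b, xs ! k} \<and> card J = 1} = {{b}, {xs ! k}}"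
        by (auto simp: card_1_singleton_iff)
      finally have "maximizers (S k) (sum (val ?y k)) = {insert b ?A, insert (xs ! k) ?A}"
        by (auto simp: image_iff)
      moreover have "b \<notin> ?A" using bB xs' by (auto dest: in_set_takeD)
      moreover have "xs ! k \<notin> ?A"
        using xs' k by (auto simp: in_set_conv_nth nth_eq_iff_index_eq)
      ultimately have "F ?y k = convex hull ((\<lambda>x. p ?A + x) ` {0, e (xs ! k)})"
        unfolding F_def max_eq by (simp add: p_def eb add.commute)
      also have "\<dots> = (+) (p ?A) ` closed_segment 0 (map e xs ! k)"
        using k xs' by (simp add: convex_hull_translation segment_convex_hull del: image_insert)
      finally show ?thesis .
    qed
    have ex: "map e xs ! k \<in> W" if "k < n" for k
      using that xs' eW by (metis nth_map nth_mem)
    have seg: "closed_segment 0 w \<in> convex_bodies W" if "w \<in> W" for w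
      using that W closed_segment_subset[of 0 W w]
      by (auto simp: convex_bodies_def subspace_0 subspace_imp_convex)
    have "MV (map (F ?y) [0..<n]) = MV (map (\<lambda>k. (+) (p (set (take k xs))) ` closed_segment 0 (map e xs ! k)) [0..<n])"
      using Fk by (intro arg_cong[of _ _ MV] map_cong) auto
    also have "\<dots> = MV (map (\<lambda>k. closed_segment 0 (map e xs ! k)) [0..<n])"
      using xs' ex seg by (intro MV_translate pW) (auto dest: in_set_takeD)
    also have "map (\<lambda>k. closed_segment 0 (map e xs ! k)) [0..<n] = map (\<lambda>j. closed_segment 0 (e j)) xs"
      using xs' by (intro nth_equalityI) auto
    also have "MV (map (\<lambda>j. closed_segment 0 (e j)) xs) = MV (map (\<lambda>j. closed_segment 0 (e j)) bs)"
    proof (rule MV_perm)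
      show "mset (map (\<lambda>j. closed_segment 0 (e j)) xs) = mset (map (\<lambda>j. closed_segment 0 (e j)) bs)"
        using xs' bs set_eq_iff_mset_eq_distinct[of xs bs] by (simp add: B_def)
    qed (use len dim_W eW seg in \<open>auto simp: B_def\<close>)
    also have "map (\<lambda>j. closed_segment 0 (e j)) bs = map (\<lambda>k. closed_segment 0 (map e bs ! k)) [0..<n]"
      using len by (intro nth_equalityI) auto
    finally show ?thesis
      using MV_segments[of "map e bs"] basis by (simp add: e_def[symmetric])
  qed
  have "MV (map (\<lambda>k. convex hull (p ` S k)) [0..<n]) = (\<Sum>y\<in>Yof ` permutations_of_set B. MV (map (F y) [0..<n]))"
    unfolding F_def[abs_def]
  proof (rule MV_mixed_subdivision)
    show "Yof ` permutations_of_set B \<subseteq> {y. y \<bullet> v = 0}" using Yof by blast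
    show "MV (map (\<lambda>k. convex hull (p ` maximizers (S k) (\<lambda>J. y \<bullet> p J + h k J))) [0..<n]) = 0"
      if "y \<bullet> v = 0" "y \<notin> Yof ` permutations_of_set B" for y
      using out[OF that] by (simp add: F_def[abs_def])
    show "p J \<in> W" if "J \<in> S k" for k J using that by (intro pW) (simp add: S_def)
  qed (use finS neS in auto)
  also have "\<dots> = (\<Sum>xs\<in>permutations_of_set B. MV (map (F (Yof xs)) [0..<n]))"
    using inj by (simp add: sum.reindex)
  \<comment> \<open>The number of orderings cancels the factor \<open>fact n\<close> from
    \<open>MV_segments\<close>.\<close>
  also have "\<dots> = (\<Sum>xs\<in>permutations_of_set B. \<bar>\<eta> (map e bs)\<bar> / fact n)"
    using cell by (intro sum.cong refl) (simp add: field_simps)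
  also have "\<dots> = \<bar>\<eta> (map e bs)\<bar>"
    using finB by simp
  finally show ?thesis
    by (simp add: p_def[abs_def] S_def[abs_def] e_def[abs_def] B_def)
qed

end

section \<open>Flat arrangements\<close>

lemma arr_map_coord_subspace:
  assumes "x \<in> coord_subspace B"
  shows "arr_map a x = (\<Sum>j\<in>B. (x $ j) *\<^sub>R a j)"
  unfolding arr_map_def using assms
  by (intro sum.mono_neutral_right) (auto simp: coord_subspace_def)

lemma basis_list_of_bases:
  fixes a :: "'m::finite \<Rightarrow> 'v::euclidean_space"
  assumes B: "B \<in> bases a" and bs: "distinct bs" "set bs = B"
  shows "basis_list UNIV (map a bs)"
proof (rule basis_listI)
  have "x \<in> span (a ` B)" for x
  proof -
    have "arr_map a ` coord_subspace B = UNIV"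
      using B by (simp add: bases_def bij_betw_def)
    then obtain z where "z \<in> coord_subspace B" "x = arr_map a z" by blast
    then show ?thesis
      by (simp add: arr_map_coord_subspace) (intro span_sum span_scale span_base, simp)
  qed
  then show "span (set (map a bs)) = UNIV" using bs by auto
  show "length (map a bs) = dim (UNIV :: 'v set)"
    using B bs distinct_card[of bs] by (simp add: bases_def)
qed

lemma bases_of_basis_list:
  fixes a :: "'m::finite \<Rightarrow> 'v::euclidean_space"
  assumes bs: "distinct bs" and basis: "basis_list UNIV (map a bs)"
  shows "set bs \<in> bases a"
proof -
  have len: "length bs = DIM('v)" using basis_list_length[OF basis] by simp
  have sum_list: "arr_map a x = (\<Sum>k<length bs. (x $ (bs ! k)) *\<^sub>R map a bs ! k)"
    if "x \<in> coord_subspace (set bs)" for x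
  proof -
    have "(\<Sum>j\<in>set bs. (x $ j) *\<^sub>R a j) = (\<Sum>k<length bs. (x $ (bs ! k)) *\<^sub>R a (bs ! k))"
      using bs by (intro sum.reindex_bij_betw[symmetric] bij_betw_nth) auto
    then show ?thesis using that by (simp add: arr_map_coord_subspace)
  qed
  obtain g where g: "\<And>i x. i < length bs \<Longrightarrow> g i (\<Sum>k<length bs. x k *\<^sub>R map a bs ! k) = x i"
    using basis_list_coordinates[OF basis] by (metis length_map)
  have "inj_on (arr_map a) (coord_subspace (set bs))"
  proof (rule inj_onI)
    fix x y assume xy: "x \<in> coord_subspace (set bs)" "y \<in> coord_subspace (set bs)" "arr_map a x = arr_map a y"
    have "x $ j = y $ j" for j
    proof (cases "j \<in> set bs")
      case True
      then obtain i where i: "i < length bs" "j = bs ! i" by (auto simp: in_set_conv_nth)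
      show ?thesis
        using g[OF i(1), of "\<lambda>k. x $ (bs ! k)"] g[OF i(1), of "\<lambda>k. y $ (bs ! k)"] xy sum_list i by simp
    qed (use xy in \<open>auto simp: coord_subspace_def\<close>)
    then show "x = y" by (simp add: vec_eq_iff)
  qed
  moreover have "arr_map a ` coord_subspace (set bs) = UNIV"
  proof -
    have "z \<in> arr_map a ` coord_subspace (set bs)" for z
    proof -
      have "z \<in> span (set (map a bs))" using basis by (simp add: basis_list_def)
      then obtain c where z: "z = (\<Sum>k<length bs. c k *\<^sub>R map a bs ! k)"
        unfolding span_list_conv by auto
      have "bij_betw ((!) bs) {..<length bs} (set bs)" using bs by (intro bij_betw_nth) auto
      then obtain idx where idx: "\<And>k. k < length bs \<Longrightarrow> idx (bs ! k) = k"
        using the_inv_into_f_f[OF bij_betw_imp_inj_on] by (metis lessThan_iff)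
      define x :: "real ^ 'm" where "x = (\<chi> j. if j \<in> set bs then c (idx j) else 0)"
      have "x \<in> coord_subspace (set bs)" by (simp add: x_def coord_subspace_def)
      moreover have "arr_map a x = z"
        unfolding z sum_list[OF calculation] by (intro sum.cong) (auto simp: x_def idx)
      ultimately show ?thesis by blast
    qed
    then show ?thesis by blast
  qed
  ultimately show ?thesis
    using len bs by (simp add: bases_def bij_betw_def distinct_card)
qed

text \<open>On the tied labels \<rho> is the restriction of the functional
  \<open>c *\<^sub>R f - y\<close>, so it pairs to 0 with every element of the kernel supported
  there. A dependency would produce such an element that is a circuit vector, against
  genericity.\<close>

lemma tied_labels_independent:
  fixes a :: "'m::finite \<Rightarrow> 'v::euclidean_space"
  assumes gen: "circuit_generic a \<rho>" and flat: "\<And>j. f \<bullet> a j = 1"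
    and T: "\<And>j. j \<in> T \<Longrightarrow> y \<bullet> a j + \<rho> $ j = c"
  shows "inj_on a T" "independent (a ` T)"
proof -
  have ker: "x = 0" if x: "arr_map a x = 0" "supp x \<subseteq> T" for x
  proof (rule ccontr)
    assume "x \<noteq> 0"
    define Q where "Q z \<longleftrightarrow> z \<noteq> 0 \<and> arr_map a z = 0 \<and> supp z \<subseteq> T" for z :: "real ^ 'm"
    have "Q x" using x \<open>x \<noteq> 0\<close> by (simp add: Q_def)
    \<comment> \<open>Smallest cardinality of the support makes the support inclusion-minimal among
      all kernel vectors, since any smaller support would again lie in \<open>T\<close>.\<close>
    then obtain z where z: "Q z" "\<And>z'. Q z' \<Longrightarrow> card (supp z) \<le> card (supp z')"
      using ex_has_least_nat[of Q x "\<lambda>z. card (supp z)"] by auto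
    have "circuit_vector a z"
      unfolding circuit_vector_def
    proof (intro conjI allI impI)
      fix z' assume z': "z' \<noteq> 0" "arr_map a z' = 0" "supp z' \<subseteq> supp z"
      then have "Q z'" using z(1) by (auto simp: Q_def)
      then show "supp z' = supp z"
        using z(2)[of z'] z'(3) card_seteq[of "supp z" "supp z'"] by simp
    qed (use z in \<open>auto simp: Q_def\<close>)
    then have "\<rho> \<bullet> z \<noteq> 0" using gen by (simp add: circuit_generic_def)
    moreover have "\<rho> \<bullet> z = 0"
    proof -
      have "\<rho> $ j * z $ j = (z $ j) * ((c *\<^sub>R f - y) \<bullet> a j)" for j
      proof (cases "j \<in> T")
        case True
        then have "\<rho> $ j = (c *\<^sub>R f - y) \<bullet> a j" using T[OF True] flat by (simp add: inner_diff_left)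
        then show ?thesis by simp
      next
        case False
        then have "z $ j = 0" using z(1) by (auto simp: Q_def supp_def)
        then show ?thesis by simp
      qed
      then have "\<rho> \<bullet> z = (c *\<^sub>R f - y) \<bullet> arr_map a z"
        unfolding inner_vec_def arr_map_def inner_sum_right by (intro sum.cong) auto
      then show ?thesis using z(1) by (simp add: Q_def)
    qed
    ultimately show False by contradiction
  qed
  show inj: "inj_on a T"
  proof (rule inj_onI, rule ccontr)
    fix j k assume jk: "j \<in> T" "k \<in> T" "a j = a k" "j \<noteq> k"
    define x :: "real ^ 'm" where "x = (\<chi> i. if i = j then 1 else if i = k then -1 else 0)"
    have "x \<in> coord_subspace {j, k}" by (auto simp: x_def coord_subspace_def)
    from arr_map_coord_subspace[OF this, of a] have "arr_map a x = 0"
      using jk by (simp add: x_def)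
    moreover have "supp x \<subseteq> T" using jk by (auto simp: supp_def x_def)
    ultimately have "x = 0" by (rule ker)
    moreover have "x $ j = 1" by (simp add: x_def)
    ultimately show False by simp
  qed
  show "independent (a ` T)"
  proof
    assume "dependent (a ` T)"
    then obtain u t where u: "t \<in> T" "u (a t) \<noteq> 0" "(\<Sum>w\<in>a ` T. u w *\<^sub>R w) = 0"
      by (auto simp: dependent_finite)
    define x :: "real ^ 'm" where "x = (\<chi> i. if i \<in> T then u (a i) else 0)"
    have "x \<in> coord_subspace T" by (auto simp: x_def coord_subspace_def)
    from arr_map_coord_subspace[OF this, of a] have "arr_map a x = (\<Sum>j\<in>T. u (a j) *\<^sub>R a j)"
      by (simp add: x_def)
    also have "\<dots> = 0" using u(3) inj by (simp add: sum.reindex)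
    finally have "x = 0" by (intro ker) (auto simp: supp_def x_def split: if_splits)
    moreover have "x $ t \<noteq> 0" using u by (simp add: x_def)
    ultimately show False by simp
  qed
qed

text \<open>The entries of the fundamental circuit on \<open>B\<close> are minus the coordinates of
  \<open>a j\<close>, so a functional that interpolates \<open>- \<rho> $ b\<close> on
  \<open>B\<close> turns their contribution into its value at \<open>a j\<close>. With a suitable
  slope this is the height of \<open>j\<close> above the tied level.\<close>

lemma inner_fund_circuit:
  fixes a :: "'m::finite \<Rightarrow> 'v::euclidean_space"
  assumes B: "B \<in> bases a" and j: "j \<notin> B" and z: "\<And>b. b \<in> B \<Longrightarrow> z \<bullet> a b = - \<rho> $ b"
  shows "\<rho> \<bullet> fund_circuit a B j = \<rho> $ j + z \<bullet> a j"
proof -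
  define x where "x = inv_into (coord_subspace B) (arr_map a) (a j)"
  have "a j \<in> arr_map a ` coord_subspace B" using B by (simp add: bases_def bij_betw_def)
  then have x: "x \<in> coord_subspace B" "arr_map a x = a j"
    unfolding x_def by (rule inv_into_into, rule f_inv_into_f)
  have "\<rho> \<bullet> fund_circuit a B j
      = (\<Sum>k\<in>UNIV. (if k = j then \<rho> $ j else 0) + (if k \<in> B then (x $ k) * (z \<bullet> a k) else 0))"
    unfolding inner_vec_def using j
    by (intro sum.cong) (auto simp: fund_circuit_def x_def[symmetric] z)
  also have "\<dots> = \<rho> $ j + (\<Sum>k\<in>B. (x $ k) * (z \<bullet> a k))"
    by (simp add: sum.distrib sum.If_cases)
  also have "(\<Sum>k\<in>B. (x $ k) * (z \<bullet> a k)) = z \<bullet> arr_map a x"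
    using x(1) by (simp add: arr_map_coord_subspace inner_sum_right)
  finally show ?thesis using x by simp
qed

lemma alternating_form_edge_vectors:
  fixes a :: "'m \<Rightarrow> 'v::euclidean_space"
  assumes alt: "alternating_form (Suc n) \<omega>" and len: "length cs = n"
    and w: "v - a b \<in> span (set (map (\<lambda>j. a j - a b) cs))"
  shows "\<omega> (map (\<lambda>j. a j - a b) cs @ [v]) = \<omega> (map a cs @ [a b])"
proof -
  \<comment> \<open>These lists interpolate between labels and edge vectors. Passing to the next one
    subtracts a term in which \<open>a b\<close> occurs twice, so the form does not change.\<close>
  define L where "L m = map (\<lambda>k. if k < m then a (cs ! k) - a b else a (cs ! k)) [0..<n] @ [a b]" for m
  have lin: "linear (\<lambda>x. \<omega> (vs[i := x]))" if "length vs = Suc n" "i < Suc n" for vs i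
    using alt that unfolding alternating_form_def by blast
  have zero: "\<omega> vs = 0" if "length vs = Suc n" "\<not> distinct vs" for vs
    using alt that unfolding alternating_form_def by blast
  have "\<omega> (L m) = \<omega> (L 0)" if "m \<le> n" for m
    using that
  proof (induction m)
    case (Suc m)
    have m: "m < n" using Suc by simp
    have lenL: "length (L m) = Suc n" by (simp add: L_def)
    have "L (Suc m) = (L m)[m := a (cs ! m) - a b]"
      using m by (intro nth_equalityI) (auto simp: L_def nth_list_update nth_append less_Suc_eq)
    then have "\<omega> (L (Suc m)) = \<omega> ((L m)[m := a (cs ! m)]) - \<omega> ((L m)[m := a b])"
      using linear_diff[OF lin[OF lenL, of m]] m by simp
    also have "(L m)[m := a (cs ! m)] = L m"
      using m by (intro nth_equalityI) (auto simp: L_def nth_list_update nth_append)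
    also have "\<omega> ((L m)[m := a b]) = 0"
    proof (rule zero)
      have "(L m)[m := a b] ! m = (L m)[m := a b] ! n"
        using m lenL by (simp add: L_def nth_append)
      then show "\<not> distinct ((L m)[m := a b])"
        using m lenL by (metis distinct_conv_nth length_list_update less_SucI lessI less_irrefl)
    qed (simp add: lenL)
    finally show ?case using Suc by simp
  qed simp
  from this[of n] have "\<omega> (L n) = \<omega> (L 0)" by simp
  moreover have "L 0 = map a cs @ [a b]"
    using len by (intro nth_equalityI) (auto simp: L_def nth_append)
  moreover have "L n = map (\<lambda>j. a j - a b) cs @ [a b]"
    using len by (intro nth_equalityI) (auto simp: L_def nth_append)
  ultimately have 1: "\<omega> (map (\<lambda>j. a j - a b) cs @ [a b]) = \<omega> (map a cs @ [a b])" by simp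
  let ?us = "map (\<lambda>j. a j - a b) cs"
  have upd: "(?us @ [0])[n := x] = ?us @ [x]" for x using len by (simp add: list_update_append)
  have linl: "linear (\<lambda>x. \<omega> (?us @ [x]))" using lin[of "?us @ [0]" n] len by (simp add: upd)
  obtain c where c: "v - a b = (\<Sum>k<length ?us. c k *\<^sub>R ?us ! k)"
    using w unfolding span_list_conv by blast
  have z: "\<omega> (?us @ [?us ! k]) = 0" if "k < length ?us" for k
    using that len by (intro zero) auto
  have "\<omega> (?us @ [v]) = \<omega> (?us @ [a b]) + \<omega> (?us @ [v - a b])"
    using linear_add[OF linl, of "a b" "v - a b"] by simp
  also have "\<omega> (?us @ [v - a b]) = (\<Sum>k<length ?us. c k * \<omega> (?us @ [?us ! k]))"
    unfolding c using linear_sum[OF linl, of "\<lambda>k. c k *\<^sub>R ?us ! k" "{..<length ?us}"] linear_scale[OF linl]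
    by simp
  also have "\<dots> = 0" using z by (intro sum.neutral) simp
  finally show ?thesis using 1 by simp
qed

lemma alternating_form_at:
  assumes "alternating_form (Suc n) \<omega>"
  shows "alternating_form n (form_at \<omega> v)"
  unfolding alternating_form_def form_at_def
proof (intro conjI allI impI)
  fix vs :: "'a list" and i assume "length vs = n" "i < n"
  moreover have "linear (\<lambda>x. \<omega> ((vs @ [v])[i := x]))"
    using assms calculation unfolding alternating_form_def by simp
  ultimately show "linear (\<lambda>x. \<omega> (vs[i := x] @ [v]))"
    by (simp add: list_update_append)
next
  fix vs :: "'a list" assume "length vs = n" "\<not> distinct vs"
  then show "\<omega> (vs @ [v]) = 0" using assms unfolding alternating_form_def by simp
qed

text \<open>As \<open>f\<close> is 1 on all labels, the coefficients of an element of
  \<open>W\<close> sum to 0; solving for the coefficient of \<open>a b\<close> rewrites the element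
  in edge vectors.\<close>

lemma edge_vectors_basis_list:
  fixes a :: "'m::finite \<Rightarrow> 'v::euclidean_space"
  assumes W: "W = {w. f \<bullet> w = 0}" "dim W = n" and flat: "\<And>j. f \<bullet> a j = 1"
    and basis: "basis_list UNIV (map a (cs @ [b]))" and len: "length cs = n"
  shows "basis_list W (map (\<lambda>j. a j - a b) cs)"
proof (rule basis_listI)
  let ?us = "map (\<lambda>j. a j - a b) cs"
  have sub: "subspace W" unfolding W by (rule subspace_hyperplane)
  show "span (set ?us) = W"
  proof
    have "set ?us \<subseteq> W" by (auto simp: W flat inner_diff_right)
    then show "span (set ?us) \<subseteq> W" using sub by (rule span_minimal)
    show "W \<subseteq> span (set ?us)"
    proof
      fix w assume w: "w \<in> W"
      have "w \<in> span (set (map a (cs @ [b])))" using basis by (simp add: basis_list_def)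
      then obtain c where "w = (\<Sum>k<length (map a (cs @ [b])). c k *\<^sub>R map a (cs @ [b]) ! k)"
        unfolding span_list_conv by blast
      then have c: "w = (\<Sum>k<n. c k *\<^sub>R a (cs ! k)) + c n *\<^sub>R a b"
        using len by (simp add: nth_append)
      have "f \<bullet> w = 0" using w by (simp add: W)
      then have "c n = - (\<Sum>k<n. c k)" by (simp add: c inner_add_right inner_sum_right flat)
      then have "w = (\<Sum>k<n. c k *\<^sub>R (a (cs ! k) - a b))"
        unfolding c by (simp add: scaleR_diff_right sum_subtractf scaleR_sum_left)
      also have "\<dots> = (\<Sum>k<length ?us. c k *\<^sub>R ?us ! k)" using len by simp
      finally show "w \<in> span (set ?us)" unfolding span_list_conv by blast
    qed
  qed
  show "length ?us = dim W" using W len by simp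
qed

section \<open>Coefficients of the flat-arrangement polynomial\<close>

locale flat_arrangement_volume = flat_mixed_volume W \<eta> n f v MV
  for W :: "'v::euclidean_space set" and \<eta> n f v MV +
  fixes a :: "'m::finite \<Rightarrow> 'v" and \<rho> :: "real ^ 'm" and \<omega> :: "'v list \<Rightarrow> real"
  assumes flat: "\<And>j. f \<bullet> a j = 1" and gen: "circuit_generic a \<rho>"
    and n: "DIM('v) = Suc n" and n_pos: "0 < n" and \<omega>: "alternating_form (Suc n) \<omega>" and \<eta>: "\<eta> = form_at \<omega> v"
begin

lemma MV_basis_cell:
  assumes B: "B \<in> bases a"
  shows "MV (map (\<lambda>k. convex hull ((\<lambda>J. \<Sum>j\<in>J. a j - v) ` {J. J \<subseteq> B \<and> card J = Suc k})) [0..<n])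
    = basis_weight a \<omega> B"
proof -
  define bs where "bs = (SOME bs. distinct bs \<and> set bs = B)"
  have "distinct bs \<and> set bs = B"
    unfolding bs_def by (rule someI_ex) (use finite_distinct_list[of B] in auto)
  then have bs: "distinct bs" "set bs = B" by auto
  have "length bs = Suc n" using bs B distinct_card[of bs] n by (simp add: bases_def)
  then obtain cs b where csb: "bs = cs @ [b]" "length cs = n" by (metis length_Suc_conv_rev)
  have cs: "distinct cs" "b \<notin> set cs" "insert b (set cs) = B" using bs csb by auto
  have basis: "basis_list W (map (\<lambda>j. a j - a b) cs)"
    using basis_list_of_bases[OF B bs] csb W_eq dim_W flat
    by (intro edge_vectors_basis_list) auto
  \<comment> \<open>The point with \<open>f\<close>-value 1 only normalizes the functionals in this
    locale, so \<open>a b\<close> may take the place of \<open>v\<close> while \<eta> stays the form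
    at the original \<open>v\<close>.\<close>
  interpret edge: flat_mixed_volume W \<eta> n f "a b" MV
    by standard (rule W_eq, rule flat)
  have weight: "basis_weight a \<omega> B = \<bar>\<eta> (map (\<lambda>j. a j - a b) cs)\<bar>"
  proof -
    have "v - a b \<in> span (set (map (\<lambda>j. a j - a b) cs))"
      using basis flat fv by (simp add: basis_list_def W_eq inner_diff_right)
    from alternating_form_edge_vectors[OF \<omega> csb(2) this] show ?thesis
      by (simp add: basis_weight_def bs_def[symmetric] csb(1) \<eta> form_at_def)
  qed
  let ?S = "\<lambda>k. {J. J \<subseteq> B \<and> card J = Suc k}"
  let ?K = "\<lambda>k. convex hull ((\<lambda>J. \<Sum>j\<in>J. a j - a b) ` ?S k)"
  have body: "?K k \<in> convex_bodies W" if k: "k < n" for k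
  proof (intro convex_hull_convex_body W)
    have "Suc k \<le> card B" using k B n by (simp add: bases_def)
    then obtain J where "J \<subseteq> B" "card J = Suc k" by (metis obtain_subset_with_card_n)
    then show "(\<lambda>J. \<Sum>j\<in>J. a j - a b) ` ?S k \<noteq> {}" by blast
    show "(\<lambda>J. \<Sum>j\<in>J. a j - a b) ` ?S k \<subseteq> W"
      by (auto simp: W_eq inner_sum_right inner_diff_right flat)
  qed simp
  \<comment> \<open>All vertices of a hypersimplex are sums of equally many labels, so changing the
    base point is one common translation.\<close>
  have "convex hull ((\<lambda>J. \<Sum>j\<in>J. a j - v) ` ?S k) = (+) (real (Suc k) *\<^sub>R (a b - v)) ` ?K k" for k
  proof -
    have "(\<Sum>j\<in>J. a j - v) = real (Suc k) *\<^sub>R (a b - v) + (\<Sum>j\<in>J. a j - a b)" if "card J = Suc k" for J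
      using that by (simp add: sum_subtractf sum_constant_scaleR algebra_simps)
    then have "(\<lambda>J. \<Sum>j\<in>J. a j - v) ` ?S k = (\<lambda>J. real (Suc k) *\<^sub>R (a b - v) + (\<Sum>j\<in>J. a j - a b)) ` ?S k"
      by (intro image_cong) auto
    then show ?thesis by (simp only: convex_hull_translate)
  qed
  then have "MV (map (\<lambda>k. convex hull ((\<lambda>J. \<Sum>j\<in>J. a j - v) ` ?S k)) [0..<n])
      = MV (map (\<lambda>k. (+) (real (Suc k) *\<^sub>R (a b - v)) ` ?K k) [0..<n])"
    by simp
  also have "\<dots> = MV (map ?K [0..<n])"
    using body fv flat by (intro MV_translate) (auto simp: W_eq inner_diff_right)
  also have "\<dots> = \<bar>\<eta> (map (\<lambda>j. a j - a b) cs)\<bar>"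
    using edge.MV_simplex[OF cs(1,2) refl basis] by (simp only: cs(3))
  finally show ?thesis using weight by simp
qed

lemma ex1_basis_slope:
  assumes B: "B \<in> bases a"
  shows "\<exists>!y. y \<bullet> v = 0 \<and> (\<exists>c. \<forall>b\<in>B. y \<bullet> a b + \<rho> $ b = c)"
    and "\<forall>b\<in>B. y \<bullet> a b + \<rho> $ b = c \<Longrightarrow>
      {j. y \<bullet> a j + \<rho> $ j = c} = B \<and> card {j. c < y \<bullet> a j + \<rho> $ j} = ext_act a \<rho> B"
proof -
  obtain bs where bs: "distinct bs" "set bs = B" using finite_distinct_list[of B] by auto
  note basis = basis_list_of_bases[OF B bs]
  have lenbs: "length bs = Suc n" using bs B distinct_card[of bs] n by (simp add: bases_def)
  then obtain cs b where csb: "bs = cs @ [b]" "length cs = n" by (metis length_Suc_conv_rev)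
  have edge: "basis_list W (map (\<lambda>j. a j - a b) cs)"
    using basis csb W_eq dim_W flat by (intro edge_vectors_basis_list) auto
  have iff: "(\<exists>c. \<forall>b\<in>B. y \<bullet> a b + \<rho> $ b = c)
      \<longleftrightarrow> (\<forall>k<n. y \<bullet> map (\<lambda>j. a j - a b) cs ! k = \<rho> $ b - \<rho> $ (cs ! k))" for y
  proof
    assume "\<exists>c. \<forall>b\<in>B. y \<bullet> a b + \<rho> $ b = c"
    then obtain c where c: "\<And>j. j \<in> B \<Longrightarrow> y \<bullet> a j + \<rho> $ j = c" by blast
    have "y \<bullet> a (cs ! k) - y \<bullet> a b = \<rho> $ b - \<rho> $ (cs ! k)" if "k < n" for k
      using c[of b] c[of "cs ! k"] that bs csb by auto
    then show "\<forall>k<n. y \<bullet> map (\<lambda>j. a j - a b) cs ! k = \<rho> $ b - \<rho> $ (cs ! k)"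
      using csb by (simp add: inner_diff_right)
  next
    assume *: "\<forall>k<n. y \<bullet> map (\<lambda>j. a j - a b) cs ! k = \<rho> $ b - \<rho> $ (cs ! k)"
    have "y \<bullet> a j + \<rho> $ j = y \<bullet> a b + \<rho> $ b" if "j \<in> B" for j
    proof (cases "j = b")
      case False
      then have "j \<in> set cs" using that bs csb by auto
      then obtain k where "k < n" "j = cs ! k" using csb by (auto simp: in_set_conv_nth)
      then show ?thesis using * csb by (auto simp: inner_diff_right)
    qed simp
    then show "\<exists>c. \<forall>b\<in>B. y \<bullet> a b + \<rho> $ b = c" by blast
  qed
  show "\<exists>!y. y \<bullet> v = 0 \<and> (\<exists>c. \<forall>b\<in>B. y \<bullet> a b + \<rho> $ b = c)"
    unfolding iff by (rule ex1_functional[OF edge])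
  assume c: "\<forall>b\<in>B. y \<bullet> a b + \<rho> $ b = c"
  let ?T = "{j. y \<bullet> a j + \<rho> $ j = c}"
  \<comment> \<open>Genericity bounds the number of tied labels by the dimension, which
    \<open>B\<close> already attains; no other label can lie on its level.\<close>
  have T: "inj_on a ?T" "independent (a ` ?T)"
    using tied_labels_independent[OF gen flat, of ?T y c] by auto
  have "card ?T \<le> card B"
    using independent_bound[OF T(2)] card_image[OF T(1)] B by (simp add: bases_def)
  moreover have "B \<subseteq> ?T" using c by auto
  ultimately have TB: "?T = B" using card_seteq[of ?T B] by simp
  \<comment> \<open>Subtracting \<open>c *\<^sub>R f\<close> moves the tied level to 0, so the sign
    in \<open>ext_act\<close> decides whether a label is above the level.\<close>
  have z: "(y - c *\<^sub>R f) \<bullet> a j = - \<rho> $ j" if "j \<in> B" for j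
    using bspec[OF c that] flat by (simp add: inner_diff_left)
  have "{j. c < y \<bullet> a j + \<rho> $ j} = {j. j \<notin> B \<and> \<rho> \<bullet> fund_circuit a B j > 0}"
  proof (rule Collect_cong)
    fix j
    show "c < y \<bullet> a j + \<rho> $ j \<longleftrightarrow> j \<notin> B \<and> \<rho> \<bullet> fund_circuit a B j > 0"
    proof (cases "j \<in> B")
      case True then show ?thesis using c by auto
    next
      case False
      have "\<rho> \<bullet> fund_circuit a B j = y \<bullet> a j + \<rho> $ j - c"
        using inner_fund_circuit[OF B False z] flat by (simp add: inner_diff_left)
      then show ?thesis using False by simp
    qed
  qed
  then show "?T = B \<and> card {j. c < y \<bullet> a j + \<rho> $ j} = ext_act a \<rho> B"
    using TB by (simp add: ext_act_def)
qed

lemma tied_labels_bases: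
  assumes "Suc n \<le> card {j. y \<bullet> a j + \<rho> $ j = c}"
  shows "{j. y \<bullet> a j + \<rho> $ j = c} \<in> bases a"
proof -
  let ?T = "{j. y \<bullet> a j + \<rho> $ j = c}"
  have T: "inj_on a ?T" "independent (a ` ?T)"
    using tied_labels_independent[OF gen flat, of ?T y c] by auto
  have card: "card ?T = Suc n"
    using assms independent_bound[OF T(2)] card_image[OF T(1)] n by simp
  obtain ts where ts: "distinct ts" "set ts = ?T" using finite_distinct_list[of ?T] by auto
  have "UNIV \<subseteq> span (a ` ?T)"
    using card card_image[OF T(1)] T(2) n by (intro card_ge_dim_independent) auto
  then have "basis_list UNIV (map a ts)"
    using ts T distinct_card[of ts] by (auto simp: basis_list_def distinct_map)
  from bases_of_basis_list[OF ts(1) this] show ?thesis by (simp add: ts)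
qed

theorem coeff_flat_poly:
  assumes i: "i + Suc n \<le> CARD('m)"
  shows "coeff (flat_poly a \<omega> \<rho>) i = MV (map (\<lambda>k. proj_hypersimplex a v (i + Suc k)) [0..<n])"
proof -
  define p where "p I = (\<Sum>j\<in>I. a j - v)" for I
  define S :: "nat \<Rightarrow> 'm set set" where "S k = {I. I \<subseteq> UNIV \<and> card I = i + Suc k}" for k
  define val where "val y j = y \<bullet> a j + \<rho> $ j" for y j
  define h where "h I = (\<Sum>j\<in>I. \<rho> $ j)" for I
  define F where "F y k = convex hull (p ` maximizers (S k) (\<lambda>I. y \<bullet> p I + h I))" for y k
  define Bs where "Bs = {B \<in> bases a. ext_act a \<rho> B = i}"
  define Yof where "Yof B = (THE y. y \<bullet> v = 0 \<and> (\<exists>c. \<forall>b\<in>B. y \<bullet> a b + \<rho> $ b = c))" for B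
  have Yof: "Yof B \<bullet> v = 0 \<and> (\<exists>c. \<forall>b\<in>B. Yof B \<bullet> a b + \<rho> $ b = c)" if "B \<in> bases a" for B
    unfolding Yof_def using ex1_basis_slope(1)[OF that] by (rule theI')
  have pW: "p I \<in> W" for I
    by (simp add: p_def W_eq inner_sum_right inner_diff_right flat fv)
  have neS: "S k \<noteq> {}" if "k < n" for k
  proof -
    have "i + Suc k \<le> card (UNIV :: 'm set)" using that i by simp
    then obtain I :: "'m set" where "card I = i + Suc k" by (metis obtain_subset_with_card_n)
    then show ?thesis by (auto simp: S_def)
  qed
  have F_body: "F y k \<in> convex_bodies W" if "k < n" for y k
    unfolding F_def using pW maximizers_nonempty[of "S k"] neS[OF that]
    by (intro convex_hull_convex_body W) auto
  \<comment> \<open>A slope is orthogonal to \<open>v\<close>, so the shift from \<open>a j\<close>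
    to \<open>a j - v\<close> is invisible to it and heights add over the labels.\<close>
  have max_eq: "maximizers (S k) (\<lambda>I. y \<bullet> p I + h I) = maximizers (S k) (sum (val y))" if "y \<bullet> v = 0" for y k
  proof -
    have "(\<lambda>I. y \<bullet> p I + h I) = sum (val y)"
      using that by (simp add: fun_eq_iff p_def h_def val_def inner_sum_right inner_diff_right sum.distrib)
    then show ?thesis by simp
  qed
  have cell: "MV (map (F (Yof B)) [0..<n]) = basis_weight a \<omega> B" if B: "B \<in> Bs" for B
  proof -
    have Bb: "B \<in> bases a" and ext: "ext_act a \<rho> B = i" using B by (auto simp: Bs_def)
    let ?y = "Yof B"
    obtain c where yv: "?y \<bullet> v = 0" and c: "\<forall>b\<in>B. ?y \<bullet> a b + \<rho> $ b = c" using Yof[OF Bb] by blast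
    let ?A = "{j. c < val ?y j}"
    have tie: "{j. val ?y j = c} = B" and cA: "card ?A = i"
      using ex1_basis_slope(2)[OF Bb c] ext by (auto simp: val_def)
    have cB: "card B = Suc n" using Bb n by (simp add: bases_def)
    have dis: "?A \<inter> B = {}" using c by (force simp: val_def)
    \<comment> \<open>The \<open>i\<close> labels above the level belong to every optimal set, and
      exactly \<open>Suc k\<close> more are free to be chosen from \<open>B\<close>.\<close>
    have "F ?y k = (+) (p ?A) ` (convex hull (p ` {J. J \<subseteq> B \<and> card J = Suc k}))" if k: "k < n" for k
    proof -
      have "maximizers (S k) (sum (val ?y)) = (\<lambda>J. ?A \<union> J) ` {J. J \<subseteq> B \<and> card J = Suc k}"
        using maximizers_sum_subsets[of "UNIV :: 'm set" c "val ?y" "i + Suc k"] k cB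
        by (simp add: tie cA S_def)
      then have "F ?y k = convex hull ((\<lambda>J. p (?A \<union> J)) ` {J. J \<subseteq> B \<and> card J = Suc k})"
        unfolding F_def max_eq[OF yv] by (simp add: image_image)
      also have "(\<lambda>J. p (?A \<union> J)) ` {J. J \<subseteq> B \<and> card J = Suc k} = (\<lambda>J. p ?A + p J) ` {J. J \<subseteq> B \<and> card J = Suc k}"
      proof (rule image_cong)
        fix J assume "J \<in> {J. J \<subseteq> B \<and> card J = Suc k}"
        then have "?A \<inter> J = {}" using dis by blast
        then show "p (?A \<union> J) = p ?A + p J" unfolding p_def by (intro sum.union_disjoint) auto
      qed simp
      finally show ?thesis by (simp only: convex_hull_translate)
    qed
    then have "MV (map (F ?y) [0..<n]) = MV (map (\<lambda>k. (+) (p ?A) ` (convex hull (p ` {J. J \<subseteq> B \<and> card J = Suc k}))) [0..<n])"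
      by (intro arg_cong[of _ _ MV] map_cong) auto
    also have "\<dots> = MV (map (\<lambda>k. convex hull (p ` {J. J \<subseteq> B \<and> card J = Suc k})) [0..<n])"
    proof (rule MV_translate[OF _ pW])
      fix k assume "k < n"
      then have "Suc k \<le> card B" using cB by simp
      then obtain J where "J \<subseteq> B" "card J = Suc k" by (metis obtain_subset_with_card_n)
      then show "convex hull (p ` {J. J \<subseteq> B \<and> card J = Suc k}) \<in> convex_bodies W"
        using pW by (intro convex_hull_convex_body W) auto
    qed
    also have "\<dots> = basis_weight a \<omega> B"
      using MV_basis_cell[OF Bb] by (simp add: p_def[abs_def])
    finally show ?thesis .
  qed
  have inj: "inj_on Yof Bs"
  proof (rule inj_onI)
    fix B B' assume B: "B \<in> Bs" "B' \<in> Bs" and eq: "Yof B = Yof B'"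
    then have Bb: "B \<in> bases a" "B' \<in> bases a" by (auto simp: Bs_def)
    obtain c c' where c: "\<forall>b\<in>B. Yof B \<bullet> a b + \<rho> $ b = c" and c': "\<forall>b\<in>B'. Yof B \<bullet> a b + \<rho> $ b = c'"
      using Yof[OF Bb(1)] Yof[OF Bb(2)] eq by auto
    let ?G = "\<lambda>c. {j. c < Yof B \<bullet> a j + \<rho> $ j}"
    have T: "{j. Yof B \<bullet> a j + \<rho> $ j = c} = B" "card (?G c) = i"
      "{j. Yof B \<bullet> a j + \<rho> $ j = c'} = B'" "card (?G c') = i"
      using ex1_basis_slope(2)[OF Bb(1) c] ex1_basis_slope(2)[OF Bb(2) c'] Yof[OF Bb(1)] B
      by (auto simp: Bs_def)
    \<comment> \<open>Labels tied at the higher level lie strictly above the lower one, so two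
      levels of one slope cannot have equally many labels above them.\<close>
    have less: "\<not> c1 < c2" if "card (?G c1) = i" "card (?G c2) = i" "{j. Yof B \<bullet> a j + \<rho> $ j = c2} \<noteq> {}" for c1 c2
    proof
      assume "c1 < c2"
      then have "?G c2 \<subset> ?G c1" using that(3) by force
      then have "card (?G c2) < card (?G c1)" by (intro psubset_card_mono) auto
      then show False using that by simp
    qed
    have "B \<noteq> {}" "B' \<noteq> {}" using Bb n by (auto simp: bases_def)
    then have "c = c'" using less[of c c'] less[of c' c] T by auto
    then show "B = B'" using T by simp
  qed
  have out: "MV (map (F y) [0..<n]) = 0" if yv: "y \<bullet> v = 0" and y: "y \<notin> Yof ` Bs" for y
  proof (rule ccontr)
    assume nz: "MV (map (F y) [0..<n]) \<noteq> 0"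
    let ?G = "\<lambda>\<tau>. card {j. \<tau> < val y j}" and ?E = "\<lambda>\<tau>. card {j. \<tau> \<le> val y j}"
    have "\<exists>\<tau>. ?G \<tau> < i + Suc k \<and> i + Suc k < ?E \<tau>" if k: "k < n" for k
    proof -
      let ?M = "maximizers (S k) (sum (val y))"
      obtain J1 where J1: "J1 \<in> ?M" using maximizers_nonempty[OF _ neS[OF k]] by auto
      have "\<exists>J2\<in>?M. J2 \<noteq> J1"
      proof (rule ccontr)
        assume "\<not> ?thesis"
        then have "?M = {J1}" using J1 by blast
        then have "F y k = {p J1}" by (simp add: F_def max_eq[OF yv])
        then have "MV (map (F y) [0..<n]) = 0" using F_body k by (intro MV_point[of "F y" k "p J1"])
        then show False using nz by contradiction
      qed
      then obtain J2 where J2: "J2 \<in> ?M" "J1 \<noteq> J2" by blast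
      show ?thesis
        using tie_of_two_maximizers[of "UNIV :: 'm set" J1 "i + Suc k" "val y" J2] J1 J2
        unfolding S_def by auto
    qed
    then have "\<forall>k\<in>{..<n}. \<exists>\<tau>. ?G \<tau> < i + Suc k \<and> i + Suc k < ?E \<tau>" by blast
    from bchoice[OF this] obtain \<tau> where \<tau>: "\<forall>k\<in>{..<n}. ?G (\<tau> k) < i + Suc k \<and> i + Suc k < ?E (\<tau> k)" ..
    have EG: "?E t \<le> ?G s" if "s < t" for s t using that by (intro card_mono) auto
    \<comment> \<open>In decreasing order, slot \<open>k\<close> ties the positions
      \<open>i + k + 1\<close> and \<open>i + k + 2\<close>. Adjacent slots share a position, so all
      of them have the same level.\<close>
    have const: "\<tau> k = \<tau> 0" if "k < n" for k
      using that
    proof (induction k)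
      case (Suc k)
      have k: "?G (\<tau> k) < i + Suc k" "i + Suc k < ?E (\<tau> k)"
        "?G (\<tau> (Suc k)) < i + Suc (Suc k)" "i + Suc (Suc k) < ?E (\<tau> (Suc k))"
        using bspec[OF \<tau>, of k] bspec[OF \<tau>, of "Suc k"] Suc.prems by auto
      have "\<not> \<tau> k < \<tau> (Suc k)" using EG[of "\<tau> k" "\<tau> (Suc k)"] k by auto
      moreover have "\<not> \<tau> (Suc k) < \<tau> k" using EG[of "\<tau> (Suc k)" "\<tau> k"] k by auto
      ultimately show ?case using Suc by simp
    qed simp

    define c where "c = \<tau> 0"
    \<comment> \<open>The first slot bounds the labels above the level and the last slot those on or
      above it; this leaves at least \<open>n + 1\<close> tied labels, and independence allows no
      more.\<close>
    have G: "?G c \<le> i" using bspec[OF \<tau>, of 0] n_pos by (auto simp: c_def)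
    have E: "i + Suc n \<le> ?E c"
    proof -
      have "i + Suc (n - 1) < ?E (\<tau> (n - 1))" using bspec[OF \<tau>, of "n - 1"] n_pos by auto
      then show ?thesis using const[of "n - 1"] n_pos by (simp add: c_def)
    qed
    let ?T = "{j. y \<bullet> a j + \<rho> $ j = c}"
    have split: "?E c = ?G c + card ?T"
    proof -
      have "{j. c \<le> val y j} = {j. c < val y j} \<union> ?T" by (auto simp: val_def)
      moreover have "{j. c < val y j} \<inter> ?T = {}" by (auto simp: val_def)
      ultimately show ?thesis by (simp add: card_Un_disjoint)
    qed
    have Tb: "?T \<in> bases a" using split E G by (intro tied_labels_bases) simp
    have "card ?T = Suc n" using Tb n by (simp add: bases_def)
    then have "?G c = i" using split E G by simp
    moreover have "?G c = ext_act a \<rho> ?T"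
      using ex1_basis_slope(2)[OF Tb, of y c] by (simp add: val_def)
    ultimately have "?T \<in> Bs" using Tb by (simp add: Bs_def)
    moreover have "y = Yof ?T"
      using ex1_basis_slope(1)[OF Tb] Yof[OF Tb] yv by blast
    ultimately show False using y by blast
  qed
  have "MV (map (\<lambda>k. convex hull (p ` S k)) [0..<n]) = (\<Sum>y\<in>Yof ` Bs. MV (map (F y) [0..<n]))"
    unfolding F_def[abs_def]
  proof (rule MV_mixed_subdivision)
    show "Yof ` Bs \<subseteq> {y. y \<bullet> v = 0}" using Yof by (auto simp: Bs_def)
    show "MV (map (\<lambda>k. convex hull (p ` maximizers (S k) (\<lambda>I. y \<bullet> p I + h I))) [0..<n]) = 0"
      if "y \<bullet> v = 0" "y \<notin> Yof ` Bs" for y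
      using out[OF that] by (simp add: F_def[abs_def])
  qed (use neS pW in auto)
  also have "\<dots> = (\<Sum>B\<in>Bs. basis_weight a \<omega> B)"
    using inj cell by (simp add: sum.reindex)
  also have "\<dots> = (\<Sum>B\<in>bases a. if ext_act a \<rho> B = i then basis_weight a \<omega> B else 0)"
    unfolding Bs_def by (rule sum.inter_filter) simp
  also have "\<dots> = coeff (flat_poly a \<omega> \<rho>) i"
    unfolding flat_poly_def coeff_sum coeff_monom ..
  also have "(\<lambda>k. convex hull (p ` S k)) = (\<lambda>k. proj_hypersimplex a v (i + Suc k))"
    by (intro ext) (auto simp: proj_hypersimplex_def p_def S_def intro!: arg_cong[of _ _ "(hull) convex"])
  finally show ?thesis ..
qed

end

theorem theorem1p3:
  fixes a :: "'m::finite \<Rightarrow> 'v::euclidean_space"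
    and \<omega> :: "'v list \<Rightarrow> real"
    and \<phi> :: "'v \<Rightarrow> real"
    and v :: 'v
    and W :: "'v set"
    and \<rho> :: "real ^ 'm"
    and MV :: "'v set list \<Rightarrow> real"
    and n r i :: nat
  assumes "DIM('v) \<ge> 2"
    and "alternating_form DIM('v) \<omega>" and "nonzero_form DIM('v) \<omega>"
    and "flat_arrangement a \<phi>"
    and "\<phi> v = 1"
    and "W = {w. \<phi> w = 0}"
    and "n = DIM('v) - 1"
    and "r = CARD('m) - DIM('v)"
    and "circuit_generic a \<rho>"
    and "is_mixed_volume W (density_measure W (form_at \<omega> v)) MV"
    and "i \<le> r"
  shows "coeff (flat_poly a \<omega> \<rho>) i = MV (map (proj_hypersimplex a v) [i + 1..<i + n + 1])"
proof -
  have n: "DIM('v) = Suc n" "0 < n" using assms(1,7) by auto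
  have lin: "linear \<phi>" and flat: "\<phi> (a j) = 1" and surj: "surj (arr_map a)" for j
    using assms(4) by (auto simp: flat_arrangement_def)
  \<comment> \<open>The inner product serves only to write functionals as vectors.\<close>
  define f where "f = (\<Sum>b\<in>Basis. \<phi> b *\<^sub>R b)"
  have f: "\<phi> x = f \<bullet> x" for x
  proof -
    have "\<phi> x = \<phi> (\<Sum>b\<in>Basis. (x \<bullet> b) *\<^sub>R b)" by (simp add: euclidean_representation)
    also have "\<dots> = (\<Sum>b\<in>Basis. (x \<bullet> b) * \<phi> b)"
      using linear_sum[OF lin, of "\<lambda>b. (x \<bullet> b) *\<^sub>R b" Basis] linear_scale[OF lin] by simp
    also have "\<dots> = f \<bullet> x" by (simp add: f_def inner_sum_left inner_commute[of x] mult.commute)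
    finally show ?thesis .
  qed
  have W: "W = {w. f \<bullet> w = 0}" using assms(6) by (simp add: f)
  have fv: "f \<bullet> v = 1" using assms(5) by (simp add: f)
  have "f \<noteq> 0" using fv by auto
  then have dimW: "dim W = n" unfolding W using n by (simp add: dim_hyperplane)
  have alt: "alternating_form (Suc n) \<omega>" using assms(2) n by simp
  \<comment> \<open>This keeps the natural-number subtraction in \<open>r\<close> from truncating,
    so that \<open>i \<le> r\<close> leaves enough labels for the last hypersimplex.\<close>
  have "DIM('v) \<le> CARD('m)"
  proof -
    have "UNIV \<subseteq> span (range a)"
    proof
      fix x :: 'v
      obtain z where "x = arr_map a z" using surj by (metis surjD)
      then show "x \<in> span (range a)"
        unfolding arr_map_def by (simp add: span_sum span_scale span_base)
    qed
    then have "DIM('v) \<le> card (range a)" using dim_le_card[of UNIV "range a"] by simp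
    also have "\<dots> \<le> CARD('m)" by (rule card_image_le) simp
    finally show ?thesis .
  qed
  then have card: "i + Suc n \<le> CARD('m)" using assms(8,11) n by simp
  interpret flat_arrangement_volume W "form_at \<omega> v" n f v MV a \<rho> \<omega>
  proof
    show "subspace W" unfolding W by (rule subspace_hyperplane)
    show "f \<bullet> a j = 1" for j using flat[of j] by (simp only: f)
  qed (fact dimW W fv n alternating_form_at[OF alt] alt assms(9,10) refl)+
  have "map (proj_hypersimplex a v) [i + 1..<i + n + 1] = map (\<lambda>k. proj_hypersimplex a v (i + Suc k)) [0..<n]"
    by (intro nth_equalityI) (auto simp del: upt_Suc)
  then show ?thesis using coeff_flat_poly[OF card] by simp
qed

end
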